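(* For all $g,p$ with $2g-2+p>0$, $$\operatorname{diam}_W\big(\mathrm{Graph}(g,p)/\mathrm{Sym}_p\big)\ \asymp\ g\log(g+p)+(g+p).$$
   Context: Here $g,p\ge0$ are integers, and $a\asymp b$ means $\frac1K b\le a\le K b$ for a uniform constant $K$ (independent of $g$ and $p$). $\mathrm{Graph}(g,p)/\mathrm{Sym}_p$ is the set of connected graphs (loops and multiple edges allowed) of rank $g$ (first Betti number) with exactly $p$ valence-1 vertices (unlabeled) and $2g-2+p$ valence-3 vertices, up to isomorphism; it is the quotient by the symmetric group $\mathrm{Sym}_p$ of the set $\mathrm{Graph}(g,p)$ of such graphs with labeled valence-1 vertices. An edge is interior if both its endpoints have valence three. A Whitehead move on an interior edge $e$ with distinct endpoints collapses $e$ to a valence-4 vertex and reopens it in one of the two other ways of splitting the four incident half-edges into two pairs. $d_W(\Gamma_1,\Gamma_2)$ is the minimal number of Whitehead moves transforming $\Gamma_1$ into $\Gamma_2$, and $\operatorname{diam}_W$ is the diameter with respect to $d_W$.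
   Formalization: The lower bound is not claimed for (g,p) = (0,3), (0,4), (0,5), (1,1): there the set of graphs has exactly one element, so the diameter is 0 while g log(g+p)+(g+p) > 0; the upper bound is claimed for all (g,p). *)

theory Defs
  imports "Graph_Theory.Graph_Theory" "HOL-Library.Extended_Real"
begin

text \<open>
  A graph with loops and multiple edges is a pair \<open>(G, r)\<close>, where \<open>G\<close> is a digraph whose arcs are
  the half-edges (an arc \<open>a\<close> is attached to \<open>tail G a\<close>) and the fixed-point free involution \<open>r\<close>
  matches the two halves of an edge.  A loop thus consists of two distinct arcs, so that
  \<^const>\<open>out_degree\<close> is the valence, to which a loop contributes 2.  Every finite graph is
  isomorphic to one whose vertices and half-edges are natural numbers, so isomorphism classes are
  formed over that carrier.
\<close>

type_synonym multigraph = "(nat, nat) pre_digraph \<times> (nat \<Rightarrow> nat)"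

definition edges :: "multigraph \<Rightarrow> nat set set" where
  "edges \<equiv> \<lambda>(G, r). (\<lambda>a. {a, r a}) ` arcs G"

text \<open>The strongly connected components of a symmetric digraph are its connected components.\<close>

definition first_betti :: "multigraph \<Rightarrow> int" where
  "first_betti \<equiv> \<lambda>(G, r). int (card (edges (G, r))) - int (card (verts G))
     + int (card (pre_digraph.sccs_verts G))"

definition valence_verts :: "multigraph \<Rightarrow> nat \<Rightarrow> nat set" where
  "valence_verts \<equiv> \<lambda>(G, r) k. {v \<in> verts G. out_degree G v = k}"

definition trivalent_graphs :: "nat \<Rightarrow> nat \<Rightarrow> multigraph set" where
  "trivalent_graphs g p = {(G, r).
     fin_digraph G \<and> bidirected_digraph G r \<and> Digraph_Component.connected G
     \<and> first_betti (G, r) = int g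
     \<and> verts G = valence_verts (G, r) 1 \<union> valence_verts (G, r) 3
     \<and> card (valence_verts (G, r) 1) = p
     \<and> int (card (valence_verts (G, r) 3)) = 2 * int g - 2 + int p}"

text \<open>A \<^const>\<open>digraph_iso\<close> need not respect the matching of half-edges, hence the extra condition.\<close>

definition multigraph_iso :: "multigraph \<Rightarrow> multigraph \<Rightarrow> bool" where
  "multigraph_iso \<equiv> \<lambda>(G, r) (H, s). \<exists>f. pre_digraph.digraph_isomorphism G f \<and> H = app_iso f G
     \<and> (\<forall>a \<in> arcs G. iso_arcs f (r a) = s (iso_arcs f a))"

text \<open>
  The leaves are unlabelled and isomorphisms may permute them, so this is the quotient
  \<open>Graph(g,p)/Sym\<^sub>p\<close>.
\<close>

definition graph_classes :: "nat \<Rightarrow> nat \<Rightarrow> multigraph set set" where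
  "graph_classes g p = trivalent_graphs g p //
     {(\<Gamma>, \<Delta>). \<Gamma> \<in> trivalent_graphs g p \<and> \<Delta> \<in> trivalent_graphs g p \<and> multigraph_iso \<Gamma> \<Delta>}"

text \<open>
  For the edge \<open>{e, r e}\<close> with distinct trivalent endpoints, the four half-edges that meet at the
  valence-4 vertex after collapsing, partitioned into pairs by the endpoint they belong to.
\<close>

definition splitting :: "multigraph \<Rightarrow> nat \<Rightarrow> nat set set" where
  "splitting \<equiv> \<lambda>(G, r) e. {out_arcs G (tail G e) - {e}, out_arcs G (head G e) - {r e}}"

text \<open>
  Collapsing and reopening the edge \<open>{e, r e}\<close> is described on a fixed set of vertices and
  half-edges: only the four half-edges around the edge are reattached, in pairs, to its endpoints,
  and the partition into pairs changes.  The two halves of an edge may both be among these four, as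
  happens for a loop at an endpoint or for an edge parallel to \<open>{e, r e}\<close>.
\<close>

definition whitehead_move :: "multigraph \<Rightarrow> multigraph \<Rightarrow> bool" where
  "whitehead_move \<equiv> \<lambda>(G, r) (H, s). \<exists>e \<in> arcs G.
     tail G e \<noteq> head G e \<and> out_degree G (tail G e) = 3 \<and> out_degree G (head G e) = 3
     \<and> verts H = verts G \<and> arcs H = arcs G \<and> s = r \<and> bidirected_digraph H s
     \<and> tail H e = tail G e \<and> head H e = head G e
     \<and> (\<forall>a \<in> arcs G - {e, r e} - \<Union> (splitting (G, r) e). tail H a = tail G a)
     \<and> \<Union> (splitting (H, s) e) = \<Union> (splitting (G, r) e)
     \<and> (\<forall>P \<in> splitting (H, s) e. card P = 2)
     \<and> splitting (H, s) e \<noteq> splitting (G, r) e"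

definition whitehead_step :: "nat \<Rightarrow> nat \<Rightarrow> (multigraph set) rel" where
  "whitehead_step g p = {(C, D). C \<in> graph_classes g p \<and> D \<in> graph_classes g p
     \<and> (\<exists>\<Gamma> \<in> C. \<exists>\<Delta> \<in> D. whitehead_move \<Gamma> \<Delta>)}"

definition whitehead_dist :: "nat \<Rightarrow> nat \<Rightarrow> multigraph set \<Rightarrow> multigraph set \<Rightarrow> enat" where
  "whitehead_dist g p C D = (INF n \<in> {n. (C, D) \<in> whitehead_step g p ^^ n}. enat n)"

definition whitehead_diam :: "nat \<Rightarrow> nat \<Rightarrow> enat" where
  "whitehead_diam g p = (SUP (C, D) \<in> graph_classes g p \<times> graph_classes g p. whitehead_dist g p C D)"

end

theory Submission
  imports Defs "HOL-Library.Multiset"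
begin

text \<open>
  Upper bound: a spanning tree turns a graph into a binary tree whose \<open>2g + p\<close> leaves are half-edges,
  and a Whitehead move on an edge of the spanning tree is a rotation of the binary tree.  Linearly
  many rotations balance the tree; then the two halves of each of the \<open>g\<close> edges outside the spanning
  tree are pulled to the root, where they form a loop, by \<open>O(log (g + p))\<close> rotations which do not
  increase the depth of the rest.  A tree with the loops first and the leaves of the graph last
  determines the graph.

  Lower bound: a move changes the number of vertices that carry a loop or two leaves by at most two,
  and some graphs have at most two such vertices while others have \<open>g + p div 2\<close> of them; this gives
  the linear term.  For the other term, a sequence of \<open>n\<close> moves is determined, up to moves
  that commute, by the bounded data that each vertex records about the moves it takes part in.
  Hence at most \<open>C ^ (g + p + n)\<close> graphs are reachable in \<open>n\<close> moves, whereas joining \<open>g\<close> pairs of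
  ends of a fixed caterpillar tree yields at least \<open>(c (g + p)) ^ g / C ^ (g + p)\<close> graphs.
\<close>

section \<open>Graphs as half-edges with tails and an involution\<close>

text \<open>Whitehead steps are defined between isomorphism classes, so a path of steps may change
  its representative at every step. Two coordinate systems deal with this. For the upper bound the
  half-edges and the involution stay fixed and only tails change, so that a subtree untouched by a
  move stays literally the same. For the lower bound the tails stay fixed and the involution
  changes, so that a vertex keeps its identity and can carry a record of its moves. The obstacle to
  the entropy bound is that a graph admits of the order of g + p moves: counting sequences naively
  allows (C (g + p)) ^ n graphs after n moves, which yields only n of order g. Forgetting the order
  of independent moves removes the factor g + p. Isomorphisms are the second danger, since
  relabelling could cost a factorial. A caterpillar is rigid enough: an isomorphism from it is fixed
  by the image of one vertex and three choices per slot, hence costs a factor exponential in g + p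
  only.\<close>

definition star :: "nat set \<Rightarrow> (nat \<Rightarrow> nat) \<Rightarrow> nat \<Rightarrow> nat set" where
  "star A t v = {a \<in> A. t a = v}"

text \<open>Connectedness without walks: a set of vertices that is closed under crossing edges and
  meets the graph is everything. In this form it survives a change of tails without rerouting any
  path.\<close>

definition linked :: "nat set \<Rightarrow> (nat \<Rightarrow> nat) \<Rightarrow> (nat \<Rightarrow> nat) \<Rightarrow> bool" where
  "linked A t r \<longleftrightarrow> (\<forall>U. (\<forall>a\<in>A. t a \<in> U \<longrightarrow> t (r a) \<in> U) \<longrightarrow> (\<exists>a\<in>A. t a \<in> U) \<longrightarrow> (\<forall>a\<in>A. t a \<in> U))"

text \<open>Vertices exist only as values of \<open>t\<close> on \<open>A\<close>, and
  \<open>r\<close> fixes every number outside \<open>A\<close>, as the reversal of a bidirected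
  digraph does. The rank enters through the number of trivalent vertices; Euler's formula recovers
  the Betti number in \<open>trivalent_graphs_iff\<close>.\<close>

definition cubic :: "nat \<Rightarrow> nat \<Rightarrow> nat set \<Rightarrow> (nat \<Rightarrow> nat) \<Rightarrow> (nat \<Rightarrow> nat) \<Rightarrow> bool" where
  "cubic g p A t r \<longleftrightarrow> finite A \<and> A \<noteq> {} \<and> (\<forall>a. a \<in> A \<longleftrightarrow> r a \<noteq> a) \<and> (\<forall>a. r (r a) = a)
     \<and> (\<forall>a\<in>A. card (star A t (t a)) \<in> {1, 3}) \<and> linked A t r
     \<and> card {v \<in> t ` A. card (star A t v) = 1} = p
     \<and> int (card {v \<in> t ` A. card (star A t v) = 3}) = 2 * int g - 2 + int p"

text \<open>No map on vertices is carried along: every vertex has a half-edge, so preserving and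
  reflecting equality of tails induces the bijection of vertices.\<close>

definition isomorphic :: "nat set \<Rightarrow> (nat \<Rightarrow> nat) \<Rightarrow> (nat \<Rightarrow> nat) \<Rightarrow> nat set \<Rightarrow> (nat \<Rightarrow> nat) \<Rightarrow> (nat \<Rightarrow> nat) \<Rightarrow> bool" where
  "isomorphic A t r B u s \<longleftrightarrow> (\<exists>\<phi>. bij_betw \<phi> A B \<and> (\<forall>a\<in>A. \<forall>b\<in>A. t a = t b \<longleftrightarrow> u (\<phi> a) = u (\<phi> b))
     \<and> (\<forall>a\<in>A. \<phi> (r a) = s (\<phi> a)))"

lemma cubic_rev_rev: "cubic g p A t r \<Longrightarrow> r (r a) = a"
  and cubic_rev_in: "cubic g p A t r \<Longrightarrow> r a \<in> A \<longleftrightarrow> a \<in> A"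
  and cubic_rev_neq: "cubic g p A t r \<Longrightarrow> a \<in> A \<Longrightarrow> r a \<noteq> a"
  and cubic_outside: "cubic g p A t r \<Longrightarrow> a \<notin> A \<Longrightarrow> r a = a"
  and cubic_finite: "cubic g p A t r \<Longrightarrow> finite A"
  unfolding cubic_def by (blast, metis, blast, blast, blast)

lemma cubic_star_cases:
  assumes "cubic g p A t r" "a \<in> A"
  shows "star A t (t a) = {a} \<or> (\<exists>b c. star A t (t a) = {a, b, c} \<and> a \<noteq> b \<and> a \<noteq> c \<and> b \<noteq> c)"
proof -
  have c: "card (star A t (t a)) \<in> {1, 3}" using assms by (auto simp: cubic_def)
  have a: "a \<in> star A t (t a)" using assms by (auto simp: star_def)
  then have c': "card (star A t (t a) - {a}) \<in> {0, 2}"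
    using c by (auto simp: card_Diff_singleton)
  have fin: "finite (star A t (t a))" using cubic_finite[OF assms(1)] by (simp add: star_def)
  show ?thesis
  proof (cases "card (star A t (t a) - {a}) = 0")
    case True
    then have "star A t (t a) - {a} = {}" using fin by simp
    then show ?thesis using a by blast
  next
    case False
    then obtain b c where "star A t (t a) - {a} = {b, c}" "b \<noteq> c" using c' by (auto simp: card_2_iff)
    then have "star A t (t a) = {a, b, c}" "a \<noteq> b" "a \<noteq> c" "b \<noteq> c" using a by blast+
    then show ?thesis by blast
  qed
qed

lemma isomorphic_refl: "isomorphic A t r A t r"
  unfolding isomorphic_def by (rule exI[of _ id]) auto

lemma isomorphic_sym:
  assumes "isomorphic A t r B u s" "\<And>a. a \<in> A \<Longrightarrow> r a \<in> A"
  shows "isomorphic B u s A t r"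
proof -
  obtain \<phi> where p: "bij_betw \<phi> A B" "\<forall>a\<in>A. \<forall>b\<in>A. t a = t b \<longleftrightarrow> u (\<phi> a) = u (\<phi> b)"
     "\<forall>a\<in>A. \<phi> (r a) = s (\<phi> a)" using assms by (auto simp: isomorphic_def)
  let ?q = "the_inv_into A \<phi>"
  have inj: "inj_on \<phi> A" and B: "B = \<phi> ` A" using p(1) by (auto simp: bij_betw_def)
  have q: "?q (\<phi> a) = a" if "a \<in> A" for a using inj that by (simp add: the_inv_into_f_f)
  show ?thesis unfolding isomorphic_def B
  proof (rule exI[of _ ?q], intro conjI ballI)
    show "bij_betw ?q (\<phi> ` A) A" using bij_betw_the_inv_into[OF p(1)] B by simp
  next
    fix a b assume "a \<in> \<phi> ` A" "b \<in> \<phi> ` A"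
    then show "u a = u b \<longleftrightarrow> t (?q a) = t (?q b)" using p(2) q by auto
  next
    fix a assume "a \<in> \<phi> ` A"
    then obtain a' where a': "a' \<in> A" "a = \<phi> a'" by auto
    then have "s a = \<phi> (r a')" using p(3) by auto
    then show "?q (s a) = r (?q a)" using a' q assms(2) by auto
  qed
qed

lemma isomorphic_trans:
  assumes "isomorphic A t r B u s" "isomorphic B u s C w q"
  shows "isomorphic A t r C w q"
proof -
  obtain \<phi> where p: "bij_betw \<phi> A B" "\<forall>a\<in>A. \<forall>b\<in>A. t a = t b \<longleftrightarrow> u (\<phi> a) = u (\<phi> b)"
     "\<forall>a\<in>A. \<phi> (r a) = s (\<phi> a)" using assms by (auto simp: isomorphic_def)
  obtain \<psi> where p': "bij_betw \<psi> B C" "\<forall>a\<in>B. \<forall>b\<in>B. u a = u b \<longleftrightarrow> w (\<psi> a) = w (\<psi> b)"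
     "\<forall>a\<in>B. \<psi> (s a) = q (\<psi> a)" using assms by (auto simp: isomorphic_def)
  have B: "\<phi> a \<in> B" if "a \<in> A" for a using p(1) that by (auto simp: bij_betw_def)
  show ?thesis unfolding isomorphic_def
    by (rule exI[of _ "\<psi> \<circ> \<phi>"]) (use p p' B in \<open>auto intro: bij_betw_trans\<close>)
qed

section \<open>Agreement with digraphs, their isomorphisms and their classes\<close>

lemma rtrancl_on_closed:
  "(u, v) \<in> rtrancl_on F R \<Longrightarrow> u \<in> U \<Longrightarrow> (\<And>x y. x \<in> U \<Longrightarrow> (x, y) \<in> R \<Longrightarrow> y \<in> U) \<Longrightarrow> v \<in> U"
  by (induct rule: rtrancl_on_induct) auto

text \<open>A walk cannot leave a closed set, and conversely the vertices reachable from a given one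
  form a closed set. Reversal makes the arc relation symmetric, so passing to its symmetric closure
  changes nothing.\<close>

lemma connected_iff_linked:
  assumes B: "bidirected_digraph G r" and V: "verts G = tail G ` arcs G"
  shows "Digraph_Component.connected G \<longleftrightarrow> arcs G \<noteq> {} \<and> linked (arcs G) (tail G) r"
proof -
  interpret bidirected_digraph G r by (rule B)
  have symc: "(arcs_ends G)\<^sup>s = arcs_ends G"
    unfolding symcl_def using graph_symmetric by auto
  have hd: "head G a = tail G (r a)" if "a \<in> arcs G" for a using that by simp
  show ?thesis
  proof
    assume c: "Digraph_Component.connected G"
    then have ne: "verts G \<noteq> {}" by (auto simp: connected_conv)
    have "linked (arcs G) (tail G) r"
      unfolding linked_def
    proof (intro allI impI ballI)
      fix U a assume U: "\<forall>a\<in>arcs G. tail G a \<in> U \<longrightarrow> tail G (r a) \<in> U" "\<exists>a\<in>arcs G. tail G a \<in> U"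
        and a: "a \<in> arcs G"
      then obtain b where b: "b \<in> arcs G" "tail G b \<in> U" by auto
      have "(tail G b, tail G a) \<in> rtrancl_on (verts G) (arcs_ends G)"
        using c a b symc by (auto simp: connected_conv)
      then show "tail G a \<in> U"
      proof (rule rtrancl_on_closed)
        fix x y assume "x \<in> U" "(x, y) \<in> arcs_ends G"
        then obtain c where "c \<in> arcs G" "x = tail G c" "y = head G c" by (auto simp: arcs_ends_conv)
        then show "y \<in> U" using U(1) \<open>x \<in> U\<close> hd by metis
      qed (rule b)
    qed
    then show "arcs G \<noteq> {} \<and> linked (arcs G) (tail G) r" using ne V by auto
  next
    assume l: "arcs G \<noteq> {} \<and> linked (arcs G) (tail G) r"
    show "Digraph_Component.connected G" unfolding connected_conv symc
    proof (intro conjI ballI)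
      show "verts G \<noteq> {}" using l V by auto
    next
      fix u v assume uv: "u \<in> verts G" "v \<in> verts G"
      let ?U = "{w. (u, w) \<in> rtrancl_on (verts G) (arcs_ends G)}"
      have "(\<forall>a\<in>arcs G. tail G a \<in> ?U \<longrightarrow> tail G (r a) \<in> ?U) \<longrightarrow> (\<exists>a\<in>arcs G. tail G a \<in> ?U)
          \<longrightarrow> (\<forall>a\<in>arcs G. tail G a \<in> ?U)"
        using l unfolding linked_def by blast
      moreover have "\<forall>a\<in>arcs G. tail G a \<in> ?U \<longrightarrow> tail G (r a) \<in> ?U"
      proof (intro ballI impI)
        fix a assume a: "a \<in> arcs G" "tail G a \<in> ?U"
        then have "(tail G a, tail G (r a)) \<in> arcs_ends G"
          unfolding hd[OF a(1), symmetric] arcs_ends_conv by blast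
        moreover have "tail G (r a) \<in> verts G" using a by simp
        ultimately show "tail G (r a) \<in> ?U" using a
          by (blast intro: rtrancl_on_into_rtrancl_on)
      qed
      moreover have "\<exists>a\<in>arcs G. tail G a \<in> ?U" using uv V by auto
      ultimately have "\<forall>a\<in>arcs G. tail G a \<in> ?U" by blast
      then show "(u, v) \<in> rtrancl_on (verts G) (arcs_ends G)" using uv V by auto
    qed
  qed
qed

lemma card_edges:
  assumes "finite A" "\<And>a. a \<in> A \<Longrightarrow> r a \<in> A" "\<And>a. a \<in> A \<Longrightarrow> r a \<noteq> a" "\<And>a. a \<in> A \<Longrightarrow> r (r a) = (a::nat)"
  shows "card A = 2 * card ((\<lambda>a. {a, r a}) ` A)"
proof -
  let ?P = "(\<lambda>a. {a, r a}) ` A"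
  have "A = \<Union> ?P" using assms(2) by blast
  then have "card A = card (\<Union> ?P)" by (rule arg_cong)
  also have "\<dots> = sum card ?P"
  proof (rule card_Union_disjoint)
    show "pairwise disjnt ?P"
      unfolding pairwise_def disjnt_def
    proof (intro ballI impI)
      fix P Q assume "P \<in> ?P" "Q \<in> ?P" "P \<noteq> Q"
      then obtain x y where xy: "x \<in> A" "y \<in> A" "P = {x, r x}" "Q = {y, r y}" by auto
      have "r (r x) = x" "r (r y) = y" using xy assms(4) by auto
      then have "x \<noteq> y" "x \<noteq> r y" "r x \<noteq> y" "r x \<noteq> r y"
        using \<open>P \<noteq> Q\<close> xy(3,4) by (blast, metis insert_commute, metis insert_commute, metis)
      then show "P \<inter> Q = {}" unfolding xy(3,4) by blast
    qed
  qed blast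
  also have "\<dots> = sum (\<lambda>_. 2) ?P"
  proof (rule sum.cong[OF refl])
    fix P assume "P \<in> ?P"
    then obtain x where "x \<in> A" "P = {x, r x}" by auto
    moreover have "r x \<noteq> x" using assms(3) calculation by blast
    ultimately show "card P = 2" by (simp add: card_insert_if)
  qed
  finally show ?thesis by simp
qed

lemma card_half_edges:
  assumes "finite A" "\<And>a. a \<in> A \<Longrightarrow> card (star A t (t a)) \<in> {1, 3}"
  shows "card A = card {v \<in> t ` A. card (star A t v) = 1} + 3 * card {v \<in> t ` A. card (star A t v) = 3}"
    and "card (t ` A) = card {v \<in> t ` A. card (star A t v) = 1} + card {v \<in> t ` A. card (star A t v) = 3}"
proof -
  let ?V1 = "{v \<in> t ` A. card (star A t v) = 1}" and ?V3 = "{v \<in> t ` A. card (star A t v) = 3}"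
  have V: "t ` A = ?V1 \<union> ?V3" "?V1 \<inter> ?V3 = {}" using assms(2) by auto
  have fin: "finite ?V1" "finite ?V3" using assms(1) by auto
  have "A = (\<Union>v\<in>t`A. star A t v)" by (auto simp: star_def)
  then have "card A = card (\<Union>v\<in>t`A. star A t v)" by (rule arg_cong)
  also have "\<dots> = (\<Sum>v\<in>t`A. card (star A t v))"
    by (rule card_UN_disjoint) (use assms(1) in \<open>auto simp: star_def\<close>)
  also have "\<dots> = (\<Sum>v\<in>?V1 \<union> ?V3. card (star A t v))" using V(1) by (rule arg_cong)
  also have "\<dots> = (\<Sum>v\<in>?V1. card (star A t v)) + (\<Sum>v\<in>?V3. card (star A t v))"
    by (rule sum.union_disjoint[OF fin V(2)])
  also have "\<dots> = (\<Sum>v\<in>?V1. 1) + (\<Sum>v\<in>?V3. 3)" by (intro arg_cong2[where f="(+)"] sum.cong) auto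
  also have "\<dots> = card ?V1 + 3 * card ?V3" by simp
  finally show "card A = card ?V1 + 3 * card ?V3" .
  have "card (t ` A) = card (?V1 \<union> ?V3)" using V(1) by (rule arg_cong)
  also have "\<dots> = card ?V1 + card ?V3" by (rule card_Un_disjoint[OF fin V(2)])
  finally show "card (t ` A) = card ?V1 + card ?V3" .
qed

lemma out_arcs_star: "out_arcs G v = star (arcs G) (tail G) v"
  by (auto simp: star_def out_arcs_def)

text \<open>With 6g - 6 + 4p half-edges there are 3g - 3 + 2p edges and 2g - 2 + 2p vertices, so
  Euler's formula gives rank g once there is a single component. A symmetric connected digraph is
  strongly connected, whence \<open>sccs_verts\<close> is a singleton.\<close>

lemma trivalent_graphs_iff:
  "(G, r) \<in> trivalent_graphs g p \<longleftrightarrow>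
    cubic g p (arcs G) (tail G) r \<and> verts G = tail G ` arcs G \<and> (\<forall>a\<in>arcs G. head G a = tail G (r a))"
   (is "?L \<longleftrightarrow> ?R")
proof
  assume L: ?L
  then have B: "bidirected_digraph G r" and F: "fin_digraph G" by (auto simp: trivalent_graphs_def)
  interpret bidirected_digraph G r by (rule B)
  have vv: "verts G = valence_verts (G, r) 1 \<union> valence_verts (G, r) 3"
    using L by (auto simp: trivalent_graphs_def)
  have V: "verts G = tail G ` arcs G"
  proof
    show "verts G \<subseteq> tail G ` arcs G"
    proof
      fix v assume "v \<in> verts G"
      then have "v \<in> valence_verts (G, r) 1 \<union> valence_verts (G, r) 3" using vv by blast
      then have "out_degree G v \<noteq> 0" by (auto simp: valence_verts_def)
      then have "out_arcs G v \<noteq> {}" by (auto simp: out_degree_def)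
      then show "v \<in> tail G ` arcs G" by (auto simp: out_arcs_def)
    qed
  qed auto
  have vk: "valence_verts (G, r) k = {v \<in> tail G ` arcs G. card (star (arcs G) (tail G) v) = k}" for k
    by (auto simp: valence_verts_def out_degree_def out_arcs_star V)
  have "\<forall>a\<in>arcs G. card (star (arcs G) (tail G) (tail G a)) \<in> {1, 3}"
  proof
    fix a assume "a \<in> arcs G"
    then have "tail G a \<in> valence_verts (G, r) 1 \<union> valence_verts (G, r) 3" using vv V by blast
    then show "card (star (arcs G) (tail G) (tail G a)) \<in> {1, 3}" unfolding vk by blast
  qed
  moreover have "finite (arcs G)" using F by (simp add: fin_digraph_def fin_digraph_axioms_def)
  moreover have "arcs G \<noteq> {} \<and> linked (arcs G) (tail G) r"
    using L connected_iff_linked[OF B V] by (simp add: trivalent_graphs_def)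
  moreover have "card {v \<in> tail G ` arcs G. card (star (arcs G) (tail G) v) = 1} = p \<and>
    int (card {v \<in> tail G ` arcs G. card (star (arcs G) (tail G) v) = 3}) = 2 * int g - 2 + int p"
    using L unfolding trivalent_graphs_def vk[symmetric] by simp
  moreover have "\<forall>a. (a \<in> arcs G) = (r a \<noteq> a)" "\<forall>a. r (r a) = a" using arev_dom arev_arev by blast+
  moreover have "\<forall>a\<in>arcs G. head G a = tail G (r a)" using tail_arev by metis
  ultimately show ?R using V unfolding cubic_def by blast
next
  assume R: ?R
  then have V: "verts G = tail G ` arcs G" and hd: "\<And>a. a \<in> arcs G \<Longrightarrow> head G a = tail G (r a)"
    and c: "cubic g p (arcs G) (tail G) r" by auto
  note rA = cubic_rev_in[OF c] and rr = cubic_rev_rev[OF c] and rne = cubic_rev_neq[OF c] and out = cubic_outside[OF c]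
  have wf: "wf_digraph G"
  proof
    fix e assume "e \<in> arcs G"
    then show "tail G e \<in> verts G" "head G e \<in> verts G" using V hd rA by blast+
  qed
  have F: "fin_digraph G" using wf cubic_finite[OF c] V by (simp add: fin_digraph_def fin_digraph_axioms_def)
  have B: "bidirected_digraph G r"
  proof (rule wf_digraph.bidirected_digraphI[OF wf])
    show "\<And>a. a \<in> arcs G \<Longrightarrow> tail G (r a) = head G a" using hd by simp
  qed (use rr rne out in blast)+
  interpret bidirected_digraph G r by (rule B)
  interpret fin_digraph G by (rule F)
  have con: "Digraph_Component.connected G" using connected_iff_linked[OF B V] c by (simp add: cubic_def)
  have vk: "valence_verts (G, r) k = {v \<in> tail G ` arcs G. card (star (arcs G) (tail G) v) = k}" for k
    by (auto simp: valence_verts_def out_degree_def out_arcs_star V)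
  have sc: "strongly_connected G" using con symmetric_connected_imp_strongly_connected sym_arcs by blast
  then have "scc_of u = verts G" if "u \<in> verts G" for u
    using that unfolding scc_of_def strongly_connected_def by (blast elim: reachable_in_vertsE)
  then have "sccs_verts = {verts G}"
    using sc unfolding sccs_verts_conv_scc_of strongly_connected_def by auto
  then have s1: "card sccs_verts = 1" by simp
  have ce: "card (arcs G) = 2 * card (edges (G, r))"
    unfolding edges_def prod.case by (rule card_edges) (use cubic_finite[OF c] rA rr rne in blast)+
  have deg: "\<And>a. a \<in> arcs G \<Longrightarrow> card (star (arcs G) (tail G) (tail G a)) \<in> {1, 3}"
    using c unfolding cubic_def by blast
  note ch = card_half_edges[of "arcs G" "tail G", OF _ deg]
  have p: "card {v \<in> tail G ` arcs G. card (star (arcs G) (tail G) v) = 1} = p"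
    "int (card {v \<in> tail G ` arcs G. card (star (arcs G) (tail G) v) = 3}) = 2 * int g - 2 + int p"
    using c unfolding cubic_def by blast+
  have "first_betti (G, r) = int g"
    unfolding first_betti_def prod.case s1 V using ch(1)[OF finite_arcs] ch(2)[OF finite_arcs] ce p by linarith
  moreover have "verts G = valence_verts (G, r) 1 \<union> valence_verts (G, r) 3"
  proof
    show "verts G \<subseteq> valence_verts (G, r) 1 \<union> valence_verts (G, r) 3"
      unfolding vk V using deg by blast
    show "valence_verts (G, r) 1 \<union> valence_verts (G, r) 3 \<subseteq> verts G"
      by (auto simp: valence_verts_def)
  qed
  ultimately show ?L using F B con p unfolding trivalent_graphs_def vk[symmetric] by simp
qed

lemma multigraph_iso_iff:
  assumes "(G, r) \<in> trivalent_graphs g p" "(H, s) \<in> trivalent_graphs g p"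
  shows "multigraph_iso (G, r) (H, s) \<longleftrightarrow> isomorphic (arcs G) (tail G) r (arcs H) (tail H) s"
proof
  note G = assms(1)[unfolded trivalent_graphs_iff] and H = assms(2)[unfolded trivalent_graphs_iff]
  assume "multigraph_iso (G, r) (H, s)"
  then obtain f where f: "pre_digraph.digraph_isomorphism G f" "H = app_iso f G"
     "\<forall>a \<in> arcs G. iso_arcs f (r a) = s (iso_arcs f a)" by (auto simp: multigraph_iso_def)
  have inj: "inj_on (iso_verts f) (verts G)" "inj_on (iso_arcs f) (arcs G)"
    and tl: "\<And>a. a \<in> arcs G \<Longrightarrow> iso_tail f (iso_arcs f a) = iso_verts f (tail G a)"
    using f(1) by (auto simp: pre_digraph.digraph_isomorphism_def)
  have vG: "tail G a \<in> verts G" if "a \<in> arcs G" for a using G that by blast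
  show "isomorphic (arcs G) (tail G) r (arcs H) (tail H) s"
    unfolding isomorphic_def
  proof (rule exI[of _ "iso_arcs f"], intro conjI ballI)
    show "bij_betw (iso_arcs f) (arcs G) (arcs H)" using inj f(2) by (simp add: bij_betw_def)
  next
    fix a b assume ab: "a \<in> arcs G" "b \<in> arcs G"
    then show "tail G a = tail G b \<longleftrightarrow> tail H (iso_arcs f a) = tail H (iso_arcs f b)"
      using f(2) tl[OF ab(1)] tl[OF ab(2)] inj_on_eq_iff[OF inj(1) vG[OF ab(1)] vG[OF ab(2)]] by simp
  qed (use f(3) in blast)
next
  note G = assms(1)[unfolded trivalent_graphs_iff] and H = assms(2)[unfolded trivalent_graphs_iff]
  assume "isomorphic (arcs G) (tail G) r (arcs H) (tail H) s"
  then obtain \<phi> where p: "bij_betw \<phi> (arcs G) (arcs H)"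
     "\<forall>a\<in>arcs G. \<forall>b\<in>arcs G. tail G a = tail G b \<longleftrightarrow> tail H (\<phi> a) = tail H (\<phi> b)"
     "\<forall>a\<in>arcs G. \<phi> (r a) = s (\<phi> a)" by (auto simp: isomorphic_def)
  \<comment> \<open>The image of a vertex is read off from an arbitrary half-edge at it; the choice
    does not matter because \<open>\<phi>\<close> respects equality of tails.\<close>
  define iv where "iv v = tail H (\<phi> (SOME a. a \<in> arcs G \<and> tail G a = v))" for v
  have im: "\<phi> ` arcs G = arcs H" using p(1) by (simp add: bij_betw_def)
  have iv: "iv (tail G a) = tail H (\<phi> a)" if "a \<in> arcs G" for a
  proof -
    have "(SOME b. b \<in> arcs G \<and> tail G b = tail G a) \<in> arcs G \<and> tail G (SOME b. b \<in> arcs G \<and> tail G b = tail G a) = tail G a"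
      by (rule someI[of _ a]) (use that in simp)
    then show ?thesis unfolding iv_def using p(2) that by blast
  qed
  have rA: "r a \<in> arcs G" if "a \<in> arcs G" for a using that G cubic_rev_in by blast
  define f where "f = \<lparr>iso_verts = iv, iso_arcs = \<phi>, iso_head = head H, iso_tail = tail H\<rparr>"
  have wf: "wf_digraph G" using assms(1) by (auto simp: trivalent_graphs_def fin_digraph_def)
  have injv: "inj_on iv (verts G)"
  proof (rule inj_onI)
    fix u v assume "u \<in> verts G" "v \<in> verts G" "iv u = iv v"
    then obtain a b where "a \<in> arcs G" "b \<in> arcs G" "u = tail G a" "v = tail G b" using G by blast
    then show "u = v" using \<open>iv u = iv v\<close> iv p(2) by simp
  qed
  have hd: "iv (head G a) = head H (\<phi> a)" if "a \<in> arcs G" for a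
  proof -
    have "\<phi> a \<in> arcs H" using that im by blast
    then have "head H (\<phi> a) = tail H (\<phi> (r a))" using H p(3) that by simp
    moreover have "head G a = tail G (r a)" using G that by blast
    ultimately show ?thesis using iv[OF rA[OF that]] by simp
  qed
  have "pre_digraph.digraph_isomorphism G f"
    unfolding pre_digraph.digraph_isomorphism_def f_def
    using wf injv p(1) iv hd by (simp add: bij_betw_def)
  moreover have "H = app_iso f G"
  proof (rule pre_digraph.equality)
    have "verts H = tail H ` \<phi> ` arcs G" using H im by simp
    also have "\<dots> = (\<lambda>a. iv (tail G a)) ` arcs G" unfolding image_image by (rule image_cong) (simp_all add: iv)
    also have "\<dots> = iv ` verts G" using G by (simp add: image_image)
    finally show "verts H = verts (app_iso f G)" by (simp add: f_def)
  qed (simp_all add: f_def im)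
  moreover have "\<forall>a \<in> arcs G. iso_arcs f (r a) = s (iso_arcs f a)" using p(3) by (simp add: f_def)
  ultimately show "multigraph_iso (G, r) (H, s)" unfolding multigraph_iso_def by blast
qed

text \<open>The class is indexed by raw data, since a digraph also carries values of
  \<open>tail\<close> and \<open>head\<close> off its arcs, on which nothing should depend.\<close>

definition iso_class :: "nat \<Rightarrow> nat \<Rightarrow> nat set \<Rightarrow> (nat \<Rightarrow> nat) \<Rightarrow> (nat \<Rightarrow> nat) \<Rightarrow> multigraph set" where
  "iso_class g p A t r = {\<Gamma> \<in> trivalent_graphs g p. isomorphic A t r (arcs (fst \<Gamma>)) (tail (fst \<Gamma>)) (snd \<Gamma>)}"

definition to_multigraph :: "nat set \<Rightarrow> (nat \<Rightarrow> nat) \<Rightarrow> (nat \<Rightarrow> nat) \<Rightarrow> multigraph" where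
  "to_multigraph A t r = (\<lparr>verts = t ` A, arcs = A, tail = t, head = t \<circ> r\<rparr>, r)"

lemma to_multigraph_in: "cubic g p A t r \<Longrightarrow> to_multigraph A t r \<in> trivalent_graphs g p"
  by (simp add: to_multigraph_def trivalent_graphs_iff)

lemma to_multigraph_in_iso_class: "cubic g p A t r \<Longrightarrow> to_multigraph A t r \<in> iso_class g p A t r"
  using to_multigraph_in by (simp add: iso_class_def) (simp add: to_multigraph_def isomorphic_refl)

lemma class_of:
  assumes "(G, r) \<in> trivalent_graphs g p"
  shows "{(\<Gamma>, \<Delta>). \<Gamma> \<in> trivalent_graphs g p \<and> \<Delta> \<in> trivalent_graphs g p \<and> multigraph_iso \<Gamma> \<Delta>} `` {(G, r)}
     = iso_class g p (arcs G) (tail G) r"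
  using assms by (auto simp: iso_class_def multigraph_iso_iff)

lemma iso_class_in_classes:
  assumes "cubic g p A t r"
  shows "iso_class g p A t r \<in> graph_classes g p"
  unfolding graph_classes_def
  using quotientI[OF to_multigraph_in[OF assms], of "{(\<Gamma>, \<Delta>). \<Gamma> \<in> trivalent_graphs g p \<and> \<Delta> \<in> trivalent_graphs g p \<and> multigraph_iso \<Gamma> \<Delta>}"]
    class_of[OF to_multigraph_in[OF assms, unfolded to_multigraph_def]] by (simp add: to_multigraph_def)

lemma isomorphic_iso_class:
  assumes "cubic g p A t r" "isomorphic A t r B u s"
  shows "iso_class g p A t r = iso_class g p B u s"
  unfolding iso_class_def using isomorphic_trans[OF assms(2)] isomorphic_trans[OF isomorphic_sym[OF assms(2)]] cubic_rev_in[OF assms(1)]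
  by blast

lemma classes_iso_class:
  assumes "C \<in> graph_classes g p"
  obtains A t r where "cubic g p A t r" "C = iso_class g p A t r"
proof -
  obtain G r where G: "(G, r) \<in> trivalent_graphs g p" "C = iso_class g p (arcs G) (tail G) r"
    using assms class_of unfolding graph_classes_def by (auto elim!: quotientE)
  then show ?thesis using that trivalent_graphs_iff by blast
qed

lemma class_member:
  assumes "C \<in> graph_classes g p" "(G, r) \<in> C"
  shows "(G, r) \<in> trivalent_graphs g p" "C = iso_class g p (arcs G) (tail G) r"
proof -
  obtain A t q where A: "cubic g p A t q" "C = iso_class g p A t q" using classes_iso_class[OF assms(1)] .
  then show "(G, r) \<in> trivalent_graphs g p" "C = iso_class g p (arcs G) (tail G) r"
    using assms(2) isomorphic_iso_class[OF A(1), of "arcs G" "tail G" r] by (auto simp: iso_class_def)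
qed

section \<open>Whitehead moves as exchanges of two half-edges\<close>

text \<open>Any two of the three splittings at an edge differ by exchanging the tails of one half-edge from each side.\<close>

definition exchange :: "nat set \<Rightarrow> (nat \<Rightarrow> nat) \<Rightarrow> (nat \<Rightarrow> nat) \<Rightarrow> (nat \<Rightarrow> nat) \<Rightarrow> bool" where
  "exchange A t r t' \<longleftrightarrow> (\<exists>e\<in>A. \<exists>x\<in>A. \<exists>y\<in>A. t e \<noteq> t (r e) \<and> t x = t e \<and> x \<noteq> e \<and> t y = t (r e) \<and> y \<noteq> r e
      \<and> (\<forall>a\<in>A. t' a = t (transpose x y a)))"

lemma star_triple: "star A t v = {a, b, c} \<Longrightarrow> a \<in> A \<and> b \<in> A \<and> c \<in> A \<and> t a = v \<and> t b = v \<and> t c = v"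
  unfolding star_def by blast

lemma star_trivalent:
  assumes "cubic g p A t r" "a \<in> A" "card (star A t (t a)) = 3"
  obtains b c where "star A t (t a) = {a, b, c}" "a \<noteq> b" "a \<noteq> c" "b \<noteq> c"
proof -
  have "star A t (t a) \<noteq> {a}"
  proof
    assume "star A t (t a) = {a}"
    then have "card (star A t (t a)) = card {a}" by (rule arg_cong)
    then show False using assms(3) by simp
  qed
  then show ?thesis using cubic_star_cases[OF assms(1,2)] that by blast
qed

lemma star_third:
  assumes "cubic g p A t r" "a \<in> A" "b \<in> star A t (t a)" "b \<noteq> a"
  obtains c where "star A t (t a) = {a, b, c}" "c \<noteq> a" "c \<noteq> b"
proof -
  have "star A t (t a) \<noteq> {a}" using assms(3,4) by auto
  then obtain u v where uv: "star A t (t a) = {a, u, v}" "a \<noteq> u" "a \<noteq> v" "u \<noteq> v"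
    using cubic_star_cases[OF assms(1,2)] by blast
  then have "b = u \<or> b = v" using assms(3,4) by simp
  then show ?thesis using that[of v] that[of u] uv by (auto simp: insert_commute)
qed

lemma star_transpose:
  assumes "x \<in> A" "y \<in> A" "\<And>a. a \<in> A \<Longrightarrow> t' a = t (transpose x y a)"
  shows "star A t' v = transpose x y ` star A t v"
proof (rule set_eqI)
  fix a
  have i: "transpose x y a \<in> A \<longleftrightarrow> a \<in> A" using assms(1,2) by (auto simp: transpose_def)
  have "a \<in> transpose x y ` star A t v \<longleftrightarrow> transpose x y a \<in> star A t v"
    by (metis image_iff transpose_involutory)
  then show "a \<in> star A t' v \<longleftrightarrow> a \<in> transpose x y ` star A t v"
    using assms(3)[of a] i by (auto simp: star_def)
qed

text \<open>Transposing two half-edges preserves the size of every star. Connectedness survives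
  because neither half of the contracted edge is moved: a set closed for the new tails contains both
  of its ends or neither, and then old and new tails lie in it simultaneously.\<close>

lemma exchange_cubic:
  assumes c: "cubic g p A t r" and s: "exchange A t r t'"
  shows "cubic g p A t' r" "t' ` A = t ` A"
proof -
  obtain e x y where e: "e \<in> A" "x \<in> A" "y \<in> A" "t e \<noteq> t (r e)" "t x = t e" "x \<noteq> e" "t y = t (r e)" "y \<noteq> r e"
     and t': "\<And>a. a \<in> A \<Longrightarrow> t' a = t (transpose x y a)" using s by (auto simp: exchange_def)
  note rA = cubic_rev_in[OF c] and rr = cubic_rev_rev[OF c]
  let ?\<tau> = "transpose x y"
  have \<tau>: "?\<tau> a \<in> A \<longleftrightarrow> a \<in> A" for a using e by (auto simp: transpose_def)
  have \<tau>A: "?\<tau> ` A = A" using \<tau> by (auto intro!: image_eqI[of _ _ "?\<tau> _"])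
  have "t' ` A = (t \<circ> ?\<tau>) ` A" by (rule image_cong) (simp_all add: t')
  also have "\<dots> = t ` (?\<tau> ` A)" by (simp only: image_comp)
  finally show im: "t' ` A = t ` A" by (simp only: \<tau>A)
  have star: "card (star A t' v) = card (star A t v)" for v
    using star_transpose[of x A y t' t v, OF e(2,3) t'] by (simp add: card_image)
  have "linked A t' r" unfolding linked_def
  proof (intro allI impI)
    fix U assume U: "\<forall>a\<in>A. t' a \<in> U \<longrightarrow> t' (r a) \<in> U" "\<exists>a\<in>A. t' a \<in> U"
    have ev: "t' e = t e" "t' (r e) = t (r e)" using e t' rA[of e] by (auto simp: transpose_def)
    have "t e \<in> U \<longleftrightarrow> t (r e) \<in> U"
      using U(1) e(1) rA[of e] ev rr[of e] by metis
    then have same: "t' a \<in> U \<longleftrightarrow> t a \<in> U" if "a \<in> A" for a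
      using that e t' by (auto simp: transpose_def)
    have lk: "(\<forall>a\<in>A. t a \<in> U \<longrightarrow> t (r a) \<in> U) \<longrightarrow> (\<exists>a\<in>A. t a \<in> U) \<longrightarrow> (\<forall>a\<in>A. t a \<in> U)"
      using c unfolding cubic_def linked_def by blast
    show "\<forall>a\<in>A. t' a \<in> U" using lk U same rA by blast
  qed
  moreover have "\<forall>a\<in>A. card (star A t' (t' a)) \<in> {1, 3}"
  proof
    fix a assume "a \<in> A"
    then have "t' a \<in> t ` A" using im by blast
    then show "card (star A t' (t' a)) \<in> {1, 3}" using c star unfolding cubic_def by auto
  qed
  ultimately show "cubic g p A t' r" using c im star unfolding cubic_def by simp
qed

text \<open>A splitting different from the given one can neither keep nor swap the two pairs, so
  each new pair takes one element from each old pair. The names are chosen so that exchanging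
  \<open>x\<close> with \<open>y\<close> produces the new pairs.\<close>

lemma two_of_four:
  assumes "card P = 2" "card Q = 2" "P \<union> Q = {a, b} \<union> {c, d}" "{P, Q} \<noteq> {{a, b}, {c, d}}"
    "P \<inter> Q = {}" "a \<noteq> b" "c \<noteq> d" "{a, b} \<inter> {c, d} = {}"
  obtains x x' y y' where "{a, b} = {x, x'}" "{c, d} = {y, y'}" "P = {x', y}" "Q = {x, y'}"
proof -
  obtain u v where P: "P = {u, v}" "u \<noteq> v" using assms(1) by (auto simp: card_2_iff)
  obtain u' v' where Q: "Q = {u', v'}" "u' \<noteq> v'" using assms(2) by (auto simp: card_2_iff)
  have ne: "a \<noteq> c" "a \<noteq> d" "b \<noteq> c" "b \<noteq> d" using assms(8) by auto
  have "Q = (P \<union> Q) - P" using assms(5) by auto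
  then have Q: "Q = {a, b, c, d} - P" unfolding assms(3) by auto
  have "P \<noteq> {a, b}"
  proof
    assume p: "P = {a, b}"
    have "Q = {c, d}" unfolding Q p using ne by auto
    then show False using assms(4) p by simp
  qed
  moreover have "P \<noteq> {c, d}"
  proof
    assume p: "P = {c, d}"
    have "Q = {a, b}" unfolding Q p using ne by auto
    then show False using assms(4) p by (simp add: insert_commute)
  qed
  moreover have "u \<in> {a, b, c, d}" "v \<in> {a, b, c, d}" using P assms(3) by auto
  ultimately have cases: "P = {a, c} \<or> P = {a, d} \<or> P = {b, c} \<or> P = {b, d}"
    using P(2) unfolding P(1) by (elim insertE emptyE) (simp_all add: insert_commute)
  from cases show ?thesis
  proof (elim disjE)
    assume p: "P = {a, c}"
    have "Q = {b, d}" unfolding Q p using ne assms(6,7) by auto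
    then show ?thesis using that[of b a c d] p by (simp add: insert_commute)
  next
    assume p: "P = {a, d}"
    have "Q = {b, c}" unfolding Q p using ne assms(6,7) by auto
    then show ?thesis using that[of b a d c] p by (simp add: insert_commute)
  next
    assume p: "P = {b, c}"
    have "Q = {a, d}" unfolding Q p using ne assms(6,7) by auto
    then show ?thesis using that[of a b c d] p by (simp add: insert_commute)
  next
    assume p: "P = {b, d}"
    have "Q = {a, c}" unfolding Q p using ne assms(6,7) by auto
    then show ?thesis using that[of a b d c] p by (simp add: insert_commute)
  qed
qed

lemma whitehead_move_exchange:
  assumes "(G, r) \<in> trivalent_graphs g p" "(H, s) \<in> trivalent_graphs g p" "whitehead_move (G, r) (H, s)"
  shows "exchange (arcs G) (tail G) r (tail H)" "arcs H = arcs G" "s = r"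
proof -
  note G = assms(1)[unfolded trivalent_graphs_iff] and H = assms(2)[unfolded trivalent_graphs_iff]
  let ?t = "tail G" and ?A = "arcs G"
  obtain e where e: "e \<in> ?A" "?t e \<noteq> head G e" "out_degree G (?t e) = 3" "out_degree G (head G e) = 3"
    "arcs H = ?A" "s = r" "tail H e = ?t e" "head H e = head G e"
    and oth: "\<forall>a \<in> ?A - {e, r e} - \<Union> (splitting (G, r) e). tail H a = ?t a"
    and un: "\<Union> (splitting (H, s) e) = \<Union> (splitting (G, r) e)"
    and c2: "\<forall>P \<in> splitting (H, s) e. card P = 2"
    and ne: "splitting (H, s) e \<noteq> splitting (G, r) e"
    using assms(3) unfolding whitehead_move_def by blast
  show "arcs H = arcs G" "s = r" using e by blast+
  have cG: "cubic g p ?A ?t r" using G by blast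
  have hdG: "head G e = ?t (r e)" using G e by blast
  have hdH: "head H e = tail H (r e)" using H e by blast
  have re: "r e \<in> ?A" using cubic_rev_in[OF cG] e by blast
  obtain a b where ab: "star ?A ?t (?t e) = {e, a, b}" "e \<noteq> a" "e \<noteq> b" "a \<noteq> b"
    using star_trivalent[OF cG e(1) e(3)[unfolded out_degree_def out_arcs_star]] .
  obtain c d where cd: "star ?A ?t (?t (r e)) = {r e, c, d}" "r e \<noteq> c" "r e \<noteq> d" "c \<noteq> d"
    using star_trivalent[OF cG re e(4)[unfolded out_degree_def out_arcs_star hdG]] .
  note tab = star_triple[OF ab(1)] and tcd = star_triple[OF cd(1)]
  have sG: "splitting (G, r) e = {{a, b}, {c, d}}"
    unfolding splitting_def prod.case out_arcs_star hdG ab(1) cd(1) using ab(2,3) cd(2,3)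
    by (simp add: insert_Diff_if)
  let ?P = "star ?A (tail H) (?t e) - {e}" and ?Q = "star ?A (tail H) (?t (r e)) - {r e}"
  have sH: "splitting (H, s) e = {?P, ?Q}"
    unfolding splitting_def prod.case out_arcs_star e(5-8) hdG ..
  have disj: "{a, b} \<inter> {c, d} = {}"
    using tab tcd e(2) hdG by auto
  obtain x x' y y' where xy: "{a, b} = {x, x'}" "{c, d} = {y, y'}" "?P = {x', y}" "?Q = {x, y'}"
  proof (rule two_of_four[of ?P ?Q a b c d])
    show "card ?P = 2" "card ?Q = 2" using c2 unfolding sH by simp_all
    show "?P \<union> ?Q = {a, b} \<union> {c, d}" using un unfolding sH sG by simp
    show "{?P, ?Q} \<noteq> {{a, b}, {c, d}}" using ne unfolding sH sG .
    show "?P \<inter> ?Q = {}" using e(2) hdG by (auto simp: star_def)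
  qed (use ab cd disj in blast)+
  have t: "?t x = ?t e" "?t x' = ?t e" "?t y = ?t (r e)" "?t y' = ?t (r e)" "x \<in> ?A" "y \<in> ?A"
  proof -
    have "{x, x'} \<subseteq> star ?A ?t (?t e)" "{y, y'} \<subseteq> star ?A ?t (?t (r e))"
      unfolding ab(1) cd(1) xy(1,2)[symmetric] by simp_all
    then show "?t x = ?t e" "?t x' = ?t e" "?t y = ?t (r e)" "?t y' = ?t (r e)" "x \<in> ?A" "y \<in> ?A"
      by (auto simp: star_def)
  qed
  have tH: "tail H x = ?t (r e)" "tail H y' = ?t (r e)" "tail H x' = ?t e" "tail H y = ?t e"
  proof -
    have "{x', y} \<subseteq> star ?A (tail H) (?t e)" "{x, y'} \<subseteq> star ?A (tail H) (?t (r e))"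
      unfolding xy(3,4)[symmetric] by simp_all
    then show "tail H x = ?t (r e)" "tail H y' = ?t (r e)" "tail H x' = ?t e" "tail H y = ?t e"
      by (auto simp: star_def)
  qed
  have n: "x \<noteq> e" "x' \<noteq> e" "y \<noteq> r e" "y' \<noteq> r e" "x \<noteq> x'" "y \<noteq> y'"
  proof -
    have "e \<notin> {x, x'}" "r e \<notin> {y, y'}" unfolding xy(1,2)[symmetric] using ab cd by simp_all
    moreover have "card {x, x'} = 2" "card {y, y'} = 2" unfolding xy(1,2)[symmetric] using ab cd by simp_all
    ultimately show "x \<noteq> e" "x' \<noteq> e" "y \<noteq> r e" "y' \<noteq> r e" "x \<noteq> x'" "y \<noteq> y'" by auto
  qed
  have "tail H z = ?t (transpose x y z)" if z: "z \<in> ?A" for z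
  proof -
    consider "z = e" | "z = r e" | "z \<in> {x, x', y, y'}" | "z \<in> ?A - {e, r e} - {x, x', y, y'}" using z by blast
    then show ?thesis
    proof cases
      case 1
      then show ?thesis using e(2,7) hdG t n by (auto simp: transpose_def)
    next
      case 2
      then show ?thesis using e(2,7,8) hdG hdH t n by (auto simp: transpose_def)
    next
      case 3
      then show ?thesis using tH t e(2) hdG by (auto simp: transpose_def)
    next
      case 4
      have "\<Union> (splitting (G, r) e) = {x, x', y, y'}" unfolding sG xy(1,2) by auto
      then have "tail H z = ?t z" using oth 4 by simp
      then show ?thesis using 4 by (simp add: transpose_def)
    qed
  qed
  then show "exchange ?A ?t r (tail H)" unfolding exchange_def
    using e(1,2) t n hdG by metis
qed

lemma exchange_whitehead_move:
  assumes c: "cubic g p A t r" and s: "exchange A t r t'"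
  shows "whitehead_move (to_multigraph A t r) (to_multigraph A t' r)"
proof -
  obtain e x y where e: "e \<in> A" "x \<in> A" "y \<in> A" "t e \<noteq> t (r e)" "t x = t e" "x \<noteq> e" "t y = t (r e)" "y \<noteq> r e"
     and t': "\<And>a. a \<in> A \<Longrightarrow> t' a = t (transpose x y a)" using s by (auto simp: exchange_def)
  let ?G = "\<lparr>verts = t ` A, arcs = A, tail = t, head = t \<circ> r\<rparr>"
  let ?H = "\<lparr>verts = t' ` A, arcs = A, tail = t', head = t' \<circ> r\<rparr>"
  have re: "r e \<in> A" using cubic_rev_in[OF c] e by blast
  have bH: "bidirected_digraph ?H r"
    using to_multigraph_in[OF exchange_cubic(1)[OF c s]] by (simp add: to_multigraph_def trivalent_graphs_def)
  have x_in: "x \<in> star A t (t e)" using e by (simp add: star_def)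
  obtain x' where x': "star A t (t e) = {e, x, x'}" "x' \<noteq> e" "x' \<noteq> x"
    using star_third[OF c e(1) x_in e(6)] .
  have y_in: "y \<in> star A t (t (r e))" using e by (simp add: star_def)
  obtain y' where y': "star A t (t (r e)) = {r e, y, y'}" "y' \<noteq> r e" "y' \<noteq> y"
    using star_third[OF c re y_in e(8)] .
  have tt: "t x' = t e" "t y' = t (r e)" "x' \<in> A" "y' \<in> A"
    using star_triple[OF x'(1)] star_triple[OF y'(1)] by blast+
  have ev: "t' e = t e" "t' (r e) = t (r e)" using e t' re by (auto simp: transpose_def)
  have dist: "distinct [e, r e, x, x', y, y']" using e tt x'(2,3) y'(2,3) by auto
  have f: "star A t' v = transpose x y ` star A t v" for v
    by (rule star_transpose[OF e(2,3)]) (rule t')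
  have f': "star A t' (t e) = {e, y, x'}" "star A t' (t (r e)) = {r e, x, y'}"
    unfolding f x'(1) y'(1) image_insert image_empty using dist by (auto simp: transpose_def)
  have sG: "splitting (?G, r) e = {{x, x'}, {y, y'}}"
    unfolding splitting_def prod.case out_arcs_star using x'(1) y'(1) dist by (auto simp: insert_Diff_if)
  have sH: "splitting (?H, r) e = {{y, x'}, {x, y'}}"
    unfolding splitting_def prod.case out_arcs_star using f' dist ev by (auto simp: insert_Diff_if)
  show ?thesis unfolding to_multigraph_def whitehead_move_def prod.case
  proof (rule bexI[of _ e], intro conjI)
    show "out_degree ?G (tail ?G e) = 3" "out_degree ?G (head ?G e) = 3"
      unfolding out_degree_def out_arcs_star using x'(1) y'(1) dist by simp_all
    show "verts ?H = verts ?G" using exchange_cubic(2)[OF c s] by simp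
    show "\<forall>a\<in>arcs ?G - {e, r e} - \<Union> (splitting (?G, r) e). tail ?H a = tail ?G a"
      unfolding sG using t' by (auto simp: transpose_def)
    show "\<Union> (splitting (?H, r) e) = \<Union> (splitting (?G, r) e)" unfolding sG sH by auto
    show "\<forall>P\<in>splitting (?H, r) e. card P = 2" unfolding sH using dist by auto
    show "splitting (?H, r) e \<noteq> splitting (?G, r) e" unfolding sG sH using dist by (auto simp: doubleton_eq_iff)
  qed (use e bH ev in auto)
qed

lemma exchange_step:
  assumes c: "cubic g p A t r" and s: "exchange A t r t'"
  shows "(iso_class g p A t r, iso_class g p A t' r) \<in> whitehead_step g p"
  unfolding whitehead_step_def
  using iso_class_in_classes[OF c] iso_class_in_classes[OF exchange_cubic(1)[OF c s]] to_multigraph_in_iso_class[OF c] to_multigraph_in_iso_class[OF exchange_cubic(1)[OF c s]]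
    exchange_whitehead_move[OF c s] by blast

text \<open>A step may start from any representative of the class; pulling the exchanged half-edges
  back along the isomorphism lets a whole path of classes be followed on one set of half-edges with
  one involution.\<close>

lemma step_exchange:
  assumes c: "cubic g p A t r" and s: "(iso_class g p A t r, D) \<in> whitehead_step g p"
  obtains t' where "exchange A t r t'" "D = iso_class g p A t' r"
proof -
  obtain G q H s where GH: "(G, q) \<in> iso_class g p A t r" "(H, s) \<in> D" "whitehead_move (G, q) (H, s)" "D \<in> graph_classes g p"
    using s unfolding whitehead_step_def by auto
  have Gin: "(G, q) \<in> trivalent_graphs g p" using GH(1) by (simp add: iso_class_def)
  note D = class_member[OF GH(4,2)]
  note mv = whitehead_move_exchange[OF Gin D(1) GH(3)]
  have cG: "cubic g p (arcs G) (tail G) q" using Gin trivalent_graphs_iff by blast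
  obtain e x y where e: "e \<in> arcs G" "x \<in> arcs G" "y \<in> arcs G" "tail G e \<noteq> tail G (q e)" "tail G x = tail G e" "x \<noteq> e"
     "tail G y = tail G (q e)" "y \<noteq> q e"
     and t': "\<And>a. a \<in> arcs G \<Longrightarrow> tail H a = tail G (transpose x y a)" using mv(1) by (auto simp: exchange_def)
  obtain \<phi> where p: "bij_betw \<phi> A (arcs G)" "\<And>a b. a \<in> A \<Longrightarrow> b \<in> A \<Longrightarrow> t a = t b \<longleftrightarrow> tail G (\<phi> a) = tail G (\<phi> b)"
     "\<And>a. a \<in> A \<Longrightarrow> \<phi> (r a) = q (\<phi> a)" using GH(1) by (auto simp: isomorphic_def iso_class_def)
  have inj: "inj_on \<phi> A" and im: "\<phi> ` A = arcs G" using p(1) by (auto simp: bij_betw_def)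
  obtain e0 x0 y0 where e0: "e0 \<in> A" "x0 \<in> A" "y0 \<in> A" "e = \<phi> e0" "x = \<phi> x0" "y = \<phi> y0"
    using e(1-3) im by blast
  have re0: "r e0 \<in> A" using cubic_rev_in[OF c] e0 by blast
  define u where "u = (\<lambda>a. t (transpose x0 y0 a))"
  have su: "exchange A t r u" unfolding exchange_def
  proof (intro bexI conjI)
    show "t e0 \<noteq> t (r e0)" using e(4) p(2)[OF e0(1) re0] p(3)[OF e0(1)] e0(4) by simp
    show "t x0 = t e0" using e(5) p(2)[OF e0(2,1)] e0 by simp
    show "x0 \<noteq> e0" using e(6) e0 by blast
    show "t y0 = t (r e0)" using e(7) p(2)[OF e0(3) re0] p(3)[OF e0(1)] e0 by simp
    show "y0 \<noteq> r e0" using e(8) e0 p(3)[OF e0(1)] by auto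
    show "\<forall>a\<in>A. u a = t (transpose x0 y0 a)" by (simp add: u_def)
  qed (use e0 in auto)
  have arc_tree: "\<phi> (transpose x0 y0 a) = transpose x y (\<phi> a)" if "a \<in> A" for a
    using that e0 inj_on_eq_iff[OF inj] by (auto simp: transpose_def)
  have trA: "transpose x0 y0 a \<in> A" if "a \<in> A" for a using that e0 by (auto simp: transpose_def)
  have "isomorphic A u r (arcs H) (tail H) s"
    unfolding isomorphic_def mv(2,3)
  proof (rule exI[of _ \<phi>], intro conjI ballI)
    fix a b assume ab: "a \<in> A" "b \<in> A"
    have "\<phi> a \<in> arcs G" "\<phi> b \<in> arcs G" using ab im by blast+
    then show "u a = u b \<longleftrightarrow> tail H (\<phi> a) = tail H (\<phi> b)"
      unfolding u_def using p(2)[OF trA[OF ab(1)] trA[OF ab(2)]] arc_tree ab t' by simp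
  qed (use p in auto)
  then have "iso_class g p A u r = D" using D(2) isomorphic_iso_class[OF exchange_cubic(1)[OF c su]] by blast
  then show ?thesis using that su by blast
qed

section \<open>Binary trees up to rotation\<close>

datatype 'a ltree = L 'a | N "'a ltree" "'a ltree"

text \<open>Exchanging two subtrees does not change the graph and is free.\<close>

inductive rotations :: "'a ltree \<Rightarrow> 'a ltree \<Rightarrow> nat \<Rightarrow> bool" where
  stay: "rotations t t 0"
| seq: "rotations s t m \<Longrightarrow> rotations t u n \<Longrightarrow> rotations s u (m + n)"
| comm: "rotations (N a b) (N b a) 0"
| assoc: "rotations (N (N a b) c) (N a (N b c)) 1"
| ctx: "rotations a a' n \<Longrightarrow> rotations (N a b) (N a' b) n"
| slack: "rotations s t m \<Longrightarrow> m \<le> n \<Longrightarrow> rotations s t n"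

fun nodes :: "'a ltree \<Rightarrow> nat" where
  "nodes (L x) = 0"
| "nodes (N s t) = Suc (nodes s + nodes t)"

fun labels :: "'a ltree \<Rightarrow> 'a list" where
  "labels (L x) = [x]"
| "labels (N s t) = labels s @ labels t"

fun depth :: "'a ltree \<Rightarrow> nat" where
  "depth (L x) = 0"
| "depth (N s t) = Suc (max (depth s) (depth t))"

fun comb :: "'a ltree list \<Rightarrow> 'a ltree" where
  "comb [] = undefined"
| "comb [x] = x"
| "comb (x # y # zs) = N x (comb (y # zs))"

lemma comb_Cons: "xs \<noteq> [] \<Longrightarrow> comb (x # xs) = N x (comb xs)"
  by (cases xs) auto

lemma length_labs: "length (labels t) = Suc (nodes t)"
  by (induction t) auto

lemma labs_ne: "labels t \<noteq> []"
  by (induction t) auto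

lemma rotations_ctx2: "rotations b b' n \<Longrightarrow> rotations (N a b) (N a b') n"
proof -
  assume "rotations b b' n"
  then have "rotations (N a b) (N a b') (0 + (n + 0))"
    by (rule rotations.seq[OF rotations.comm rotations.seq[OF rotations.ctx rotations.comm]])
  then show ?thesis by simp
qed

lemma rotations_assoc': "rotations (N a (N b c)) (N (N a b) c) 1"
proof -
  have "rotations (N a (N b c)) (N (N c b) a) (0 + 0)"
    by (rule rotations.seq[OF rotations_ctx2[OF rotations.comm] rotations.comm])
  then have "rotations (N a (N b c)) (N c (N b a)) (0 + 0 + 1)" by (rule rotations.seq[OF _ rotations.assoc])
  then have "rotations (N a (N b c)) (N (N a b) c) (0 + 0 + 1 + (0 + 0))"
    by (rule rotations.seq[OF _ rotations.seq[OF rotations_ctx2[OF rotations.comm] rotations.comm]])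
  then show ?thesis by simp
qed

lemma rotations_sym: "rotations s t n \<Longrightarrow> rotations t s n"
proof (induction rule: rotations.induct)
  case (seq s t m u n)
  then show ?case using rotations.seq[of u t n s m] by (simp add: add.commute)
qed (auto intro: rotations.intros rotations_assoc')

text \<open>Each inner node of \<open>s\<close> is turned onto the right spine by one rotation, so
  the cost is the number of nodes, whatever the depth.\<close>

lemma rotations_append: "ys \<noteq> [] \<Longrightarrow> rotations (N s (comb ys)) (comb (map L (labels s) @ ys)) (nodes s)"
proof (induction s arbitrary: ys)
  case (L x)
  then show ?case by (simp add: comb_Cons rotations.stay)
next
  case (N a b)
  have "rotations (N b (comb ys)) (comb (map L (labels b) @ ys)) (nodes b)" using N by blast
  then have "rotations (N a (N b (comb ys))) (N a (comb (map L (labels b) @ ys))) (nodes b)" by (rule rotations_ctx2)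
  moreover have "rotations (N a (comb (map L (labels b) @ ys))) (comb (map L (labels a) @ (map L (labels b) @ ys))) (nodes a)"
    using N by simp
  ultimately have "rotations (N a (N b (comb ys))) (comb (map L (labels a) @ (map L (labels b) @ ys))) (nodes b + nodes a)"
    by (rule rotations.seq)
  then have "rotations (N a (N b (comb ys))) (comb (map L (labels (N a b)) @ ys)) (nodes b + nodes a)" by simp
  from rotations.seq[OF rotations.assoc this] show ?case by (simp add: add.commute)
qed

text \<open>The comb depends on the sequence of leaves alone, so it is a common stop on the way
  between any two trees with that sequence; this makes balancing linear.\<close>

lemma rotations_comb: "rotations t (comb (map L (labels t))) (nodes t)"
proof (induction t)
  case (N a b)
  have "rotations (N a b) (N a (comb (map L (labels b)))) (nodes b)" by (rule rotations_ctx2[OF N(2)])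
  moreover have "rotations (N a (comb (map L (labels b)))) (comb (map L (labels a) @ map L (labels b))) (nodes a)"
    by (rule rotations_append) (simp add: labs_ne)
  ultimately have "rotations (N a b) (comb (map L (labels a) @ map L (labels b))) (nodes b + nodes a)"
    by (rule rotations.seq)
  then have "rotations (N a b) (comb (map L (labels (N a b)))) (nodes b + nodes a)" by simp
  then show ?case by (rule rotations.slack) simp
qed (simp add: rotations.stay)

lemma ex_balanced: "xs \<noteq> [] \<Longrightarrow> length xs \<le> 2 ^ k \<Longrightarrow> \<exists>t. labels t = xs \<and> depth t \<le> k"
proof (induction k arbitrary: xs)
  case 0
  then obtain x where "xs = [x]" by (cases xs) auto
  then show ?case by (intro exI[of _ "L x"]) simp
next
  case (Suc k)
  show ?case
  proof (cases "length xs \<le> 2 ^ k")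
    case True
    then obtain t where "labels t = xs" "depth t \<le> k" using Suc by blast
    then show ?thesis by (intro exI[of _ t]) simp
  next
    case False
    then obtain s where s: "labels s = take (2 ^ k) xs" "depth s \<le> k"
      using Suc.IH[of "take (2 ^ k) xs"] Suc.prems by auto
    obtain u where u: "labels u = drop (2 ^ k) xs" "depth u \<le> k"
      using Suc.IH[of "drop (2 ^ k) xs"] Suc.prems False by (auto simp: le_diff_conv)
    show ?thesis by (rule exI[of _ "N s u"]) (simp add: s u)
  qed
qed

text \<open>One rotation lifts the leaf by one level, and up to swapping subtrees the remainder is
  the tree with that leaf deleted. Hence the rest never gets deeper, and the logarithmic depth of
  the balanced tree is available for every later leaf.\<close>

lemma rotations_extract:
  "x \<in> set (labels t) \<Longrightarrow> t \<noteq> L x \<Longrightarrow>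
    \<exists>t'. rotations t (N (L x) t') (depth t) \<and> depth t' \<le> depth t \<and> mset (labels t) = add_mset x (mset (labels t'))"
proof (induction t)
  case (N a b)
  have aux: "\<exists>t'. rotations (N a b) (N (L x) t') (depth (N a b)) \<and> depth t' \<le> depth (N a b)
      \<and> mset (labels (N a b)) = add_mset x (mset (labels t'))"
    if x: "x \<in> set (labels a)" and IH: "a \<noteq> L x \<Longrightarrow> \<exists>t'. rotations a (N (L x) t') (depth a) \<and> depth t' \<le> depth a \<and> mset (labels a) = add_mset x (mset (labels t'))"
    for a b :: "'a ltree"
  proof (cases "a = L x")
    case True
    then show ?thesis by (intro exI[of _ b]) (auto intro: rotations.slack[OF rotations.stay])
  next
    case False
    then obtain a' where a': "rotations a (N (L x) a') (depth a)" "depth a' \<le> depth a"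
       "mset (labels a) = add_mset x (mset (labels a'))" using IH by blast
    have "rotations (N a b) (N (L x) (N a' b)) (depth a + 1)"
      by (rule rotations.seq[OF rotations.ctx[OF a'(1)] rotations.assoc])
    then have "rotations (N a b) (N (L x) (N a' b)) (depth (N a b))" by (rule rotations.slack) simp
    then show ?thesis using a' by (intro exI[of _ "N a' b"]) auto
  qed
  show ?case
  proof (cases "x \<in> set (labels a)")
    case True
    then show ?thesis using aux[OF True, of b] N.IH(1) by blast
  next
    case False
    then have x: "x \<in> set (labels b)" using N.prems by simp
    obtain t' where t': "rotations (N b a) (N (L x) t') (depth (N b a))" "depth t' \<le> depth (N b a)"
       "mset (labels (N b a)) = add_mset x (mset (labels t'))" using aux[OF x, of a] N.IH(2)[OF x] by blast
    have "rotations (N a b) (N (L x) t') (0 + depth (N b a))" by (rule rotations.seq[OF rotations.comm t'(1)])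
    then show ?thesis using t' by (intro exI[of _ t']) (auto simp: max.commute add.commute)
  qed
qed auto

abbreviation loops :: "('a \<times> 'a) list \<Rightarrow> 'a ltree list" where
  "loops ps \<equiv> map (\<lambda>(x, y). N (L x) (L y)) ps"

abbreviation flat :: "('a \<times> 'a) list \<Rightarrow> 'a list" where
  "flat ps \<equiv> concat (map (\<lambda>(x, y). [x, y]) ps)"

text \<open>Each pair costs at most \<open>d\<close> rotations per element and one more to join the
  two into a loop; straightening what is left into a comb costs \<open>length zs\<close>. The order
  of the single leaves is left open, which does no harm since the leaves of the graph carry no
  labels.\<close>

lemma rotations_pair_up:
  "mset (labels t) = mset (flat ps @ zs) \<Longrightarrow> depth t \<le> d \<Longrightarrow>
    \<exists>zs'. mset zs' = mset zs \<and> rotations t (comb (loops ps @ map L zs')) (length ps * (2 * d + 1) + length zs)"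
proof (induction ps arbitrary: t)
  case Nil
  have m0: "mset (labels t) = mset zs" using Nil(1) by simp
  then have "length (labels t) = length zs" by (rule mset_eq_length)
  then have "nodes t \<le> length zs" using length_labs[of t] by simp
  then have "rotations t (comb (map L (labels t))) (length zs)" by (rule rotations.slack[OF rotations_comb])
  then show ?case using m0 by (intro exI[of _ "labels t"] conjI) simp_all
next
  case (Cons p ps)
  obtain x y where p: "p = (x, y)" by (cases p)
  have m: "mset (labels t) = add_mset x (add_mset y (mset (flat ps @ zs)))" using Cons.prems(1) p by simp
  have "x \<in># mset (labels t)" unfolding m by simp
  then have x: "x \<in> set (labels t)" by simp
  have tx: "t \<noteq> L x" using m by auto
  obtain t' where t': "rotations t (N (L x) t') (depth t)" "depth t' \<le> depth t" "mset (labels t) = add_mset x (mset (labels t'))"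
    using rotations_extract[OF x tx] by (elim exE conjE)
  have m': "mset (labels t') = add_mset y (mset (flat ps @ zs))" using m t'(3) by simp
  show ?case
  proof (cases "t' = L y")
    \<comment> \<open>The last pair without single leaves: the loop itself is the whole tree, and no
      comb follows it.\<close>
    case True
    then have "mset (flat ps @ zs) = {#}" using m' by simp
    then have "flat ps @ zs = []" unfolding mset_zero_iff .
    then have e: "ps = []" "zs = []" by (cases ps; auto)+
    have "rotations t (N (L x) (L y)) (2 * d + 1)"
      by (rule rotations.slack[OF t'(1)[unfolded True]]) (use Cons.prems(2) in simp)
    then show ?thesis using e p by simp
  next
    case False
    have "y \<in># mset (labels t')" unfolding m' by simp
    then have y: "y \<in> set (labels t')" by simp
    obtain t'' where t'': "rotations t' (N (L y) t'') (depth t')" "depth t'' \<le> depth t'" "mset (labels t') = add_mset y (mset (labels t''))"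
      using rotations_extract[OF y False] by (elim exE conjE)
    have m'': "mset (labels t'') = mset (flat ps @ zs)" using m' t''(3) by simp
    obtain zs' where zs': "mset zs' = mset zs" "rotations t'' (comb (loops ps @ map L zs')) (length ps * (2 * d + 1) + length zs)"
      using Cons.IH[OF m''] t'' t' Cons.prems(2) by auto
    have ne: "loops ps @ map L zs' \<noteq> []"
    proof
      assume "loops ps @ map L zs' = []"
      then have "mset (labels t'') = {#}" using m'' zs'(1) by simp
      then show False using labs_ne[of t''] by simp
    qed
    have "rotations t (N (L x) (N (L y) t'')) (depth t + depth t')"
      by (rule rotations.seq[OF t'(1) rotations_ctx2[OF t''(1)]])
    from rotations.seq[OF rotations.seq[OF this rotations_assoc'] rotations_ctx2[OF zs'(2)]]
    have "rotations t (N (N (L x) (L y)) (comb (loops ps @ map L zs'))) (depth t + depth t' + 1 + (length ps * (2 * d + 1) + length zs))" .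
    then have "rotations t (N (N (L x) (L y)) (comb (loops ps @ map L zs'))) (length (p # ps) * (2 * d + 1) + length zs)"
      by (rule rotations.slack) (use t'(2) Cons.prems(2) in simp)
    then have "rotations t (comb (loops (p # ps) @ map L zs')) (length (p # ps) * (2 * d + 1) + length zs)"
      using comb_Cons[OF ne] p by simp
    then show ?thesis using zs' by blast
  qed
qed

text \<open>The factor 3 counts three straightenings: of the given tree, of the balanced tree (run
  backwards), and of the single leaves at the end. The given and the balanced tree have the same
  leaf sequence and hence the same comb.\<close>

lemma rotations_normalize:
  assumes m: "mset (labels t) = mset (flat ps @ zs)" and k: "length (labels t) \<le> 2 ^ k"
  obtains zs' where "mset zs' = mset zs"
    "rotations t (comb (loops ps @ map L zs')) (3 * length (labels t) + length ps * (2 * k + 1))"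
proof -
  obtain s where s: "labels s = labels t" "depth s \<le> k" using ex_balanced[OF labs_ne k] by blast
  have n: "nodes s = nodes t" using length_labs[of s] length_labs[of t] s by simp
  have "rotations t s (nodes t + nodes s)"
    using rotations.seq[OF rotations_comb rotations_sym[OF rotations_comb[of s, unfolded s(1)]]] by simp
  moreover obtain zs' where zs': "mset zs' = mset zs" "rotations s (comb (loops ps @ map L zs')) (length ps * (2 * k + 1) + length zs)"
    using rotations_pair_up[OF m[folded s(1)] s(2)] by blast
  ultimately have c: "rotations t (comb (loops ps @ map L zs')) (nodes t + nodes s + (length ps * (2 * k + 1) + length zs))"
    using rotations.seq by blast
  have "length (labels t) = length (flat ps @ zs)" using m by (metis size_mset)
  then have "length zs \<le> length (labels t)" by simp
  then show ?thesis using that[OF zs'(1) rotations.slack[OF c]] n length_labs[of t] by simp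
qed

section \<open>Spanning trees\<close>

text \<open>Every node carries the half-edge that leads to it from its parent.  A leaf is a half-edge where the
  tree is cut, or one that leads to a leaf of the graph.\<close>

datatype 'a arc_tree = Lf 'a | Nd 'a "'a arc_tree" "'a arc_tree"

fun root_arc :: "'a arc_tree \<Rightarrow> 'a" where
  "root_arc (Lf b) = b"
| "root_arc (Nd b s u) = b"

fun forget_inner :: "'a arc_tree \<Rightarrow> 'a ltree" where
  "forget_inner (Lf b) = L b"
| "forget_inner (Nd b s u) = N (forget_inner s) (forget_inner u)"

fun hang :: "nat set \<Rightarrow> (nat \<Rightarrow> nat) \<Rightarrow> (nat \<Rightarrow> nat) \<Rightarrow> nat arc_tree \<Rightarrow> bool" where
  "hang A r t (Lf b) \<longleftrightarrow> b \<in> A"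
| "hang A r t (Nd b s u) \<longleftrightarrow> b \<in> A \<and> star A t (t (r b)) = {r b, root_arc s, root_arc u}
     \<and> r b \<noteq> root_arc s \<and> r b \<noteq> root_arc u \<and> root_arc s \<noteq> root_arc u \<and> hang A r t s \<and> hang A r t u"

fun inner_verts :: "(nat \<Rightarrow> nat) \<Rightarrow> (nat \<Rightarrow> nat) \<Rightarrow> nat arc_tree \<Rightarrow> nat list" where
  "inner_verts r t (Lf b) = []"
| "inner_verts r t (Nd b s u) = t (r b) # inner_verts r t s @ inner_verts r t u"

lemma ar_in: "hang A r t T \<Longrightarrow> root_arc T \<in> A"
  by (cases T) auto

lemma length_inner_verts: "length (inner_verts r t T) = nodes (forget_inner T)"
  by (induction T) auto

lemma hang_cong:
  assumes "\<And>a. a \<in> A \<Longrightarrow> r a \<in> A"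
  shows "hang A r t T \<Longrightarrow> (\<And>v. v \<in> set (inner_verts r t T) \<Longrightarrow> star A t' v = star A t v) \<Longrightarrow>
    hang A r t' T \<and> inner_verts r t' T = inner_verts r t T"
proof (induction T)
  case (Nd b s u)
  have f: "star A t' (t (r b)) = star A t (t (r b))" using Nd.prems(2) by simp
  have "r b \<in> star A t (t (r b))" using Nd.prems(1) assms by (simp add: star_def)
  then have "t' (r b) = t (r b)" unfolding f[symmetric] by (simp add: star_def)
  moreover have "hang A r t' s \<and> inner_verts r t' s = inner_verts r t s" "hang A r t' u \<and> inner_verts r t' u = inner_verts r t u"
    using Nd by auto
  ultimately show ?case using Nd.prems(1) f by simp
qed simp

section \<open>Rotations realized by Whitehead moves\<close>

definition reached :: "nat set \<Rightarrow> (nat \<Rightarrow> nat) \<Rightarrow> nat \<Rightarrow> (nat \<Rightarrow> nat) \<Rightarrow> (nat \<Rightarrow> nat) \<Rightarrow> bool" where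
  "reached A r n t t' \<longleftrightarrow> (\<exists>m\<le>n. ((\<lambda>t t'. exchange A t r t') ^^ m) t t')"

lemma reached_refl: "reached A r n t t"
  unfolding reached_def by (rule exI[of _ 0]) simp

lemma exchangeI:
  assumes "e \<in> A" "x \<in> A" "y \<in> A" "t e \<noteq> t (r e)" "t x = t e" "x \<noteq> e" "t y = t (r e)" "y \<noteq> r e"
     "\<And>a. a \<in> A \<Longrightarrow> t' a = t (transpose x y a)"
  shows "exchange A t r t'"
  unfolding exchange_def using assms by blast

lemma reached_exchange: "exchange A t r t' \<Longrightarrow> reached A r 1 t t'"
  unfolding reached_def by (rule exI[of _ 1]) auto

lemma reached_trans: "reached A r m t t' \<Longrightarrow> reached A r n t' t'' \<Longrightarrow> reached A r (m + n) t t''"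
  unfolding reached_def
proof (elim exE conjE)
  fix k l assume "k \<le> m" "l \<le> n" "((\<lambda>t t'. exchange A t r t') ^^ k) t t'" "((\<lambda>t t'. exchange A t r t') ^^ l) t' t''"
  then show "\<exists>j\<le>m + n. ((\<lambda>t t'. exchange A t r t') ^^ j) t t''"
    by (intro exI[of _ "k + l"]) (auto simp: relpowp_add)
qed

lemma reached_mono: "reached A r m t t' \<Longrightarrow> m \<le> n \<Longrightarrow> reached A r n t t'"
  unfolding reached_def by (meson order_trans)

text \<open>The vertices and half-edges outside the subtree are untouched, so that moves inside a subtree
  lift to the whole tree.\<close>

lemma rotations_imp_moves:
  assumes "rotations S S' n"
  shows "cubic g p A t r \<Longrightarrow> forget_inner T = S \<Longrightarrow> hang A r t T \<Longrightarrow> distinct (inner_verts r t T) \<Longrightarrow>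
    \<exists>t' T'. forget_inner T' = S' \<and> hang A r t' T' \<and> distinct (inner_verts r t' T') \<and> set (inner_verts r t' T') = set (inner_verts r t T)
      \<and> root_arc T' = root_arc T \<and> (\<forall>v. v \<notin> set (inner_verts r t T) \<longrightarrow> star A t' v = star A t v) \<and> reached A r n t t' \<and> cubic g p A t' r"
  using assms
proof (induction arbitrary: t T rule: rotations.induct)
  case (stay S)
  then show ?case using reached_refl by blast
next
  case (seq S1 S2 m S3 n)
  obtain t' T' where 1: "forget_inner T' = S2" "hang A r t' T'" "distinct (inner_verts r t' T')" "set (inner_verts r t' T') = set (inner_verts r t T)"
    "root_arc T' = root_arc T" "\<forall>v. v \<notin> set (inner_verts r t T) \<longrightarrow> star A t' v = star A t v" "reached A r m t t'" "cubic g p A t' r"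
    using seq.IH(1)[OF seq.prems] by (elim exE conjE)
  obtain t'' T'' where 2: "forget_inner T'' = S3" "hang A r t'' T''" "distinct (inner_verts r t'' T'')" "set (inner_verts r t'' T'') = set (inner_verts r t' T')"
    "root_arc T'' = root_arc T'" "\<forall>v. v \<notin> set (inner_verts r t' T') \<longrightarrow> star A t'' v = star A t' v" "reached A r n t' t''" "cubic g p A t'' r"
    using seq.IH(2)[OF 1(8,1-3)] by (elim exE conjE)
  have "\<forall>v. v \<notin> set (inner_verts r t T) \<longrightarrow> star A t'' v = star A t v" using 1(4,6) 2(6) by simp
  then show ?case using 1 2 reached_trans[OF 1(7) 2(7)] by (intro exI[of _ t''] exI[of _ T'']) simp
next
  \<comment> \<open>The tails stay as they are; only the order of the two subtrees changes.\<close>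
  case (comm a b)
  then obtain c s u where T: "T = Nd c s u" "forget_inner s = a" "forget_inner u = b" by (cases T) auto
  have "hang A r t (Nd c u s)" using comm.prems(3) unfolding T by (auto simp: insert_commute)
  moreover have "distinct (inner_verts r t (Nd c u s))" "set (inner_verts r t (Nd c u s)) = set (inner_verts r t T)"
    using comm.prems(4) unfolding T by auto
  ultimately show ?case using T comm.prems(1) reached_refl
    by (intro exI[of _ t] exI[of _ "Nd c u s"]) simp
next
  case (assoc x1 x2 x3)
  then obtain b T1 w where "T = Nd b T1 w" "forget_inner T1 = N x1 x2" "forget_inner w = x3" by (cases T) auto
  then obtain c s u where T: "T = Nd b (Nd c s u) w" "forget_inner s = x1" "forget_inner u = x2" "forget_inner w = x3" by (cases T1) auto
  note cub = assoc.prems(1)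
  have rA: "r a \<in> A" if "a \<in> A" for a using cubic_rev_in[OF cub] that by blast
  let ?v = "t (r b)" and ?w = "t (r c)"
  have F: "star A t ?v = {r b, c, root_arc w}" "star A t ?w = {r c, root_arc s, root_arc u}"
    and ne: "r b \<noteq> c" "r b \<noteq> root_arc w" "c \<noteq> root_arc w" "r c \<noteq> root_arc s" "r c \<noteq> root_arc u" "root_arc s \<noteq> root_arc u"
    and h: "hang A r t s" "hang A r t u" "hang A r t w" "b \<in> A" "c \<in> A"
    using assoc.prems(3) unfolding T by simp_all
  have d: "?v \<noteq> ?w" "?v \<notin> set (inner_verts r t s)" "?v \<notin> set (inner_verts r t u)" "?v \<notin> set (inner_verts r t w)"
     "?w \<notin> set (inner_verts r t s)" "?w \<notin> set (inner_verts r t u)" "?w \<notin> set (inner_verts r t w)"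
     "distinct (inner_verts r t s @ inner_verts r t u @ inner_verts r t w)"
    using assoc.prems(4) unfolding T by auto
  note m1 = star_triple[OF F(1)] and m2 = star_triple[OF F(2)]
  \<comment> \<open>The contracted edge is that of \<open>c\<close>, between the two nodes. Sending
    the third subtree down and the first one up across it is exactly the rotation; the halves of the
    edge itself stay.\<close>
  define t' where "t' = (\<lambda>a. t (transpose (root_arc w) (root_arc s) a))"
  have xy: "root_arc w \<in> A" "root_arc s \<in> A" using m1 m2 by blast+
  have fs: "star A t' v = transpose (root_arc w) (root_arc s) ` star A t v" for v
    by (rule star_transpose[OF xy]) (simp add: t'_def)
  have nn: "r b \<noteq> root_arc s" "c \<noteq> root_arc s" "r c \<noteq> root_arc w" "root_arc u \<noteq> root_arc w" using m1 m2 d(1) by metis+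
  have F': "star A t' ?v = {r b, c, root_arc s}" "star A t' ?w = {r c, root_arc w, root_arc u}"
    unfolding fs F image_insert image_empty using ne nn by (auto simp: transpose_def)
  have other: "star A t' v = star A t v" if "v \<noteq> ?v" "v \<noteq> ?w" for v
  proof -
    have "root_arc w \<notin> star A t v" "root_arc s \<notin> star A t v" using that m1 m2 by (auto simp: star_def)
    then have "transpose (root_arc w) (root_arc s) a = a" if "a \<in> star A t v" for a using that by (auto simp: transpose_def)
    then show ?thesis unfolding fs by simp
  qed
  have tv: "t' (r b) = ?v" "t' (r c) = ?w" using star_triple[OF F'(1)] star_triple[OF F'(2)] by blast+
  have hs: "hang A r t' s \<and> inner_verts r t' s = inner_verts r t s"
    by (rule hang_cong[OF rA h(1)]) (use d in \<open>auto intro!: other\<close>)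
  have hu: "hang A r t' u \<and> inner_verts r t' u = inner_verts r t u"
    by (rule hang_cong[OF rA h(2)]) (use d in \<open>auto intro!: other\<close>)
  have hw: "hang A r t' w \<and> inner_verts r t' w = inner_verts r t w"
    by (rule hang_cong[OF rA h(3)]) (use d in \<open>auto intro!: other\<close>)
  let ?T' = "Nd b s (Nd c u w)"
  have e: "{r b, c, root_arc s} = {r b, root_arc s, c}" "{r c, root_arc w, root_arc u} = {r c, root_arc u, root_arc w}" by auto
  have "hang A r t' ?T'" using hs hu hw h ne nn by (simp add: tv F' e)
  moreover have "distinct (inner_verts r t' ?T')" "set (inner_verts r t' ?T') = set (inner_verts r t T)"
    using d hs hu hw tv unfolding T by auto
  moreover have "exchange A t r t'"
    by (rule exchangeI[of c A "root_arc w" "root_arc s"]) (use m1 m2 d(1) ne nn h in \<open>auto simp: t'_def\<close>)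
  moreover have "\<forall>v. v \<notin> set (inner_verts r t T) \<longrightarrow> star A t' v = star A t v" using other unfolding T by auto
  moreover have "forget_inner ?T' = N x1 (N x2 x3)" "root_arc ?T' = root_arc T" using T by simp_all
  ultimately show ?case using exchange_cubic(1)[OF cub] reached_exchange by blast
next
  case (ctx a a' n b)
  then obtain c s u where T: "T = Nd c s u" "forget_inner s = a" "forget_inner u = b" by (cases T) auto
  note cub = ctx.prems(1)
  have rA: "r a \<in> A" if "a \<in> A" for a using cubic_rev_in[OF cub] that by blast
  have h: "hang A r t s" "hang A r t u" "c \<in> A" "star A t (t (r c)) = {r c, root_arc s, root_arc u}"
    "r c \<noteq> root_arc s" "r c \<noteq> root_arc u" "root_arc s \<noteq> root_arc u" using ctx.prems(3) unfolding T by simp_all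
  have d: "distinct (inner_verts r t s)" "distinct (inner_verts r t u)" "t (r c) \<notin> set (inner_verts r t s)" "t (r c) \<notin> set (inner_verts r t u)"
     "set (inner_verts r t s) \<inter> set (inner_verts r t u) = {}" using ctx.prems(4) unfolding T by auto
  obtain t' s' where 1: "forget_inner s' = a'" "hang A r t' s'" "distinct (inner_verts r t' s')" "set (inner_verts r t' s') = set (inner_verts r t s)"
    "root_arc s' = root_arc s" "\<forall>v. v \<notin> set (inner_verts r t s) \<longrightarrow> star A t' v = star A t v" "reached A r n t t'" "cubic g p A t' r"
    using ctx.IH[OF cub T(2) h(1) d(1)] by (elim exE conjE)
  have hu: "hang A r t' u \<and> inner_verts r t' u = inner_verts r t u"
    by (rule hang_cong[OF rA h(2)]) (use d(5) 1(6) in auto)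
  have f: "star A t' (t (r c)) = {r c, root_arc s, root_arc u}" using 1(6) d(3) h(4) by simp
  have tv: "t' (r c) = t (r c)" using star_triple[OF f] by blast
  let ?T' = "Nd c s' u"
  have "hang A r t' ?T'" using h 1 hu f tv by simp
  moreover have "distinct (inner_verts r t' ?T')" "set (inner_verts r t' ?T') = set (inner_verts r t T)"
    using d hu 1 tv unfolding T by auto
  moreover have "\<forall>v. v \<notin> set (inner_verts r t T) \<longrightarrow> star A t' v = star A t v" using 1(6) unfolding T by auto
  moreover have "forget_inner ?T' = N a' b" "root_arc ?T' = root_arc T" using T 1 by simp_all
  ultimately show ?case using 1 by blast
next
  case (slack S S' m n)
  show ?case using slack.IH[OF slack.prems] reached_mono[OF _ slack.hyps(2)] by blast
qed

section \<open>Existence of spanning trees\<close>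

definition spans :: "nat set \<Rightarrow> (nat \<Rightarrow> nat) \<Rightarrow> (nat \<Rightarrow> nat) \<Rightarrow> nat arc_tree \<Rightarrow> bool" where
  "spans A r t T \<longleftrightarrow> hang A r t T \<and> distinct (inner_verts r t T) \<and> set (inner_verts r t T) = {v \<in> t ` A. card (star A t v) = 3}"

lemma hang_inner_verts:
  assumes "\<And>a. a \<in> A \<Longrightarrow> r a \<in> A"
  shows "hang A r t T \<Longrightarrow> set (inner_verts r t T) \<subseteq> {v \<in> t ` A. card (star A t v) = 3}"
proof (induction T)
  case (Nd b s u)
  have "card (star A t (t (r b))) = 3" using Nd.prems by simp
  moreover have "t (r b) \<in> t ` A" using Nd.prems assms by simp
  ultimately show ?case using Nd by simp
qed simp

text \<open>An edge leaving the spanned set can start only at the root or at a leaf of the tree, so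
  these are the only places where a tree that does not yet span has to grow.\<close>

lemma arcs_cover:
  assumes rr: "\<And>a. r (r a) = a"
  shows "hang A r t T \<Longrightarrow> a \<in> A \<Longrightarrow> t a \<in> set (inner_verts r t T) \<Longrightarrow>
    a = r (root_arc T) \<or> t (r a) \<in> set (inner_verts r t T) \<or> a \<in> set (labels (forget_inner T))"
proof (induction T)
  case (Nd b s u)
  have sub: "a = r (root_arc w) \<or> t (r a) \<in> set (inner_verts r t w) \<or> a \<in> set (labels (forget_inner w)) \<Longrightarrow> w \<in> {s, u} \<Longrightarrow> ?case" for w
  proof -
    assume w: "w \<in> {s, u}" and "a = r (root_arc w) \<or> t (r a) \<in> set (inner_verts r t w) \<or> a \<in> set (labels (forget_inner w))"
    then consider "a = r (root_arc w)" | "t (r a) \<in> set (inner_verts r t w) \<or> a \<in> set (labels (forget_inner w))" by blast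
    then show ?case
    proof cases
      case 1
      have "root_arc w \<in> star A t (t (r b))" using Nd.prems(1) w by auto
      then have "t (r a) = t (r b)" using 1 rr by (simp add: star_def)
      then show ?thesis by simp
    next
      case 2
      then show ?thesis using w by auto
    qed
  qed
  consider "t a = t (r b)" | "t a \<in> set (inner_verts r t s)" | "t a \<in> set (inner_verts r t u)" using Nd.prems(3) by auto
  then show ?case
  proof cases
    case 1
    then have "a \<in> star A t (t (r b))" using Nd.prems(2) by (simp add: star_def)
    then consider "a = r b" | "a = root_arc s" | "a = root_arc u" using Nd.prems(1) by auto
    then show ?thesis
    proof cases
      case 2
      then show ?thesis by (cases s) simp_all
    next
      case 3
      then show ?thesis by (cases u) simp_all
    qed simp
  next
    case 2
    then show ?thesis using sub[of s] Nd by simp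
  next
    case 3
    then show ?thesis using sub[of u] Nd by simp
  qed
qed simp

lemma extend_leaf:
  assumes cub: "cubic g p A t r"
  shows "hang A r t T \<Longrightarrow> distinct (inner_verts r t T) \<Longrightarrow> a \<in> set (labels (forget_inner T)) \<Longrightarrow> t (r a) \<notin> set (inner_verts r t T) \<Longrightarrow>
    card (star A t (t (r a))) = 3 \<Longrightarrow>
    \<exists>T'. hang A r t T' \<and> distinct (inner_verts r t T') \<and> set (inner_verts r t T') = insert (t (r a)) (set (inner_verts r t T)) \<and> root_arc T' = root_arc T
      \<and> (\<exists>b s u. T' = Nd b s u)"
proof (induction T)
  case (Lf b)
  have b: "b \<in> A" "r b \<in> A" "a = b" using Lf cubic_rev_in[OF cub] by auto
  obtain c d where cd: "star A t (t (r b)) = {r b, c, d}" "r b \<noteq> c" "r b \<noteq> d" "c \<noteq> d"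
    using star_trivalent[OF cub b(2)] Lf(5) b(3) by blast
  have "hang A r t (Nd b (Lf c) (Lf d))" using cd b star_triple[OF cd(1)] by simp
  then show ?case using b by (intro exI[of _ "Nd b (Lf c) (Lf d)"]) simp
next
  case (Nd b s u)
  have h: "hang A r t s" "hang A r t u" and d: "distinct (inner_verts r t s)" "distinct (inner_verts r t u)"
    and n: "t (r a) \<notin> set (inner_verts r t s)" "t (r a) \<notin> set (inner_verts r t u)"
    using Nd.prems by auto
  show ?case
  proof (cases "a \<in> set (labels (forget_inner s))")
    case True
    then obtain s' where "hang A r t s'" "distinct (inner_verts r t s')" "set (inner_verts r t s') = insert (t (r a)) (set (inner_verts r t s))" "root_arc s' = root_arc s"
      using Nd.IH(1)[OF h(1) d(1) True n(1) Nd.prems(5)] by blast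
    then show ?thesis using Nd.prems by (intro exI[of _ "Nd b s' u"]) auto
  next
    case False
    then have "a \<in> set (labels (forget_inner u))" using Nd.prems(3) by simp
    then obtain u' where "hang A r t u'" "distinct (inner_verts r t u')" "set (inner_verts r t u') = insert (t (r a)) (set (inner_verts r t u))" "root_arc u' = root_arc u"
      using Nd.IH(2)[OF h(2) d(2) _ n(2) Nd.prems(5)] by blast
    then show ?thesis using Nd.prems by (intro exI[of _ "Nd b s u'"]) auto
  qed
qed

text \<open>Otherwise the edge is a connected component, hence the whole graph, and no trivalent
  vertex is left for \<open>2 * int g - 2 + int p > 0\<close>.\<close>

lemma pendant_opposite:
  assumes cub: "cubic g p A t r" and pos: "2 * int g - 2 + int p > 0" and a: "a \<in> A" "card (star A t (t a)) = 1"
  shows "card (star A t (t (r a))) = 3"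
proof (rule ccontr)
  assume n: "card (star A t (t (r a))) \<noteq> 3"
  note rA = cubic_rev_in[OF cub] and rr = cubic_rev_rev[OF cub]
  have ra: "r a \<in> A" using a rA by blast
  have "star A t (t a) = {a}" using cubic_star_cases[OF cub a(1)] a(2) by auto
  moreover have "star A t (t (r a)) = {r a}" using cubic_star_cases[OF cub ra] n by auto
  ultimately have only: "b = a \<or> b = r a" if "b \<in> A" "t b = t a \<or> t b = t (r a)" for b
    using that unfolding star_def by blast
  have l: "(\<forall>b\<in>A. t b \<in> {t a, t (r a)} \<longrightarrow> t (r b) \<in> {t a, t (r a)}) \<longrightarrow> (\<exists>b\<in>A. t b \<in> {t a, t (r a)})
     \<longrightarrow> (\<forall>b\<in>A. t b \<in> {t a, t (r a)})" using cub unfolding cubic_def linked_def by blast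
  have "\<forall>b\<in>A. t b \<in> {t a, t (r a)}"
  proof (rule l[THEN mp, THEN mp])
    show "\<forall>b\<in>A. t b \<in> {t a, t (r a)} \<longrightarrow> t (r b) \<in> {t a, t (r a)}"
      using only rr by (metis insert_iff singletonD)
  qed (use a in blast)
  then have "{v \<in> t ` A. card (star A t v) = 3} = {}" using n a(2) by auto
  then have "card {v \<in> t ` A. card (star A t v) = 3} = 0" by (simp only: card.empty)
  then show False using cub pos unfolding cubic_def by linarith
qed

text \<open>A tree with the most nodes spans, since a trivalent vertex next to it could be added.
  Starting at a leaf of the graph when there is one makes the root edge end in that leaf, so that
  its half-edge is not also a leaf of the tree.\<close>

lemma ex_spans:
  assumes cub: "cubic g p A t r" and pos: "2 * int g - 2 + int p > 0"
  shows "\<exists>b s u. spans A r t (Nd b s u) \<and> (p > 0 \<longrightarrow> card (star A t (t b)) = 1)"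
proof -
  note rA = cubic_rev_in[OF cub] and rr = cubic_rev_rev[OF cub]
  let ?V = "{v \<in> t ` A. card (star A t v) = 3}"
  have V: "int (card ?V) = 2 * int g - 2 + int p" and P: "card {v \<in> t ` A. card (star A t v) = 1} = p"
    using cub unfolding cubic_def by blast+
  have finV: "finite ?V" using cubic_finite[OF cub] by simp
  define good where "good T \<longleftrightarrow> hang A r t T \<and> distinct (inner_verts r t T) \<and> (\<exists>b s u. T = Nd b s u)
     \<and> (p > 0 \<longrightarrow> card (star A t (t (root_arc T))) = 1)" for T
  have start: "\<exists>T. good T" if b: "b \<in> A" "card (star A t (t (r b))) = 3" "p > 0 \<longrightarrow> card (star A t (t b)) = 1" for b
  proof -
    have "\<exists>T'. hang A r t T' \<and> distinct (inner_verts r t T') \<and> set (inner_verts r t T') = insert (t (r b)) (set (inner_verts r t (Lf b))) \<and> root_arc T' = root_arc (Lf b)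
      \<and> (\<exists>b s u. T' = Nd b s u)"
      by (rule extend_leaf[OF cub]) (use b in simp_all)
    then show ?thesis using b(3) unfolding good_def by auto
  qed
  have ex: "\<exists>T. good T"
  proof (cases "p > 0")
    case True
    then have "{v \<in> t ` A. card (star A t v) = 1} \<noteq> {}" using P by (metis card.empty less_irrefl)
    then obtain b where "b \<in> A" "card (star A t (t b)) = 1" by blast
    then show ?thesis using start[of b] pendant_opposite[OF cub pos] by blast
  next
    case False
    have "?V \<noteq> {}" using V pos by (metis card.empty less_irrefl of_nat_0)
    then obtain b where b: "b \<in> A" "card (star A t (t b)) = 3" by blast
    then show ?thesis using start[of "r b"] rA[of b] rr[of b] False by simp
  qed
  have bound: "length (inner_verts r t T) \<le> card ?V" if "good T" for T
  proof -
    have "set (inner_verts r t T) \<subseteq> ?V" using hang_inner_verts[of A r t T] rA that good_def by blast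
    then have "card (set (inner_verts r t T)) \<le> card ?V" by (rule card_mono[OF finV])
    then show ?thesis using that distinct_card[of "inner_verts r t T"] unfolding good_def by simp
  qed
  obtain T where T: "good T" "\<And>T'. good T' \<Longrightarrow> length (inner_verts r t T') \<le> length (inner_verts r t T)"
  proof -
    obtain T0 where T0: "good T0" using ex by blast
    have "\<forall>y. good y \<longrightarrow> length (inner_verts r t y) < Suc (card ?V)" using bound by (simp add: less_Suc_eq_le)
    from ex_has_greatest_nat[of good, OF T0 this] show ?thesis using that by blast
  qed
  let ?S = "set (inner_verts r t T)"
  have h: "hang A r t T" "distinct (inner_verts r t T)" using T(1) by (simp_all add: good_def)
  have bigger: False if "hang A r t T'" "distinct (inner_verts r t T')" "\<exists>b s u. T' = Nd b s u"
      "p > 0 \<longrightarrow> card (star A t (t (root_arc T'))) = 1" "set (inner_verts r t T') = insert v ?S" "v \<notin> ?S" for T' v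
  proof -
    have "length (inner_verts r t T') = card (insert v ?S)" using distinct_card[OF that(2)] that(5) by simp
    also have "\<dots> = Suc (length (inner_verts r t T))" using that(6) distinct_card[OF h(2)] by simp
    finally show False using T(2)[of T'] that(1-4) by (simp add: good_def)
  qed
  have step: "t (r a) \<in> ?S" if a: "a \<in> A" "t a \<in> ?S" "card (star A t (t (r a))) = 3" for a
  proof (rule ccontr)
    assume n: "t (r a) \<notin> ?S"
    then consider "a = r (root_arc T)" | "a \<in> set (labels (forget_inner T))" using arcs_cover[of r A t T a] rr h(1) a by blast
    then show False
    proof cases
      case 1
      then have ra: "r a = root_arc T" using rr by simp
      then have p0: "p = 0" using T(1) a(3) by (auto simp: good_def)
      have "r a \<in> A" using a rA by blast
      then obtain y z where yz: "star A t (t (r a)) = {r a, y, z}" "r a \<noteq> y" "r a \<noteq> z" "y \<noteq> z"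
        using star_trivalent[OF cub _ a(3)] by blast
      note m = star_triple[OF yz(1)]
      \<comment> \<open>Growth above the root, which occurs only when the graph has no leaves: the
        old root edge becomes an inner edge, and the edge of \<open>y\<close> becomes the new root
        edge.\<close>
      have "hang A r t (Nd (r y) (Lf z) T)" using yz m ra rr rA h by (auto simp: insert_commute)
      moreover have "distinct (inner_verts r t (Nd (r y) (Lf z) T))" "set (inner_verts r t (Nd (r y) (Lf z) T)) = insert (t (r a)) ?S"
        using h(2) n m rr by simp_all
      ultimately show False using bigger[of "Nd (r y) (Lf z) T"] p0 n by blast
    next
      case 2
      obtain T' where "hang A r t T'" "distinct (inner_verts r t T')" "set (inner_verts r t T') = insert (t (r a)) ?S" "root_arc T' = root_arc T"
         "\<exists>b s u. T' = Nd b s u"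
        using extend_leaf[OF cub h 2 n a(3)] by blast
      then show False using bigger[of T' "t (r a)"] n T(1) by (simp add: good_def)
    qed
  qed
  \<comment> \<open>The spanned vertices with the univalent vertices next to them. By maximality
    this set is closed under crossing edges, so connectedness makes it everything.\<close>
  define U where "U = ?S \<union> {v. \<exists>a\<in>A. v = t a \<and> card (star A t v) = 1 \<and> t (r a) \<in> ?S}"
  have closed: "\<forall>a\<in>A. t a \<in> U \<longrightarrow> t (r a) \<in> U"
  proof (intro ballI impI)
    fix a assume a: "a \<in> A" "t a \<in> U"
    have ra: "r a \<in> A" using a rA by blast
    show "t (r a) \<in> U"
    proof (cases "t a \<in> ?S")
      case True
      have "card (star A t (t (r a))) \<in> {1, 3}" using cub ra unfolding cubic_def by blast
      then show ?thesis using step[OF a(1) True] True ra rr unfolding U_def by auto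
    next
      case False
      then obtain a' where a': "a' \<in> A" "t a' = t a" "card (star A t (t a)) = 1" "t (r a') \<in> ?S"
        using a(2) unfolding U_def by auto
      have "star A t (t a) = {a}" using cubic_star_cases[OF cub a(1)] a'(3) by auto
      then have "a' = a" using a' unfolding star_def by blast
      then show ?thesis using a'(4) unfolding U_def by blast
    qed
  qed
  have l: "(\<forall>a\<in>A. t a \<in> U \<longrightarrow> t (r a) \<in> U) \<longrightarrow> (\<exists>a\<in>A. t a \<in> U) \<longrightarrow> (\<forall>a\<in>A. t a \<in> U)"
    using cub unfolding cubic_def linked_def by blast
  obtain b s u where bsu: "T = Nd b s u" using T(1) good_def by blast
  have "t (r b) \<in> U" "r b \<in> A" using h(1) rA unfolding bsu U_def by simp_all
  then have all: "\<forall>a\<in>A. t a \<in> U" using l closed by blast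
  have "?V \<subseteq> ?S"
  proof
    fix v assume "v \<in> ?V"
    then have "v \<in> U" "card (star A t v) = 3" using all by auto
    then show "v \<in> ?S" unfolding U_def by auto
  qed
  then have "spans A r t T" using h hang_inner_verts[of A r t T] rA unfolding spans_def by blast
  then show ?thesis using T(1) bsu unfolding good_def by auto
qed

section \<open>A graph in normal form is determined by its tree\<close>

fun arc_list :: "'a arc_tree \<Rightarrow> 'a list" where
  "arc_list (Lf b) = [b]"
| "arc_list (Nd b s u) = b # arc_list s @ arc_list u"

fun inner_arcs :: "'a arc_tree \<Rightarrow> 'a set" where
  "inner_arcs (Lf b) = {}"
| "inner_arcs (Nd b s u) = insert b (inner_arcs s \<union> inner_arcs u)"

text \<open>The stars of the spanned vertices, written without the tail function, so that a
  relabelling of the tree transports them.\<close>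

fun blocks :: "(nat \<Rightarrow> nat) \<Rightarrow> nat arc_tree \<Rightarrow> nat set set" where
  "blocks r (Lf b) = {}"
| "blocks r (Nd b s u) = insert {r b, root_arc s, root_arc u} (blocks r s \<union> blocks r u)"

lemma al_Cons: "arc_list T = root_arc T # tl (arc_list T)"
  by (cases T) auto

lemma set_al: "set (arc_list T) = insert (root_arc T) (set (tl (arc_list T)))"
  by (metis al_Cons list.simps(15))

lemma labs_subset_al: "set (labels (forget_inner T)) \<subseteq> set (arc_list T)"
  by (induction T) auto

lemma nds_subset_al: "inner_arcs T \<subseteq> set (arc_list T)"
  by (induction T) auto

lemma al_subset: "set (arc_list T) \<subseteq> set (labels (forget_inner T)) \<union> inner_arcs T"
  by (induction T) auto

lemma set_arc_tree_arcs: "set_arc_tree T = set (arc_list T)"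
  by (induction T) auto

lemma ar_map: "root_arc (map_arc_tree f T) = f (root_arc T)"
  by (cases T) auto

lemma labs_map: "labels (forget_inner (map_arc_tree f T)) = map f (labels (forget_inner T))"
  by (induction T) auto

lemma distinct_labs_al: "distinct (arc_list T) \<Longrightarrow> distinct (labels (forget_inner T))"
proof (induction T)
  case (Nd b s u)
  then show ?case using labs_subset_al[of s] labs_subset_al[of u] by auto
qed simp

lemma tl_al_tail: "hang A r t T \<Longrightarrow> c \<in> set (tl (arc_list T)) \<Longrightarrow> c \<in> A \<and> t c \<in> set (inner_verts r t T)"
proof (induction T)
  case (Nd b s u)
  have f: "star A t (t (r b)) = {r b, root_arc s, root_arc u}" using Nd.prems(1) by simp
  note m = star_triple[OF f]
  have "c = root_arc s \<or> c = root_arc u \<or> c \<in> set (tl (arc_list s)) \<or> c \<in> set (tl (arc_list u))"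
    using Nd.prems(2) set_al[of s] set_al[of u] by auto
  then show ?case using m Nd by auto
qed simp

lemma inner_arcs_verts: "c \<in> inner_arcs T \<Longrightarrow> t (r c) \<in> set (inner_verts r t T)"
  by (induction T) auto

text \<open>Listed half-edges below the root are attached to inner vertices, which are distinct. The
  head of the list is left out because the root half-edge recurs as a leaf when
  \<open>p = 0\<close>.\<close>

lemma distinct_tl_al: "hang A r t T \<Longrightarrow> distinct (inner_verts r t T) \<Longrightarrow> distinct (tl (arc_list T))"
proof (induction T)
  case (Nd b s u)
  have f: "star A t (t (r b)) = {r b, root_arc s, root_arc u}" and h: "hang A r t s" "hang A r t u" "root_arc s \<noteq> root_arc u"
    using Nd.prems(1) by simp_all
  note m = star_triple[OF f]
  have d: "distinct (inner_verts r t s)" "distinct (inner_verts r t u)" "t (r b) \<notin> set (inner_verts r t s)" "t (r b) \<notin> set (inner_verts r t u)"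
    "set (inner_verts r t s) \<inter> set (inner_verts r t u) = {}" using Nd.prems(2) by auto
  have "distinct (tl (arc_list s))" "distinct (tl (arc_list u))" using Nd.IH h d by blast+
  moreover have "root_arc s \<notin> set (tl (arc_list s))" "root_arc s \<notin> set (tl (arc_list u))" "root_arc u \<notin> set (tl (arc_list s))" "root_arc u \<notin> set (tl (arc_list u))"
    using tl_al_tail[OF h(1)] tl_al_tail[OF h(2)] m d(3,4) by metis+
  moreover have "set (tl (arc_list s)) \<inter> set (tl (arc_list u)) = {}"
    using tl_al_tail[OF h(1)] tl_al_tail[OF h(2)] d(5) by blast
  ultimately have "distinct ((root_arc s # tl (arc_list s)) @ (root_arc u # tl (arc_list u)))" using h(3) by auto
  then show ?case using al_Cons[of s] al_Cons[of u] by simp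
qed simp

lemma root_not_in: "hang A r t T \<Longrightarrow> distinct (inner_verts r t T) \<Longrightarrow> r (root_arc T) \<notin> set (tl (arc_list T))"
proof (cases T)
  case (Nd b s u)
  assume h: "hang A r t T" "distinct (inner_verts r t T)"
  then have "hang A r t s" "hang A r t u" "r b \<noteq> root_arc s" "r b \<noteq> root_arc u" "t (r b) \<notin> set (inner_verts r t s)" "t (r b) \<notin> set (inner_verts r t u)"
    unfolding Nd by auto
  then have "r b \<notin> set (arc_list s)" "r b \<notin> set (arc_list u)" unfolding set_al using tl_al_tail by blast+
  then show ?thesis unfolding Nd by simp
qed simp

text \<open>At every inner vertex exactly one half-edge is missing from the tail of
  \<open>arc_list\<close>: the one leading back to the parent.\<close>

lemma nds_rev_not_in: "hang A r t T \<Longrightarrow> distinct (inner_verts r t T) \<Longrightarrow> c \<in> inner_arcs T \<Longrightarrow> r c \<notin> set (tl (arc_list T))"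
proof (induction T)
  case (Nd b s u)
  have h: "hang A r t s" "hang A r t u" and f: "star A t (t (r b)) = {r b, root_arc s, root_arc u}"
    using Nd.prems(1) by simp_all
  note m = star_triple[OF f]
  have d: "distinct (inner_verts r t s)" "distinct (inner_verts r t u)" "t (r b) \<notin> set (inner_verts r t s)" "t (r b) \<notin> set (inner_verts r t u)"
    "set (inner_verts r t s) \<inter> set (inner_verts r t u) = {}" using Nd.prems(2) by auto
  consider "c = b" | "c \<in> inner_arcs s" | "c \<in> inner_arcs u" using Nd.prems(3) by auto
  then show ?case
  proof cases
    case 1
    then show ?thesis using root_not_in[OF Nd.prems(1,2)] by simp
  next
    case 2
    then have v: "t (r c) \<in> set (inner_verts r t s)" by (rule inner_arcs_verts)
    have "r c \<notin> set (arc_list s)" unfolding set_al using Nd.IH(1)[OF h(1) d(1) 2] v d(3) m by auto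
    moreover have "r c \<notin> set (arc_list u)" unfolding set_al using tl_al_tail[OF h(2)] v d(3,5) m by auto
    ultimately show ?thesis by simp
  next
    case 3
    then have v: "t (r c) \<in> set (inner_verts r t u)" by (rule inner_arcs_verts)
    have "r c \<notin> set (arc_list u)" unfolding set_al using Nd.IH(2)[OF h(2) d(2) 3] v d(4) m by auto
    moreover have "r c \<notin> set (arc_list s)" unfolding set_al using tl_al_tail[OF h(1)] v d(4,5) m by auto
    ultimately show ?thesis by simp
  qed
qed simp

text \<open>A half-edge below the root occurs once in the list, so it is either cut or followed;
  only the root half-edge can be both.\<close>

lemma labs_nds: "hang A r t T \<Longrightarrow> distinct (inner_verts r t T) \<Longrightarrow> c \<in> set (labels (forget_inner T)) \<Longrightarrow> c \<in> inner_arcs T \<Longrightarrow> c = root_arc T"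
proof (induction T)
  case (Nd b s u)
  have h: "hang A r t s" "hang A r t u" and f: "star A t (t (r b)) = {r b, root_arc s, root_arc u}"
    using Nd.prems(1) by simp_all
  note m = star_triple[OF f]
  have d: "distinct (inner_verts r t s)" "distinct (inner_verts r t u)" "t (r b) \<notin> set (inner_verts r t s)" "t (r b) \<notin> set (inner_verts r t u)"
    using Nd.prems(2) by auto
  have dis: "distinct (arc_list s @ arc_list u)" using distinct_tl_al[OF Nd.prems(1,2)] by simp
  have no: "False" if "w \<in> {s, u}" "c \<in> set (labels (forget_inner w))" "c \<in> inner_arcs w" for w
  proof -
    have hw: "hang A r t w" "distinct (inner_verts r t w)" "t (r b) \<notin> set (inner_verts r t w)" "t (root_arc w) = t (r b)"
      using that(1) h d m by auto
    have c: "c = root_arc w" using Nd.IH that hw by blast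
    have "\<exists>e s' u'. w = Nd e s' u'" using that(3) by (cases w) auto
    then obtain e s' u' where w: "w = Nd e s' u'" by (elim exE)
    have "c \<in> set (tl (arc_list w))" using that(2) labs_subset_al[of s'] labs_subset_al[of u'] unfolding w by auto
    then show False using tl_al_tail[OF hw(1)] hw(3,4) c by metis
  qed
  show ?case
  proof (rule ccontr)
    assume "c \<noteq> root_arc (Nd b s u)"
    then have "c \<in> inner_arcs s \<or> c \<in> inner_arcs u" "c \<in> set (labels (forget_inner s)) \<or> c \<in> set (labels (forget_inner u))" using Nd.prems by auto
    then show False using no dis labs_subset_al[of s] labs_subset_al[of u] nds_subset_al[of s] nds_subset_al[of u]
      by auto
  qed
qed simp

lemma arcs_at: "hang A r t T \<Longrightarrow> a \<in> A \<Longrightarrow> t a \<in> set (inner_verts r t T) \<Longrightarrow> a \<in> set (tl (arc_list T)) \<or> (\<exists>c\<in>inner_arcs T. a = r c)"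
proof (induction T)
  case (Nd b s u)
  consider "t a = t (r b)" | "t a \<in> set (inner_verts r t s)" | "t a \<in> set (inner_verts r t u)" using Nd.prems(3) by auto
  then show ?case
  proof cases
    case 1
    then have "a \<in> star A t (t (r b))" using Nd.prems(2) by (simp add: star_def)
    then have "a = r b \<or> a = root_arc s \<or> a = root_arc u" using Nd.prems(1) by simp
    then show ?thesis by (auto simp: set_al)
  next
    case 2
    then show ?thesis using Nd set_al[of s] by auto
  next
    case 3
    then show ?thesis using Nd set_al[of u] by auto
  qed
qed simp

lemma blocks_star: "hang A r t T \<Longrightarrow> blocks r T = star A t ` set (inner_verts r t T)"
  by (induction T) (auto simp: image_Un)

lemma bl_map: "(\<And>a. a \<in> set (arc_list T) \<Longrightarrow> \<phi> a = f a \<and> \<phi> (r a) = s (f a)) \<Longrightarrow> blocks s (map_arc_tree f T) = (\<lambda>P. \<phi> ` P) ` blocks r T"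
proof (induction T)
  case (Nd b S U)
  have "blocks s (map_arc_tree f S) = (\<lambda>P. \<phi> ` P) ` blocks r S" "blocks s (map_arc_tree f U) = (\<lambda>P. \<phi> ` P) ` blocks r U"
    using Nd by auto
  moreover have "\<phi> (r b) = s (f b)" "\<phi> (root_arc S) = f (root_arc S)" "\<phi> (root_arc U) = f (root_arc U)"
    using Nd.prems set_al[of S] set_al[of U] by auto
  ultimately show ?case by (simp add: ar_map image_Un)
qed simp

abbreviation shape :: "'a ltree \<Rightarrow> unit ltree" where
  "shape \<equiv> map_ltree (\<lambda>_. ())"

lemma ex_map: "shape (forget_inner T) = shape (forget_inner T') \<Longrightarrow> distinct (arc_list T) \<Longrightarrow> \<exists>f. map_arc_tree f T = T'"
proof (induction T arbitrary: T')
  case (Lf b)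
  then obtain c where "T' = Lf c" by (cases T') auto
  then show ?case by (intro exI[of _ "\<lambda>_. c"]) simp
next
  case (Nd b s u)
  then obtain c s' u' where T': "T' = Nd c s' u'" by (cases T') auto
  obtain f1 where f1: "map_arc_tree f1 s = s'" using Nd.IH(1)[of s'] Nd.prems unfolding T' by auto
  obtain f2 where f2: "map_arc_tree f2 u = u'" using Nd.IH(2)[of u'] Nd.prems unfolding T' by auto
  define f where "f a = (if a = b then c else if a \<in> set (arc_list s) then f1 a else f2 a)" for a
  have "map_arc_tree f s = map_arc_tree f1 s" by (rule arc_tree.map_cong0) (use Nd.prems(2) in \<open>auto simp: f_def set_arc_tree_arcs\<close>)
  moreover have "map_arc_tree f u = map_arc_tree f2 u" by (rule arc_tree.map_cong0) (use Nd.prems(2) in \<open>auto simp: f_def set_arc_tree_arcs\<close>)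
  moreover have "f b = c" by (simp add: f_def)
  ultimately show ?case using f1 f2 unfolding T' by (intro exI[of _ f]) simp
qed

lemma map_comb: "xs \<noteq> [] \<Longrightarrow> map_ltree f (comb xs) = comb (map (map_ltree f) xs)"
  by (induction xs rule: comb.induct) auto

lemma labs_comb: "xs \<noteq> [] \<Longrightarrow> labels (comb xs) = concat (map labels xs)"
  by (induction xs rule: comb.induct) auto

lemma labs_normal: "loops ps @ map L zs \<noteq> [] \<Longrightarrow> labels (comb (loops ps @ map L zs)) = flat ps @ zs"
proof -
  have "concat (map labels (loops ps)) = flat ps" by (induction ps) auto
  moreover have "concat (map labels (map L zs)) = zs" by (induction zs) auto
  ultimately show "loops ps @ map L zs \<noteq> [] \<Longrightarrow> labels (comb (loops ps @ map L zs)) = flat ps @ zs"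
    by (simp add: labs_comb del: map_map)
qed

lemma length_flat: "length (flat ps) = 2 * length ps"
  by (induction ps) auto

lemma flat_eqD: "map f (flat ps) = flat qs \<Longrightarrow> qs = map (\<lambda>(x, y). (f x, f y)) ps"
proof (induction ps arbitrary: qs)
  case Nil
  then show ?case by (cases qs) auto
next
  case (Cons p ps)
  obtain x y where p: "p = (x, y)" by (cases p)
  obtain q qs' where q: "qs = q # qs'" using Cons.prems p by (cases qs) auto
  obtain x' y' where q': "q = (x', y')" by (cases q)
  show ?case using Cons p q q' by auto
qed

lemma card_cubic: "cubic g p A t r \<Longrightarrow> int (card A) = int p + 3 * (2 * int g - 2 + int p)"
  using card_half_edges(1)[of A t] unfolding cubic_def by auto

text \<open>Trees of the same shape match the listed half-edges, and commuting with the involutions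
  extends the matching to all others. Nothing conflicts because two partners are both listed only
  when they form one of the pairs. Stars of trivalent vertices are visible in the trees, and
  univalent vertices have one half-edge each, so equality of tails is respected.\<close>

lemma normal_form_isomorphic:
  assumes cub: "cubic g p A t r" "cubic g p B u s" and pos: "2 * int g - 2 + int p > 0"
    and spans: "spans A r t T" "spans B s u T'"
    and T: "T = Nd b S U" "T' = Nd c S' U'"
    and ltree: "forget_inner T = comb (loops ps @ map L zs)" "forget_inner T' = comb (loops qs @ map L ws)"
 and ne: "loops ps @ map L zs \<noteq> []"
    and len: "length ps = length qs" "length zs = length ws"
    and pairs: "\<And>x y. (x, y) \<in> set ps \<Longrightarrow> y = r x" "\<And>x y. (x, y) \<in> set qs \<Longrightarrow> y = s x"
    and singles: "\<And>z. z \<in> set zs \<Longrightarrow> r z \<notin> set (labels (forget_inner T))"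
    and root: "(b \<notin> set (labels (forget_inner T)) \<and> c \<notin> set (labels (forget_inner T'))) \<or> (zs = [b] \<and> ws = [c])"
  shows "isomorphic A t r B u s"
proof -
  note rA = cubic_rev_in[OF cub(1)] and rr = cubic_rev_rev[OF cub(1)] and rB = cubic_rev_in[OF cub(2)] and ss = cubic_rev_rev[OF cub(2)]
  have h: "hang A r t T" "distinct (inner_verts r t T)" "set (inner_verts r t T) = {v \<in> t ` A. card (star A t v) = 3}"
    using spans(1) by (simp_all add: spans_def)
  have h': "hang B s u T'" "set (inner_verts s u T') = {v \<in> u ` B. card (star B u v) = 3}"
    using spans(2) by (simp_all add: spans_def)
  have ne': "loops qs @ map L ws \<noteq> []" using ne len by auto
  have lT: "labels (forget_inner T) = flat ps @ zs" "labels (forget_inner T') = flat qs @ ws"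
    unfolding ltree using labs_normal ne ne' by blast+
  have "map (map_ltree (\<lambda>_. ())) (loops ps) = map (map_ltree (\<lambda>_. ())) (loops qs)"
    using len(1) by (induction ps qs rule: list_induct2) auto
  moreover have "map (map_ltree (\<lambda>_. ())) (map L zs) = map (map_ltree (\<lambda>_. ())) (map L ws)"
    using len(2) by (induction zs ws rule: list_induct2) auto
  ultimately have sh: "shape (forget_inner T) = shape (forget_inner T')"
    unfolding ltree map_comb[OF ne] map_comb[OF ne'] map_append by argo
  have dis: "distinct (arc_list S @ arc_list U)" using distinct_tl_al[OF h(1,2)] unfolding T by simp
  obtain f1 where f1: "map_arc_tree f1 S = S'" using ex_map[of S S'] sh dis unfolding T by auto
  obtain f2 where f2: "map_arc_tree f2 U = U'" using ex_map[of U U'] sh dis unfolding T by auto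
  \<comment> \<open>The root half-edge \<open>b\<close> goes to \<open>c\<close> by default; if it
    is also a leaf, the leaf decides, and the assumption \<open>root\<close> makes both
    agree.\<close>
  define f where "f a = (if a \<in> set (arc_list S) then f1 a else if a \<in> set (arc_list U) then f2 a else c)" for a
  have "map_arc_tree f S = map_arc_tree f1 S" by (rule arc_tree.map_cong0) (auto simp: f_def set_arc_tree_arcs)
  moreover have "map_arc_tree f U = map_arc_tree f2 U" by (rule arc_tree.map_cong0) (use dis in \<open>auto simp: f_def set_arc_tree_arcs\<close>)
  ultimately have fSU: "map_arc_tree f S = S'" "map_arc_tree f U = U'" using f1 f2 by simp_all
  have fl: "map f (flat ps @ zs) = flat qs @ ws"
  proof -
    have "map f (labels (forget_inner T)) = labels (forget_inner T')"
      using labs_map[of f S] labs_map[of f U] fSU unfolding T by simp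
    then show ?thesis unfolding lT .
  qed
  have fl2: "map f (flat ps) = flat qs" "map f zs = ws"
    using fl len length_flat[of ps] length_flat[of qs] by (simp_all add: append_eq_append_conv)
  have bnd: "b \<notin> inner_arcs S" "b \<notin> inner_arcs U"
    using h(2) inner_arcs_verts[of b S t r] inner_arcs_verts[of b U t r] unfolding T by auto
  have fb: "f b = c"
  proof (cases "b \<in> set (labels (forget_inner T))")
    case True
    then have "zs = [b]" "ws = [c]" using root by blast+
    then show ?thesis using fl2(2) by simp
  next
    case False
    then have "b \<notin> set (arc_list S)" "b \<notin> set (arc_list U)" using al_subset[of S] al_subset[of U] bnd unfolding T by auto
    then show ?thesis by (simp add: f_def)
  qed
  have fT: "map_arc_tree f T = T'" unfolding T using fb fSU by simp
  have alT: "set (arc_list T') = f ` set (arc_list T)"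
    using fT arc_tree.set_map[of f T] by (simp add: set_arc_tree_arcs)
  have bT: "root_arc T = b" "arc_list T = b # tl (arc_list T)" using T by simp_all
  \<comment> \<open>Neither of two listed partners is the root or an inner half-edge, since the
    partners of those are never listed. So both are leaves and hence form one of the pairs.\<close>
  have compat: "f (r a) = s (f a)" if a: "a \<in> set (arc_list T)" "r a \<in> set (arc_list T)" for a
  proof -
    have aA: "a \<in> A" using a(1) set_al[of T] tl_al_tail[OF h(1)] ar_in[OF h(1)] by auto
    have rb: "r b \<notin> set (arc_list T)" using root_not_in[OF h(1,2)] cubic_rev_neq[OF cub(1) ar_in[OF h(1)]] bT set_al[of T] by auto
    have ab: "a \<noteq> b" "r a \<noteq> b" using rb a rr[of a] by metis+
    have tl: "a \<in> set (tl (arc_list T))" "r a \<in> set (tl (arc_list T))" using a ab set_al[of T] bT by auto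
    then have "a \<notin> inner_arcs T" "r a \<notin> inner_arcs T"
      using nds_rev_not_in[OF h(1,2), of a] nds_rev_not_in[OF h(1,2), of "r a"] rr[of a] by auto
    then have lab: "a \<in> set (labels (forget_inner T))" "r a \<in> set (labels (forget_inner T))" using a al_subset[of T] by auto
    then have "a \<notin> set zs" using singles by blast
    then have "a \<in> set (flat ps)" using lab(1) unfolding lT(1) by simp
    then obtain x y where xy: "(x, y) \<in> set ps" "a = x \<or> a = y" by auto
    have "(f x, f y) \<in> set qs" using flat_eqD[OF fl2(1)] xy(1) by force
    then have "f y = s (f x)" "y = r x" using pairs xy(1) by blast+
    then show ?thesis using xy(2) rr ss by auto
  qed
  \<comment> \<open>At a trivalent vertex only the half-edge back to the parent can be missing from
    the list, and its partner is listed; the edge at a univalent vertex ends in a trivalent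
    one.\<close>
  have cover: "a \<in> set (arc_list T) \<or> r a \<in> set (arc_list T)" if a: "a \<in> A" for a
  proof -
    have c3: "x \<in> set (arc_list T) \<or> (r x \<in> inner_arcs T)" if "x \<in> A" "card (star A t (t x)) = 3" for x
      using arcs_at[OF h(1) that(1)] that h(3) set_al[of T] rr by auto
    show ?thesis
    proof (cases "card (star A t (t a)) = 3")
      case True
      then show ?thesis using c3[OF a] nds_subset_al[of T] by blast
    next
      case False
      then have "card (star A t (t a)) = 1" using cub(1) a unfolding cubic_def by auto
      then have "card (star A t (t (r a))) = 3" by (rule pendant_opposite[OF cub(1) pos a])
      then show ?thesis using c3[of "r a"] rA rr nds_subset_al[of T] a by auto
    qed
  qed
  have cover': "b' \<in> set (arc_list T') \<or> s b' \<in> set (arc_list T')" if b': "b' \<in> B" for b'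
  proof -
    have c3: "x \<in> set (arc_list T') \<or> (s x \<in> inner_arcs T')" if "x \<in> B" "card (star B u (u x)) = 3" for x
      using arcs_at[OF h'(1) that(1)] that h'(2) set_al[of T'] ss by auto
    show ?thesis
    proof (cases "card (star B u (u b')) = 3")
      case True
      then show ?thesis using c3[OF b'] nds_subset_al[of T'] by blast
    next
      case False
      then have "card (star B u (u b')) = 1" using cub(2) b' unfolding cubic_def by auto
      then have "card (star B u (u (s b'))) = 3" by (rule pendant_opposite[OF cub(2) pos b'])
      then show ?thesis using c3[of "s b'"] rB ss nds_subset_al[of T'] b' by auto
    qed
  qed
  define \<phi> where "\<phi> a = (if a \<in> set (arc_list T) then f a else s (f (r a)))" for a
  have alA: "set (arc_list T) \<subseteq> A" using set_al[of T] tl_al_tail[OF h(1)] ar_in[OF h(1)] by auto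
  have alB: "set (arc_list T') \<subseteq> B" using set_al[of T'] tl_al_tail[OF h'(1)] ar_in[OF h'(1)] by auto
  have comm: "\<phi> (r a) = s (\<phi> a)" if "a \<in> A" for a
    using cover[OF that] compat[of a] rr[of a] ss by (auto simp: \<phi>_def)
  have into: "\<phi> a \<in> B" if "a \<in> A" for a
    using cover[OF that] alT alB rB by (auto simp: \<phi>_def)
  have onto: "B \<subseteq> \<phi> ` A"
  proof
    fix b' assume b': "b' \<in> B"
    show "b' \<in> \<phi> ` A"
    proof (cases "b' \<in> set (arc_list T')")
      case True
      then obtain a where "a \<in> set (arc_list T)" "b' = f a" using alT by auto
      then show ?thesis using alA by (auto simp: \<phi>_def)
    next
      case False
      then obtain a where a: "a \<in> set (arc_list T)" "s b' = f a" using cover'[OF b'] alT by auto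
      then have "a \<in> A" using alA by blast
      then have "\<phi> (r a) = b'" using comm[of a] a ss[of b'] by (simp add: \<phi>_def)
      then show ?thesis using \<open>a \<in> A\<close> rA by blast
    qed
  qed
  have im: "\<phi> ` A = B" using into onto by blast
  have "int (card A) = int (card B)" using card_cubic[OF cub(1)] card_cubic[OF cub(2)] by simp
  then have inj: "inj_on \<phi> A" using im cubic_finite[OF cub(1)] by (simp add: eq_card_imp_inj_on)
  have "blocks s (map_arc_tree f T) = (\<lambda>P. \<phi> ` P) ` blocks r T"
  proof (rule bl_map)
    fix a assume a: "a \<in> set (arc_list T)"
    then have "\<phi> a = f a" by (simp add: \<phi>_def)
    then show "\<phi> a = f a \<and> \<phi> (r a) = s (f a)" using comm[of a] a alA by auto
  qed
  then have blocks: "star B u ` {v \<in> u ` B. card (star B u v) = 3} = (\<lambda>v. \<phi> ` star A t v) ` {v \<in> t ` A. card (star A t v) = 3}"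
    using blocks_star[OF h(1)] blocks_star[OF h'(1)] fT h(3) h'(2) by (simp add: image_image)
  have tails: "t a = t a' \<longleftrightarrow> u (\<phi> a) = u (\<phi> a')" if a: "a \<in> A" "a' \<in> A" for a a'
  proof (cases "a = a'")
    case False
    show ?thesis
    proof
      assume eq: "t a = t a'"
      have "card (star A t (t a)) \<noteq> 1"
      proof
        assume "card (star A t (t a)) = 1"
        then have "star A t (t a) = {a}" using cubic_star_cases[OF cub(1) a(1)] by auto
        moreover have "a' \<in> star A t (t a)" using a eq by (simp add: star_def)
        ultimately show False using False by simp
      qed
      then have "card (star A t (t a)) = 3" using cub(1) a unfolding cubic_def by auto
      then have "t a \<in> {v \<in> t ` A. card (star A t v) = 3}" using a by blast
      then have "\<phi> ` star A t (t a) \<in> (\<lambda>v. \<phi> ` star A t v) ` {v \<in> t ` A. card (star A t v) = 3}" by blast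
      then obtain w where w: "\<phi> ` star A t (t a) = star B u w" unfolding blocks[symmetric] by blast
      have "a \<in> star A t (t a)" "a' \<in> star A t (t a)" using a eq by (simp_all add: star_def)
      then have "\<phi> a \<in> star B u w" "\<phi> a' \<in> star B u w" unfolding w[symmetric] by blast+
      then show "u (\<phi> a) = u (\<phi> a')" by (simp add: star_def)
    next
      assume eq: "u (\<phi> a) = u (\<phi> a')"
      have ne: "\<phi> a \<noteq> \<phi> a'" using inj False a by (simp add: inj_on_eq_iff)
      have "card (star B u (u (\<phi> a))) \<noteq> 1"
      proof
        assume "card (star B u (u (\<phi> a))) = 1"
        then have "star B u (u (\<phi> a)) = {\<phi> a}" using cubic_star_cases[OF cub(2) into[OF a(1)]] by auto
        moreover have "\<phi> a' \<in> star B u (u (\<phi> a))" using into[OF a(2)] eq by (simp add: star_def)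
        ultimately show False using ne by simp
      qed
      then have "card (star B u (u (\<phi> a))) = 3" using cub(2) into[OF a(1)] unfolding cubic_def by auto
      then have "star B u (u (\<phi> a)) \<in> star B u ` {v \<in> u ` B. card (star B u v) = 3}" using into[OF a(1)] by blast
      then obtain v where v: "star B u (u (\<phi> a)) = \<phi> ` star A t v" unfolding blocks by blast
      have "\<phi> a \<in> \<phi> ` star A t v" "\<phi> a' \<in> \<phi> ` star A t v"
        unfolding v[symmetric] using into a eq by (simp_all add: star_def)
      then have "a \<in> star A t v" "a' \<in> star A t v"
        using inj a by (auto simp: star_def inj_on_eq_iff)
      then show "t a = t a'" by (simp add: star_def)
    qed
  qed simp
  show ?thesis unfolding isomorphic_def
    by (rule exI[of _ \<phi>]) (use im inj tails comm in \<open>simp add: bij_betw_def\<close>)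
qed

section \<open>Every graph reaches the normal form\<close>

lemma ex_pairs:
  assumes "finite S"
  shows "(\<And>x. x \<in> S \<Longrightarrow> f x \<in> S \<and> f x \<noteq> x \<and> f (f x) = x) \<Longrightarrow>
    \<exists>ps. distinct (flat ps) \<and> set (flat ps) = S \<and> (\<forall>(x, y)\<in>set ps. y = f x)"
  using assms
proof (induction S rule: finite_psubset_induct)
  case (psubset S)
  show ?case
  proof (cases "S = {}")
    case True
    then show ?thesis by (intro exI[of _ "[]"]) simp
  next
    case False
    then obtain x where x: "x \<in> S" by blast
    have fx: "f x \<in> S" "f x \<noteq> x" "f (f x) = x" using psubset.prems[OF x] by blast+
    have "S - {x, f x} \<subset> S" using x by blast
    moreover have "f y \<in> S - {x, f x} \<and> f y \<noteq> y \<and> f (f y) = y" if y: "y \<in> S - {x, f x}" for y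
    proof -
      have "y \<in> S" using y by blast
      then have fy: "f y \<in> S" "f y \<noteq> y" "f (f y) = y" using psubset.prems by blast+
      moreover have "f y \<noteq> x" "f y \<noteq> f x" using y fy(3) fx(3) by auto
      ultimately show ?thesis by blast
    qed
    ultimately obtain ps where ps: "distinct (flat ps)" "set (flat ps) = S - {x, f x}" "\<forall>(x, y)\<in>set ps. y = f x"
      using psubset.IH[of "S - {x, f x}"] by blast
    have "x \<notin> set (flat ps)" "f x \<notin> set (flat ps)" unfolding ps(2) by blast+
    moreover have "insert x (insert (f x) (set (flat ps))) = S" unfolding ps(2) using x fx(1) by blast
    ultimately show ?thesis using ps(1,3) fx(2)
      by (intro exI[of _ "(x, f x) # ps"]) simp
  qed
qed

text \<open>If the root edge ends in a leaf of the graph, a leaf of the tree without its partner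
  lies on an edge to another leaf of the graph. If the graph has no leaves, the root edge is cut
  instead: its outer half \<open>b\<close> sits at an inner vertex and is therefore a leaf of the
  tree, while its partner \<open>r b\<close>, the way back from the root vertex, is not.\<close>

lemma spans_singles:
  assumes cub: "cubic g p A t r" and pos: "2 * int g - 2 + int p > 0"
    and spans: "spans A r t T" and T: "T = Nd b S U" and root: "p > 0 \<longrightarrow> card (star A t (t b)) = 1"
  defines "Lb \<equiv> set (labels (forget_inner T))"
  defines "Z \<equiv> {z \<in> Lb. r z \<notin> Lb}"
  shows "p > 0 \<Longrightarrow> b \<notin> Lb \<and> card Z = p - 1" "p = 0 \<Longrightarrow> Z = {b}"
    "int (length (labels (forget_inner T))) = 2 * int g - 1 + int p" "distinct (labels (forget_inner T))"
proof -
  note rA = cubic_rev_in[OF cub] and rr = cubic_rev_rev[OF cub]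
  let ?V = "{v \<in> t ` A. card (star A t v) = 3}"
  have h: "hang A r t T" "distinct (inner_verts r t T)" "set (inner_verts r t T) = ?V"
    using spans by (simp_all add: spans_def)
  have "int (card ?V) = 2 * int g - 2 + int p" using cub unfolding cubic_def by blast
  moreover have "card ?V = nodes (forget_inner T)" using h(2,3) length_inner_verts[of r t T] by (metis distinct_card)
  ultimately show "int (length (labels (forget_inner T))) = 2 * int g - 1 + int p" by (simp add: length_labs)
  have dis: "distinct (arc_list S @ arc_list U)" using distinct_tl_al[OF h(1,2)] unfolding T by simp
  show "distinct (labels (forget_inner T))"
    using dis distinct_labs_al[of S] distinct_labs_al[of U] labs_subset_al[of S] labs_subset_al[of U]
    unfolding T by auto
  have Ltl: "Lb \<subseteq> set (tl (arc_list T))"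
    unfolding Lb_def T using labs_subset_al[of S] labs_subset_al[of U] by auto
  have tlV: "c \<in> A \<and> card (star A t (t c)) = 3" if "c \<in> set (tl (arc_list T))" for c
    using tl_al_tail[OF h(1) that] h(3) by blast
  have bA: "b \<in> A" using h(1) unfolding T by simp
  have arb: "root_arc T = b" using T by simp
  have rb: "r b \<notin> set (tl (arc_list T))" using root_not_in[OF h(1,2)] arb by simp
  have arc3: "a \<in> set (tl (arc_list T)) \<or> r a \<in> inner_arcs T" if "a \<in> A" "card (star A t (t a)) = 3" for a
    using arcs_at[OF h(1) that(1)] that h(3) rr by auto
  have tl_cases: "a \<in> Lb \<or> a \<in> inner_arcs T" if "a \<in> set (tl (arc_list T))" for a
    using that al_subset[of T] set_al[of T] unfolding Lb_def by blast
  have pend: "card (star A t (t (r a))) = 3" if "a \<in> A" "card (star A t (t a)) = 1" for a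
    by (rule pendant_opposite[OF cub pos that])
  have deg: "card (star A t (t a)) = 1 \<or> card (star A t (t a)) = 3" if "a \<in> A" for a
    using cub that unfolding cubic_def by auto
  have Z1: "card (star A t (t (r z))) = 1 \<or> z = b" if z: "z \<in> Z" for z
  proof (rule ccontr)
    assume n: "\<not> (card (star A t (t (r z))) = 1 \<or> z = b)"
    have zL: "z \<in> Lb" "r z \<notin> Lb" using z by (simp_all add: Z_def)
    then have ztl: "z \<in> set (tl (arc_list T))" using Ltl by blast
    then have rz: "r z \<in> A" using tlV rA by blast
    then consider "r z \<in> set (tl (arc_list T))" | "z \<in> inner_arcs T" using arc3[OF rz] deg[OF rz] n rr by auto
    then show False
    proof cases
      case 1
      then have "r z \<in> inner_arcs T" using tl_cases zL by blast
      then have "z \<notin> set (tl (arc_list T))" using nds_rev_not_in[OF h(1,2), of "r z"] rr by simp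
      then show False using ztl by blast
    next
      case 2
      then show False using labs_nds[OF h(1,2), of z] zL n arb unfolding Lb_def by blast
    qed
  qed
  have Z2: "z \<in> Z" if "z \<in> Lb" "card (star A t (t (r z))) = 1" for z
    using that tlV[of "r z"] Ltl unfolding Z_def by auto
  have Z3: "b \<in> Z" if "b \<in> Lb" using that rb Ltl unfolding Z_def by blast
  let ?P = "{a \<in> A. card (star A t (t a)) = 1}"
  have cardP: "card ?P = p"
  proof -
    have inj: "inj_on t ?P"
    proof (rule inj_onI)
      fix x y assume xy: "x \<in> ?P" "y \<in> ?P" "t x = t y"
      then have "star A t (t x) = {x}" using cubic_star_cases[OF cub, of x] by auto
      moreover have "y \<in> star A t (t x)" using xy by (simp add: star_def)
      ultimately show "x = y" by simp
    qed
    have "t ` ?P = {v \<in> t ` A. card (star A t v) = 1}" by auto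
    then have "card ?P = card {v \<in> t ` A. card (star A t v) = 1}" using card_image[OF inj] by simp
    then show ?thesis using cub unfolding cubic_def by simp
  qed
  have Plab: "r a \<in> Lb" if a: "a \<in> ?P" "a \<noteq> b" for a
  proof -
    have ra: "r a \<in> A" using a rA by blast
    have "card (star A t (t (r a))) = 3" using pend a by blast
    then consider "r a \<in> set (tl (arc_list T))" | "a \<in> inner_arcs T" using arc3[OF ra] rr by auto
    then show ?thesis
    proof cases
      case 1
      have "r a \<notin> inner_arcs T"
      proof
        assume "r a \<in> inner_arcs T"
        then have "t (r (r a)) \<in> set (inner_verts r t T)" by (rule inner_arcs_verts)
        then show False using a h(3) rr by auto
      qed
      then show ?thesis using tl_cases 1 by blast
    next
      case 2
      then have "a \<in> set (tl (arc_list T))" using nds_subset_al[of T] set_al[of T] a(2) arb by auto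
      then show ?thesis using tlV[of a] a by auto
    qed
  qed
  show "b \<notin> Lb \<and> card Z = p - 1" if p: "p > 0"
  proof
    have b1: "card (star A t (t b)) = 1" using root p by blast
    show bL: "b \<notin> Lb" using tlV[of b] Ltl b1 by auto
    have "Z = r ` (?P - {b})"
    proof
      show "Z \<subseteq> r ` (?P - {b})"
      proof
        fix z assume z: "z \<in> Z"
        then have zL: "z \<in> Lb" by (simp add: Z_def)
        have "card (star A t (t (r z))) = 1" using Z1[OF z] zL bL by auto
        moreover have "r z \<in> A" using zL Ltl tlV rA by blast
        moreover have "r z \<noteq> b"
        proof
          assume "r z = b"
          then have "r b = z" using rr[of z] by simp
          then show False using rb zL Ltl by blast
        qed
        ultimately show "z \<in> r ` (?P - {b})" using rr[of z] by (intro image_eqI[of _ _ "r z"]) auto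
      qed
      show "r ` (?P - {b}) \<subseteq> Z"
      proof
        fix z assume "z \<in> r ` (?P - {b})"
        then obtain a where a: "a \<in> ?P" "a \<noteq> b" "z = r a" by blast
        then show "z \<in> Z" using Z2[of z] Plab[OF a(1,2)] rr by simp
      qed
    qed
    moreover have "inj_on r (?P - {b})" by (rule inj_on_inverseI[of _ r]) (rule rr)
    ultimately have "card Z = card (?P - {b})" by (simp add: card_image)
    then show "card Z = p - 1" using cardP b1 bA by simp
  qed
  show "Z = {b}" if p: "p = 0"
  proof -
    have P0: "?P = {}" using cardP p cubic_finite[OF cub] by simp
    then have all3: "card (star A t (t a)) = 3" if "a \<in> A" for a using deg[OF that] that by blast
    have "b \<in> Lb"
    proof -
      have "r b \<notin> inner_arcs T"
      proof
        assume rbn: "r b \<in> inner_arcs T"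
        then have "r b \<in> set (arc_list T)" using nds_subset_al[of T] by blast
        then have "r b = b" using rb set_al[of T] arb by auto
        then show False using cubic_rev_neq[OF cub bA] by blast
      qed
      then have "b \<in> set (tl (arc_list T))" using arc3[OF bA all3[OF bA]] by blast
      then have "b \<in> set (arc_list S) \<union> set (arc_list U)" unfolding T by simp
      moreover have "b \<notin> inner_arcs S" "b \<notin> inner_arcs U"
        using h(2) inner_arcs_verts[of b S t r] inner_arcs_verts[of b U t r] unfolding T by auto
      ultimately show ?thesis using al_subset[of S] al_subset[of U] unfolding Lb_def T by auto
    qed
    moreover have "z = b" if "z \<in> Z" for z
    proof -
      have "z \<in> A" using that Ltl tlV unfolding Z_def by blast
      then show ?thesis using Z1[OF that] all3[of "r z"] rA by auto
    qed
    ultimately show ?thesis using Z3 by blast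
  qed
qed

text \<open>A tree with \<open>2 * g - 2 + p\<close> nodes has \<open>2 * g + p - 1\<close> leaves,
  hence \<open>Suc\<close> in the hypothesis on \<open>k\<close>. If \<open>p > 0\<close> then
  \<open>g\<close> pairs are pulled out; if \<open>p = 0\<close> only \<open>g - 1\<close>, because
  half of the root edge remains as a single leaf.\<close>

lemma normal_form:
  assumes cub: "cubic g p A t r" and pos: "2 * int g - 2 + int p > 0" and k: "2 * g + p \<le> Suc (2 ^ k)"
  shows "\<exists>t' T b S U ps zs. reached A r (3 * (2 * g + p) + g * (2 * k + 1)) t t' \<and> cubic g p A t' r
    \<and> spans A r t' T \<and> T = Nd b S U \<and> forget_inner T = comb (loops ps @ map L zs) \<and> loops ps @ map L zs \<noteq> []
    \<and> (\<forall>(x, y)\<in>set ps. y = r x) \<and> (\<forall>z\<in>set zs. r z \<notin> set (labels (forget_inner T)))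
    \<and> length zs = (if p > 0 then p - 1 else 1) \<and> 2 * length ps + length zs = 2 * g + p - 1
    \<and> (p > 0 \<longrightarrow> b \<notin> set (labels (forget_inner T))) \<and> (p = 0 \<longrightarrow> zs = [b])"
proof -
  note rA = cubic_rev_in[OF cub] and rr = cubic_rev_rev[OF cub] and rne = cubic_rev_neq[OF cub]
  obtain b S U where T0: "spans A r t (Nd b S U)" "p > 0 \<longrightarrow> card (star A t (t b)) = 1"
    using ex_spans[OF cub pos] by blast
  define T where "T = Nd b S U"
  have spans: "spans A r t T" using T0(1) by (simp add: T_def)
  note sg = spans_singles[OF cub pos spans T_def T0(2)]
  let ?Lb = "set (labels (forget_inner T))"
  let ?Z = "{z \<in> ?Lb. r z \<notin> ?Lb}"
  have LA: "?Lb \<subseteq> A"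
  proof -
    have "hang A r t T" using spans by (simp add: spans_def)
    then have "set (arc_list T) \<subseteq> A" using tl_al_tail[of A r t T] ar_in[of A r t T] set_al[of T] by auto
    then show ?thesis using labs_subset_al[of T] by blast
  qed
  obtain ps where ps: "distinct (flat ps)" "set (flat ps) = ?Lb - ?Z" "\<forall>(x, y)\<in>set ps. y = r x"
  proof -
    have "finite (?Lb - ?Z)" by simp
    moreover have "r x \<in> ?Lb - ?Z \<and> r x \<noteq> x \<and> r (r x) = x" if "x \<in> ?Lb - ?Z" for x
      using that rr rne[of x] LA by auto
    ultimately show ?thesis using ex_pairs[of "?Lb - ?Z" r] that by blast
  qed
  obtain zs0 where zs0: "distinct zs0" "set zs0 = ?Z" using finite_distinct_list[of ?Z] by auto
  have "distinct (flat ps @ zs0)" "set (flat ps @ zs0) = ?Lb" using ps zs0 by auto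
  then have m: "mset (labels (forget_inner T)) = mset (flat ps @ zs0)" using sg(4) set_eq_iff_mset_eq_distinct by metis
  have len: "length (labels (forget_inner T)) = 2 * g + p - 1" using sg(3) pos by linarith
  have "length (labels (forget_inner T)) \<le> 2 ^ k" using len k by simp
  then obtain zs where zs: "mset zs = mset zs0"
    "rotations (forget_inner T) (comb (loops ps @ map L zs)) (3 * length (labels (forget_inner T)) + length ps * (2 * k + 1))"
    using rotations_normalize[OF m] by blast
  have h: "hang A r t T" "distinct (inner_verts r t T)" "set (inner_verts r t T) = {v \<in> t ` A. card (star A t v) = 3}"
    using spans by (simp_all add: spans_def)
  obtain t' T' where T': "forget_inner T' = comb (loops ps @ map L zs)" "hang A r t' T'" "distinct (inner_verts r t' T')"
      "set (inner_verts r t' T') = set (inner_verts r t T)" "root_arc T' = root_arc T" "\<forall>v. v \<notin> set (inner_verts r t T) \<longrightarrow> star A t' v = star A t v"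
      "reached A r (3 * length (labels (forget_inner T)) + length ps * (2 * k + 1)) t t'" "cubic g p A t' r"
    using rotations_imp_moves[OF zs(2) cub refl h(1,2)] by (elim exE conjE)
  let ?V = "{v \<in> t ` A. card (star A t v) = 3}" and ?V' = "{v \<in> t' ` A. card (star A t' v) = 3}"
  \<comment> \<open>The transported tree spans again: it keeps its vertices, all of them are
    trivalent for \<open>t'\<close>, and the number of trivalent vertices depends on
    \<open>g\<close> and \<open>p\<close> only.\<close>
  have "int (card ?V) = int (card ?V')" using cub T'(8) unfolding cubic_def by simp
  moreover have "?V \<subseteq> ?V'" using hang_inner_verts[OF _ T'(2)] T'(4) h(3) rA by blast
  moreover have "finite ?V'" using cubic_finite[OF cub] by simp
  ultimately have "?V = ?V'" by (simp add: card_subset_eq)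
  then have rep': "spans A r t' T'" using T'(2-4) h(3) unfolding spans_def by simp
  have lz: "length zs = length zs0" using zs(1) by (rule mset_eq_length)
  have sz: "set zs = ?Z" using zs(1) zs0(2) by (metis set_mset_mset)
  have cz: "card ?Z = (if p > 0 then p - 1 else 1)" using sg(1,2) by auto
  have lzs: "length zs = (if p > 0 then p - 1 else 1)" using lz zs0 cz distinct_card[of zs0] by simp
  have tot: "2 * length ps + length zs = 2 * g + p - 1"
    using arg_cong[OF m, of size] len lz by (simp add: length_flat)
  have ne: "loops ps @ map L zs \<noteq> []"
  proof
    assume "loops ps @ map L zs = []"
    then show False using tot pos by simp
  qed
  have lab': "labels (forget_inner T') = flat ps @ zs" using labs_normal[OF ne] T'(1) by simp
  then have Lb': "set (labels (forget_inner T')) = ?Lb" using ps(2) sz by auto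
  obtain b' S' U' where B: "T' = Nd b' S' U'"
  proof (cases T')
    case (Lf c)
    then have "length (labels (forget_inner T')) = 1" by simp
    then have "2 * g + p - 1 = 1" using lab' tot by (simp add: length_flat)
    then show ?thesis using pos by linarith
  qed
  have b': "b' = b" using T'(5) B T_def by simp
  have "length ps \<le> g" using tot lzs pos by (auto split: if_splits)
  then have "3 * length (labels (forget_inner T)) + length ps * (2 * k + 1) \<le> 3 * (2 * g + p) + g * (2 * k + 1)"
    using len by (intro add_mono mult_right_mono) simp_all
  then have re: "reached A r (3 * (2 * g + p) + g * (2 * k + 1)) t t'" using T'(7) reached_mono by blast
  have p0: "p = 0 \<longrightarrow> zs = [b]"
  proof
    assume p: "p = 0"
    then have "set zs = {b}" "length zs = 1" using sz sg(2) lzs by auto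
    then show "zs = [b]" by (cases zs) auto
  qed
  show ?thesis
  proof (intro exI conjI)
    show "T' = Nd b S' U'" using B b' by simp
    show "\<forall>z\<in>set zs. r z \<notin> set (labels (forget_inner T'))" unfolding Lb' using sz by blast
    show "p > 0 \<longrightarrow> b \<notin> set (labels (forget_inner T'))" unfolding Lb' using sg(1) by blast
  qed (rule re T'(8) rep' T'(1) ne ps(3) lzs tot p0)+
qed

lemma exchange_sym:
  assumes c: "cubic g p A t r" and s: "exchange A t r t'"
  shows "exchange A t' r t"
proof -
  obtain e x y where e: "e \<in> A" "x \<in> A" "y \<in> A" "t e \<noteq> t (r e)" "t x = t e" "x \<noteq> e" "t y = t (r e)" "y \<noteq> r e"
     and t': "\<And>a. a \<in> A \<Longrightarrow> t' a = t (transpose x y a)" using s by (auto simp: exchange_def)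
  have re: "r e \<in> A" using cubic_rev_in[OF c] e by blast
  have ev: "t' e = t e" "t' (r e) = t (r e)" "t' x = t (r e)" "t' y = t e"
    using e t' re by (auto simp: transpose_def)
  have arc_tree: "transpose x y a \<in> A" if "a \<in> A" for a using that e by (auto simp: transpose_def)
  show ?thesis
  proof (rule exchangeI[of e A y x])
    fix a assume a: "a \<in> A"
    show "t a = t' (transpose y x a)"
      using t'[OF arc_tree[OF a]] by (simp add: transpose_commute)
  qed (use e ev in auto)
qed

lemma reached_steps:
  assumes "cubic g p A t r" "((\<lambda>t t'. exchange A t r t') ^^ m) t t'"
  shows "cubic g p A t' r \<and> (iso_class g p A t r, iso_class g p A t' r) \<in> whitehead_step g p ^^ m
    \<and> (iso_class g p A t' r, iso_class g p A t r) \<in> whitehead_step g p ^^ m"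
  using assms(2)
proof (induction m arbitrary: t')
  case 0
  then show ?case using assms(1) by simp
next
  case (Suc m)
  then obtain u where u: "((\<lambda>t t'. exchange A t r t') ^^ m) t u" "exchange A u r t'" by auto
  have c: "cubic g p A u r" using Suc.IH[OF u(1)] by blast
  have c': "cubic g p A t' r" by (rule exchange_cubic(1)[OF c u(2)])
  have "(iso_class g p A u r, iso_class g p A t' r) \<in> whitehead_step g p" by (rule exchange_step[OF c u(2)])
  moreover have "(iso_class g p A t' r, iso_class g p A u r) \<in> whitehead_step g p" by (rule exchange_step[OF c' exchange_sym[OF c u(2)]])
  ultimately show ?case using Suc.IH[OF u(1)] c' relpow_Suc_I relpow_Suc_I2 by metis
qed

text \<open>Both graphs are brought to the one normal form, and the second path is run backwards;
  hence the factor 2.\<close>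

lemma classes_connected:
  assumes "C \<in> graph_classes g p" "D \<in> graph_classes g p" "2 * int g - 2 + int p > 0" and k: "2 * g + p \<le> Suc (2 ^ k)"
  shows "\<exists>m \<le> 2 * (3 * (2 * g + p) + g * (2 * k + 1)). (C, D) \<in> whitehead_step g p ^^ m"
proof -
  let ?n = "3 * (2 * g + p) + g * (2 * k + 1)"
  obtain A t r where C: "cubic g p A t r" "C = iso_class g p A t r" using classes_iso_class[OF assms(1)] .
  obtain B u s where D: "cubic g p B u s" "D = iso_class g p B u s" using classes_iso_class[OF assms(2)] .
  obtain t' T b S U ps zs where 1: "reached A r ?n t t'" "cubic g p A t' r" "spans A r t' T" "T = Nd b S U"
    "forget_inner T = comb (loops ps @ map L zs)" "loops ps @ map L zs \<noteq> []"
    "\<forall>(x, y)\<in>set ps. y = r x" "\<forall>z\<in>set zs. r z \<notin> set (labels (forget_inner T))"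
    "length zs = (if p > 0 then p - 1 else 1)" "2 * length ps + length zs = 2 * g + p - 1"
    "p > 0 \<longrightarrow> b \<notin> set (labels (forget_inner T))" "p = 0 \<longrightarrow> zs = [b]"
    using normal_form[OF C(1) assms(3) k] by (elim exE conjE)
  obtain u' T' c S' U' qs ws where 2: "reached B s ?n u u'" "cubic g p B u' s" "spans B s u' T'" "T' = Nd c S' U'"
    "forget_inner T' = comb (loops qs @ map L ws)" "loops qs @ map L ws \<noteq> []"
    "\<forall>(x, y)\<in>set qs. y = s x" "\<forall>z\<in>set ws. s z \<notin> set (labels (forget_inner T'))"
    "length ws = (if p > 0 then p - 1 else 1)" "2 * length qs + length ws = 2 * g + p - 1"
    "p > 0 \<longrightarrow> c \<notin> set (labels (forget_inner T'))" "p = 0 \<longrightarrow> ws = [c]"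
    using normal_form[OF D(1) assms(3) k] by (elim exE conjE)
  have "isomorphic A t' r B u' s"
  proof (rule normal_form_isomorphic[OF 1(2) 2(2) assms(3) 1(3) 2(3) 1(4) 2(4) 1(5) 2(5) 1(6)])
    show "length ps = length qs" "length zs = length ws" using 1(9,10) 2(9,10) by linarith+
    show "(b \<notin> set (labels (forget_inner T)) \<and> c \<notin> set (labels (forget_inner T'))) \<or> (zs = [b] \<and> ws = [c])"
      using 1(11,12) 2(11,12) by blast
  qed (use 1(7,8) 2(7) in blast)+
  then have eq: "iso_class g p A t' r = iso_class g p B u' s" by (rule isomorphic_iso_class[OF 1(2)])
  obtain m1 where m1: "m1 \<le> ?n" "((\<lambda>t t'. exchange A t r t') ^^ m1) t t'" using 1(1) unfolding reached_def by blast
  obtain m2 where m2: "m2 \<le> ?n" "((\<lambda>t t'. exchange B t s t') ^^ m2) u u'" using 2(1) unfolding reached_def by blast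
  have "(C, iso_class g p A t' r) \<in> whitehead_step g p ^^ m1" using reached_steps[OF C(1) m1(2)] C(2) by blast
  moreover have "(iso_class g p A t' r, D) \<in> whitehead_step g p ^^ m2" using reached_steps[OF D(1) m2(2)] D(2) eq by simp
  ultimately have "(C, D) \<in> whitehead_step g p ^^ (m1 + m2)" by (auto simp: relpow_add)
  then show ?thesis using m1(1) m2(1) by (intro exI[of _ "m1 + m2"]) simp
qed

section \<open>Graphs with fixed half-edge slots\<close>

text \<open>Slots come in triples for the vertices below \<open>V\<close> and singly for the
  univalent ones. Subtracting \<open>2 * V\<close> numbers the latter consecutively: slot
  \<open>3 * V + j\<close> belongs to vertex \<open>V + j\<close>.\<close>

definition slot_vert :: "nat \<Rightarrow> nat \<Rightarrow> nat" where
  "slot_vert V a = (if a < 3 * V then a div 3 else a - 2 * V)"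

lemma div3_less: "(a::nat) < 3 * V \<Longrightarrow> a div 3 < V"
  by (simp add: less_mult_imp_div_less)

lemma vt_eq_trivalent: "a < 3 * V \<Longrightarrow> slot_vert V a = slot_vert V b \<longleftrightarrow> b < 3 * V \<and> b div 3 = a div 3"
  using div3_less[of a V] unfolding slot_vert_def by (cases "b < 3 * V") (simp_all, linarith?)

lemma vt_eq_leaf: "\<not> a < 3 * V \<Longrightarrow> slot_vert V a = slot_vert V b \<longleftrightarrow> a = b"
  using div3_less[of b V] unfolding slot_vert_def by (cases "b < 3 * V") (simp_all, linarith?)

lemma vt_same: "slot_vert V a = slot_vert V b \<Longrightarrow> a \<noteq> b \<Longrightarrow> a < 3 * V \<and> b < 3 * V \<and> a div 3 = b div 3"
  by (cases "a < 3 * V") (simp_all add: vt_eq_leaf vt_eq_trivalent)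

text \<open>The slots \<open>3 * v\<close>, \<open>3 * v + 1\<close>, \<open>3 * v + 2\<close> belong to the trivalent vertex \<open>v\<close>, and the slots from
  \<open>3 * V\<close> on to the leaves.  The last condition says that \<open>3 * v\<close> leads to a smaller vertex.\<close>

definition slot_graph :: "nat \<Rightarrow> nat \<Rightarrow> (nat \<Rightarrow> nat) \<Rightarrow> bool" where
  "slot_graph V p \<rho> \<longleftrightarrow> (\<forall>a. \<rho> (\<rho> a) = a) \<and> (\<forall>a. a < 3 * V + p \<longleftrightarrow> \<rho> a \<noteq> a)
     \<and> (\<forall>a. 3 * V \<le> a \<and> a < 3 * V + p \<longrightarrow> \<rho> a < 3 * V)
     \<and> (\<forall>v. 0 < v \<and> v < V \<longrightarrow> \<rho> (3 * v) < 3 * v)"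

lemma div3_iff: "(a::nat) div 3 = v \<longleftrightarrow> a = 3 * v \<or> a = 3 * v + 1 \<or> a = 3 * v + 2"
  by presburger

lemma star_slot:
  assumes "v < V"
  shows "star {..<3 * V + p} (slot_vert V) v = {3 * v, 3 * v + 1, 3 * v + 2}"
proof (rule set_eqI)
  fix a
  have "slot_vert V a = v \<longleftrightarrow> a < 3 * V \<and> a div 3 = v"
    using assms unfolding slot_vert_def by (cases "a < 3 * V") simp_all
  also have "\<dots> \<longleftrightarrow> a = 3 * v \<or> a = 3 * v + 1 \<or> a = 3 * v + 2"
    unfolding div3_iff using assms by linarith
  finally show "a \<in> star {..<3 * V + p} (slot_vert V) v \<longleftrightarrow> a \<in> {3 * v, 3 * v + 1, 3 * v + 2}"
    unfolding star_def using assms by (simp, linarith)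
qed

lemma star_leaf:
  assumes "V \<le> v" "v < V + p"
  shows "star {..<3 * V + p} (slot_vert V) v = {v + 2 * V}"
proof -
  have "slot_vert V a = v \<longleftrightarrow> a = v + 2 * V" for a
    using assms div3_less[of a V] unfolding slot_vert_def by (cases "a < 3 * V") (simp_all, linarith?)
  then show ?thesis using assms by (auto simp: star_def)
qed

text \<open>Following the slots \<open>3 * v\<close> descends to vertex 0, so a closed set of
  vertices contains all vertices of the graph or none; this is why \<open>slot_graph\<close> asks
  for a decreasing parent slot.\<close>

lemma slot_cubic:
  assumes V: "V > 0" "int V = 2 * int g - 2 + int p" and \<rho>: "slot_graph V p \<rho>"
  shows "cubic g p {..<3 * V + p} (slot_vert V) \<rho>"
proof -
  let ?A = "{..<3 * V + p}"
  have rr: "\<rho> (\<rho> a) = a" and fp: "a < 3 * V + p \<longleftrightarrow> \<rho> a \<noteq> a" for a using \<rho> by (auto simp: slot_graph_def)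
  have lf: "\<rho> a < 3 * V" if "3 * V \<le> a" "a < 3 * V + p" for a using \<rho> that by (auto simp: slot_graph_def)
  have tree: "\<rho> (3 * v) < 3 * v" if "0 < v" "v < V" for v using \<rho> that by (auto simp: slot_graph_def)
  have \<rho>A: "\<rho> a < 3 * V + p" if "a < 3 * V + p" for a using fp[of "\<rho> a"] fp[of a] rr[of a] that by auto
  have im: "slot_vert V ` ?A = {..<V + p}"
  proof
    show "slot_vert V ` ?A \<subseteq> {..<V + p}"
    proof
      fix v assume "v \<in> slot_vert V ` ?A"
      then obtain a where a: "a < 3 * V + p" "v = slot_vert V a" by blast
      show "v \<in> {..<V + p}" using a div3_less[of a V] by (cases "a < 3 * V") (simp_all add: slot_vert_def)
    qed
    show "{..<V + p} \<subseteq> slot_vert V ` ?A"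
    proof
      fix v assume v: "v \<in> {..<V + p}"
      show "v \<in> slot_vert V ` ?A"
      proof (cases "v < V")
        case True
        then show ?thesis by (intro image_eqI[of _ _ "3 * v"]) (simp_all add: slot_vert_def)
      next
        case False
        then show ?thesis using v by (intro image_eqI[of _ _ "v + 2 * V"]) (simp_all add: slot_vert_def)
      qed
    qed
  qed
  have cf: "card (star ?A (slot_vert V) v) = (if v < V then 3 else 1)" if "v < V + p" for v
    using star_slot[of v V p] star_leaf[of V v p] that by (auto simp: card_insert_if)
  have "{v \<in> slot_vert V ` ?A. card (star ?A (slot_vert V) v) = 1} = {V..<V + p}"
    unfolding im using cf by (auto split: if_splits)
  then have c1: "card {v \<in> slot_vert V ` ?A. card (star ?A (slot_vert V) v) = 1} = p" by simp
  have "{v \<in> slot_vert V ` ?A. card (star ?A (slot_vert V) v) = 3} = {..<V}"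
    unfolding im using cf by (auto split: if_splits)
  then have c3: "int (card {v \<in> slot_vert V ` ?A. card (star ?A (slot_vert V) v) = 3}) = 2 * int g - 2 + int p" using V by simp
  have deg: "\<forall>a\<in>?A. card (star ?A (slot_vert V) (slot_vert V a)) \<in> {1, 3}"
  proof
    fix a assume "a \<in> ?A"
    then have "slot_vert V a < V + p" using im by blast
    then show "card (star ?A (slot_vert V) (slot_vert V a)) \<in> {1, 3}" using cf by simp
  qed
  have "linked ?A (slot_vert V) \<rho>" unfolding linked_def
  proof (intro allI impI)
    fix U assume cl: "\<forall>a\<in>?A. slot_vert V a \<in> U \<longrightarrow> slot_vert V (\<rho> a) \<in> U" and ne: "\<exists>a\<in>?A. slot_vert V a \<in> U"
    have sym: "slot_vert V a \<in> U \<longleftrightarrow> slot_vert V (\<rho> a) \<in> U" if "a < 3 * V + p" for a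
    proof
      assume "slot_vert V (\<rho> a) \<in> U"
      then have "slot_vert V (\<rho> (\<rho> a)) \<in> U" using cl \<rho>A[OF that] by blast
      then show "slot_vert V a \<in> U" using rr by simp
    qed (use cl that in blast)
    have tri: "v \<in> U \<longleftrightarrow> 0 \<in> U" if "v < V" for v
      using that
    proof (induction v rule: less_induct)
      case (less v)
      show ?case
      proof (cases "v = 0")
        case False
        then have t: "\<rho> (3 * v) < 3 * v" using tree less.prems by simp
        define w where "w = \<rho> (3 * v) div 3"
        have w: "w < v" unfolding w_def using t by (rule div3_less)
        have 1: "slot_vert V (3 * v) = v" using less.prems by (simp add: slot_vert_def)
        have 2: "slot_vert V (\<rho> (3 * v)) = w" using t less.prems by (simp add: slot_vert_def w_def)
        have "v \<in> U \<longleftrightarrow> w \<in> U" using sym[of "3 * v"] less.prems unfolding 1 2 by simp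
        moreover have "w \<in> U \<longleftrightarrow> 0 \<in> U" by (rule less.IH) (use w less.prems in simp_all)
        ultimately show ?thesis by blast
      qed simp
    qed
    have all: "slot_vert V a \<in> U \<longleftrightarrow> 0 \<in> U" if a: "a < 3 * V + p" for a
    proof (cases "a < 3 * V")
      case True
      then show ?thesis using tri[of "a div 3"] div3_less[of a V] by (simp add: slot_vert_def)
    next
      case False
      then have "\<rho> a < 3 * V" using lf a by simp
      then have "slot_vert V (\<rho> a) \<in> U \<longleftrightarrow> 0 \<in> U" using tri[of "\<rho> a div 3"] div3_less[of "\<rho> a" V] by (simp add: slot_vert_def)
      then show ?thesis using sym[OF a] by simp
    qed
    then show "\<forall>a\<in>?A. slot_vert V a \<in> U" using ne by blast
  qed
  then show ?thesis unfolding cubic_def using V c1 c3 deg rr fp by auto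
qed

text \<open>An exchange seen from the vertices: instead of moving two half-edges to other vertices,
  the slots stay and the involution is conjugated by their transposition.\<close>

definition slot_move :: "nat \<Rightarrow> (nat \<Rightarrow> nat) \<Rightarrow> (nat \<Rightarrow> nat) \<Rightarrow> bool" where
  "slot_move V \<rho> \<rho>' \<longleftrightarrow> (\<exists>e x y. e < 3 * V \<and> \<rho> e < 3 * V \<and> e div 3 \<noteq> \<rho> e div 3 \<and> x div 3 = e div 3 \<and> x \<noteq> e
     \<and> y div 3 = \<rho> e div 3 \<and> y \<noteq> \<rho> e \<and> \<rho>' = transpose x y \<circ> \<rho> \<circ> transpose x y)"

text \<open>The permutation \<open>\<pi>\<close> records which slot each half-edge occupies.
  Exchanging the tails of \<open>x\<close> and \<open>y\<close> composes it with a transposition,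
  and conjugating the fixed involution by the result yields the slot move.\<close>

lemma lift_step:
  assumes cub: "cubic g p A t r" and A: "A = {..<3 * V + p}" and \<pi>: "bij \<pi>" "\<pi> ` A = A"
    and t: "\<And>a. a \<in> A \<Longrightarrow> t a = slot_vert V (\<pi> a)" and s: "exchange A t r t'"
  shows "\<exists>\<pi>'. bij \<pi>' \<and> \<pi>' ` A = A \<and> (\<forall>a\<in>A. t' a = slot_vert V (\<pi>' a))
    \<and> slot_move V (\<pi> \<circ> r \<circ> inv \<pi>) (\<pi>' \<circ> r \<circ> inv \<pi>')"
proof -
  obtain e x y where e: "e \<in> A" "x \<in> A" "y \<in> A" "t e \<noteq> t (r e)" "t x = t e" "x \<noteq> e" "t y = t (r e)" "y \<noteq> r e"
     and t': "\<And>a. a \<in> A \<Longrightarrow> t' a = t (transpose x y a)" using s by (auto simp: exchange_def)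
  have re: "r e \<in> A" using cubic_rev_in[OF cub] e by blast
  let ?\<tau> = "transpose x y" and ?\<sigma> = "transpose (\<pi> x) (\<pi> y)" and ?\<rho> = "\<pi> \<circ> r \<circ> inv \<pi>"
  define \<pi>' where "\<pi>' = \<pi> \<circ> ?\<tau>"
  have inj: "inj \<pi>" using \<pi>(1) by (rule bij_is_inj)
  have comm: "\<pi> \<circ> ?\<tau> = ?\<sigma> \<circ> \<pi>"
    using inj by (auto simp: fun_eq_iff transpose_def inj_eq)
  have bij: "bij \<pi>'" unfolding \<pi>'_def by (intro bij_comp \<pi>) simp
  have "?\<tau> ` A = A"
  proof -
    have "?\<tau> a \<in> A" if "a \<in> A" for a using that e by (auto simp: transpose_def)
    moreover have "a = ?\<tau> (?\<tau> a)" for a by simp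
    ultimately show ?thesis by (metis (no_types, lifting) image_subsetI subset_antisym subsetI imageI)
  qed
  then have im: "\<pi>' ` A = A" unfolding \<pi>'_def image_comp[symmetric] using \<pi>(2) by simp
  have t'': "\<forall>a\<in>A. t' a = slot_vert V (\<pi>' a)"
  proof
    fix a assume a: "a \<in> A"
    then have "?\<tau> a \<in> A" using e by (auto simp: transpose_def)
    then show "t' a = slot_vert V (\<pi>' a)" using t'[OF a] t by (simp add: \<pi>'_def)
  qed
  have inv': "inv \<pi>' = inv \<pi> \<circ> ?\<sigma>"
  proof (rule inv_unique_comp)
    show "\<pi>' \<circ> (inv \<pi> \<circ> ?\<sigma>) = id"
      unfolding \<pi>'_def comm using \<pi>(1) by (simp add: fun_eq_iff bij_is_surj surj_f_inv_f)
    show "(inv \<pi> \<circ> ?\<sigma>) \<circ> \<pi>' = id"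
      unfolding \<pi>'_def comm using inj by (simp add: fun_eq_iff)
  qed
  have \<rho>e: "?\<rho> (\<pi> e) = \<pi> (r e)" using inj by simp
  have vv: "slot_vert V (\<pi> e) \<noteq> slot_vert V (\<pi> (r e))" "slot_vert V (\<pi> x) = slot_vert V (\<pi> e)" "slot_vert V (\<pi> y) = slot_vert V (\<pi> (r e))"
    using e re t by auto
  have ne: "\<pi> x \<noteq> \<pi> e" "\<pi> y \<noteq> \<pi> (r e)" using e inj by (simp_all add: inj_eq)
  note 1 = vt_same[OF vv(2) ne(1)] and 2 = vt_same[OF vv(3) ne(2)]
  have "slot_move V ?\<rho> (\<pi>' \<circ> r \<circ> inv \<pi>')"
    unfolding slot_move_def
  proof (intro exI conjI)
    show "\<pi> e < 3 * V" "?\<rho> (\<pi> e) < 3 * V" "\<pi> x div 3 = \<pi> e div 3" "\<pi> x \<noteq> \<pi> e" "\<pi> y div 3 = ?\<rho> (\<pi> e) div 3" "\<pi> y \<noteq> ?\<rho> (\<pi> e)"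
      using 1 2 ne \<rho>e by simp_all
    show "\<pi> e div 3 \<noteq> ?\<rho> (\<pi> e) div 3" using 1 2 vv(1) unfolding \<rho>e by (simp add: slot_vert_def)
    show "\<pi>' \<circ> r \<circ> inv \<pi>' = ?\<sigma> \<circ> ?\<rho> \<circ> ?\<sigma>" unfolding inv' unfolding \<pi>'_def comm by (simp add: comp_assoc)
  qed
  then show ?thesis using bij im t'' by blast
qed

lemma lift_path:
  assumes cub: "cubic g p {..<3 * V + p} (slot_vert V) \<rho>0"
    and path: "(iso_class g p {..<3 * V + p} (slot_vert V) \<rho>0, D) \<in> whitehead_step g p ^^ m"
  shows "\<exists>t \<pi> \<rho>'. D = iso_class g p {..<3 * V + p} t \<rho>0 \<and> cubic g p {..<3 * V + p} t \<rho>0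
     \<and> bij \<pi> \<and> \<pi> ` {..<3 * V + p} = {..<3 * V + p} \<and> (\<forall>a\<in>{..<3 * V + p}. t a = slot_vert V (\<pi> a))
     \<and> \<rho>' = \<pi> \<circ> \<rho>0 \<circ> inv \<pi> \<and> (slot_move V ^^ m) \<rho>0 \<rho>'"
  using path
proof (induction m arbitrary: D)
  case 0
  then show ?case using cub
    by - (rule exI[where x = "slot_vert V"], rule exI[where x = id], rule exI[where x = \<rho>0], simp add: bij_def inj_def surj_def)
next
  case (Suc m)
  let ?A = "{..<3 * V + p}"
  obtain C where C: "(iso_class g p ?A (slot_vert V) \<rho>0, C) \<in> whitehead_step g p ^^ m" "(C, D) \<in> whitehead_step g p"
    using relpow_Suc_E[OF Suc.prems] .
  obtain t \<pi> \<rho>1 where 1: "C = iso_class g p ?A t \<rho>0" "cubic g p ?A t \<rho>0" "bij \<pi>" "\<pi> ` ?A = ?A"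
    "\<forall>a\<in>?A. t a = slot_vert V (\<pi> a)" "\<rho>1 = \<pi> \<circ> \<rho>0 \<circ> inv \<pi>" "(slot_move V ^^ m) \<rho>0 \<rho>1"
    using Suc.IH[OF C(1)] by (elim exE conjE)
  obtain t' where t': "exchange ?A t \<rho>0 t'" "D = iso_class g p ?A t' \<rho>0"
    using step_exchange[OF 1(2) C(2)[unfolded 1(1)]] .
  obtain \<pi>' where 2: "bij \<pi>'" "\<pi>' ` ?A = ?A" "\<forall>a\<in>?A. t' a = slot_vert V (\<pi>' a)"
      "slot_move V (\<pi> \<circ> \<rho>0 \<circ> inv \<pi>) (\<pi>' \<circ> \<rho>0 \<circ> inv \<pi>')"
    using lift_step[OF 1(2) HOL.refl 1(3,4) _ t'(1)] bspec[OF 1(5)] by metis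
  define \<rho>2 where "\<rho>2 = \<pi>' \<circ> \<rho>0 \<circ> inv \<pi>'"
  have "slot_move V \<rho>1 \<rho>2" using 2(4) unfolding 1(6) \<rho>2_def .
  then have "(slot_move V ^^ Suc m) \<rho>0 \<rho>2" by (rule relpowp_Suc_I[OF 1(7)])
  then show ?case using 2(1-3) t'(2) exchange_cubic(1)[OF 1(2) t'(1)] \<rho>2_def by blast
qed

text \<open>The endpoint is given only as a class, so the graph actually reached agrees with
  \<open>\<rho>1\<close> up to isomorphism; the counting has to pay for this later.\<close>

lemma slot_path:
  assumes cub: "cubic g p {..<3 * V + p} (slot_vert V) \<rho>0" "cubic g p {..<3 * V + p} (slot_vert V) \<rho>1"
    and path: "(iso_class g p {..<3 * V + p} (slot_vert V) \<rho>0, iso_class g p {..<3 * V + p} (slot_vert V) \<rho>1) \<in> whitehead_step g p ^^ m"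
  shows "\<exists>\<rho>'. (slot_move V ^^ m) \<rho>0 \<rho>' \<and> isomorphic {..<3 * V + p} (slot_vert V) \<rho>1 {..<3 * V + p} (slot_vert V) \<rho>'"
proof -
  let ?A = "{..<3 * V + p}"
  obtain t \<pi> where 1: "iso_class g p ?A (slot_vert V) \<rho>1 = iso_class g p ?A t \<rho>0" "cubic g p ?A t \<rho>0" "bij \<pi>" "\<pi> ` ?A = ?A"
    "\<forall>a\<in>?A. t a = slot_vert V (\<pi> a)" "(slot_move V ^^ m) \<rho>0 (\<pi> \<circ> \<rho>0 \<circ> inv \<pi>)"
    using lift_path[OF cub(1) path] by blast
  have "to_multigraph ?A t \<rho>0 \<in> iso_class g p ?A (slot_vert V) \<rho>1" using to_multigraph_in_iso_class[OF 1(2)] 1(1) by simp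
  then have "isomorphic ?A (slot_vert V) \<rho>1 ?A t \<rho>0" by (simp add: iso_class_def to_multigraph_def)
  moreover have "isomorphic ?A t \<rho>0 ?A (slot_vert V) (\<pi> \<circ> \<rho>0 \<circ> inv \<pi>)"
    unfolding isomorphic_def
  proof (rule exI[of _ \<pi>], intro conjI ballI)
    have inj: "inj \<pi>" using 1(3) by (rule bij_is_inj)
    show "bij_betw \<pi> ?A ?A" using inj 1(4) by (auto simp: bij_betw_def intro: inj_on_subset)
    fix a assume "a \<in> ?A"
    show "\<pi> (\<rho>0 a) = (\<pi> \<circ> \<rho>0 \<circ> inv \<pi>) (\<pi> a)" using inj by simp
  qed (use 1(5) in simp)
  ultimately show ?thesis using isomorphic_trans 1(6) by blast
qed

section \<open>Scripts, and the number of graphs reachable in n moves\<close>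

text \<open>Along a sequence of moves every vertex keeps a list of the moves that it takes part in,
  each recorded by the slots of the contracted half-edge and of the exchanged half-edge.\<close>

type_synonym script = "nat \<Rightarrow> (nat \<times> nat) list"

text \<open>A move is played when both ends of its edge announce it at the front of their lists.
  Vertices share no clock, so moves at edges without a common end have no prescribed order.\<close>

definition play :: "nat \<Rightarrow> (nat \<Rightarrow> nat) \<times> script \<Rightarrow> (nat \<Rightarrow> nat) \<times> script \<Rightarrow> bool" where
  "play V S S' \<longleftrightarrow> (\<exists>\<rho> w e x y us vs. S = (\<rho>, w) \<and> (\<forall>a. \<rho> (\<rho> a) = a)
     \<and> e < 3 * V \<and> \<rho> e < 3 * V \<and> e div 3 \<noteq> \<rho> e div 3
     \<and> x div 3 = e div 3 \<and> x \<noteq> e \<and> y div 3 = \<rho> e div 3 \<and> y \<noteq> \<rho> e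
     \<and> w (e div 3) = (e mod 3, x mod 3) # us \<and> w (\<rho> e div 3) = (\<rho> e mod 3, y mod 3) # vs
     \<and> S' = (transpose x y \<circ> \<rho> \<circ> transpose x y, w(e div 3 := us, \<rho> e div 3 := vs)))"

lemma playE:
  assumes "play V (\<rho>, w) S'"
  obtains e x y us vs where "\<forall>a. \<rho> (\<rho> a) = a" "e < 3 * V" "\<rho> e < 3 * V" "e div 3 \<noteq> \<rho> e div 3"
    "x div 3 = e div 3" "x \<noteq> e" "y div 3 = \<rho> e div 3" "y \<noteq> \<rho> e"
    "w (e div 3) = (e mod 3, x mod 3) # us" "w (\<rho> e div 3) = (\<rho> e mod 3, y mod 3) # vs"
    "S' = (transpose x y \<circ> \<rho> \<circ> transpose x y, w(e div 3 := us, \<rho> e div 3 := vs))"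
  using assms unfolding play_def by (elim exE conjE) simp

lemma playI:
  assumes "\<And>a. \<rho> (\<rho> a) = a" "e < 3 * V" "\<rho> e < 3 * V" "e div 3 \<noteq> \<rho> e div 3"
    "x div 3 = e div 3" "x \<noteq> e" "y div 3 = \<rho> e div 3" "y \<noteq> \<rho> e"
    "w (e div 3) = (e mod 3, x mod 3) # us" "w (\<rho> e div 3) = (\<rho> e mod 3, y mod 3) # vs"
    "S' = (transpose x y \<circ> \<rho> \<circ> transpose x y, w(e div 3 := us, \<rho> e div 3 := vs))"
  shows "play V (\<rho>, w) S'"
  unfolding play_def using assms by blast

lemma eq_div_mod3: "(a::nat) div 3 = b div 3 \<Longrightarrow> a mod 3 = b mod 3 \<Longrightarrow> a = b"
  by (metis div_mult_mod_eq)

lemma invol_conj: "(\<And>a. \<rho> (\<rho> a) = a) \<Longrightarrow> (transpose x y \<circ> \<rho> \<circ> transpose x y) ((transpose x y \<circ> \<rho> \<circ> transpose x y) a) = a"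
  by simp

text \<open>The front of a vertex's list names the one edge at which that vertex can move next. So
  two playable moves that share a vertex are the same move, and moves that share none touch
  different slots and commute.\<close>

lemma play_diamond:
  assumes 1: "play V S S1" and 2: "play V S S2"
  shows "S1 = S2 \<or> (\<exists>S3. play V S1 S3 \<and> play V S2 S3)"
proof -
  obtain \<rho> w where S: "S = (\<rho>, w)" by (cases S)
  obtain e x y us vs where a: "\<forall>a. \<rho> (\<rho> a) = a" "e < 3 * V" "\<rho> e < 3 * V" "e div 3 \<noteq> \<rho> e div 3"
    "x div 3 = e div 3" "x \<noteq> e" "y div 3 = \<rho> e div 3" "y \<noteq> \<rho> e"
    "w (e div 3) = (e mod 3, x mod 3) # us" "w (\<rho> e div 3) = (\<rho> e mod 3, y mod 3) # vs"
    "S1 = (transpose x y \<circ> \<rho> \<circ> transpose x y, w(e div 3 := us, \<rho> e div 3 := vs))"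
    using playE[OF 1[unfolded S]] .
  obtain f x' y' us' vs' where b: "\<forall>a. \<rho> (\<rho> a) = a" "f < 3 * V" "\<rho> f < 3 * V" "f div 3 \<noteq> \<rho> f div 3"
    "x' div 3 = f div 3" "x' \<noteq> f" "y' div 3 = \<rho> f div 3" "y' \<noteq> \<rho> f"
    "w (f div 3) = (f mod 3, x' mod 3) # us'" "w (\<rho> f div 3) = (\<rho> f mod 3, y' mod 3) # vs'"
    "S2 = (transpose x' y' \<circ> \<rho> \<circ> transpose x' y', w(f div 3 := us', \<rho> f div 3 := vs'))"
    using playE[OF 2[unfolded S]] .
  have inv: "\<rho> (\<rho> c) = c" for c using a(1) by blast
  consider (same) "e = f" | (opp) "e = \<rho> f" | (dis) "e div 3 \<noteq> f div 3" "e div 3 \<noteq> \<rho> f div 3" "\<rho> e div 3 \<noteq> f div 3" "\<rho> e div 3 \<noteq> \<rho> f div 3"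
  proof -
    have "e = f" if "e div 3 = f div 3"
      by (rule eq_div_mod3[OF that]) (use a(9) b(9) that in simp)
    moreover have "e = \<rho> f" if "e div 3 = \<rho> f div 3"
      by (rule eq_div_mod3[OF that]) (use a(9) b(10) that in simp)
    moreover have "\<rho> e = f" if "\<rho> e div 3 = f div 3"
      by (rule eq_div_mod3[OF that]) (use a(10) b(9) that in simp)
    moreover have "\<rho> e = \<rho> f" if "\<rho> e div 3 = \<rho> f div 3"
      by (rule eq_div_mod3[OF that]) (use a(10) b(10) that in simp)
    ultimately show ?thesis using that a(1) by metis
  qed
  then show ?thesis
  proof cases
    case same
    have "x = x'" by (rule eq_div_mod3) (use a(5,9) b(5,9) same in simp_all)
    moreover have "y = y'" by (rule eq_div_mod3) (use a(7,10) b(7,10) same in simp_all)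
    ultimately have "S1 = S2" unfolding a(11) b(11) using same a(9,10) b(9,10) by simp
    then show ?thesis by blast
  next
    \<comment> \<open>The same move read from the other half of the edge, which interchanges the
      roles of \<open>x\<close> and \<open>y\<close>.\<close>
    case opp
    then have o: "\<rho> e = f" using a(1) by simp
    have "x = y'" by (rule eq_div_mod3) (use a(5,9) b(7,10) opp in simp_all)
    moreover have "y = x'" by (rule eq_div_mod3) (use a(7,10) b(5,9) o in simp_all)
    moreover have "us = vs'" "vs = us'" using a(9,10) b(9,10) o opp by simp_all
    ultimately have "S1 = S2" unfolding a(11) b(11) using o opp a(4)
      by (simp add: transpose_commute fun_upd_twist)
    then show ?thesis by blast
  next
    case dis
    let ?t = "transpose x y" and ?u = "transpose x' y'"
    let ?w = "w(e div 3 := us, \<rho> e div 3 := vs, f div 3 := us', \<rho> f div 3 := vs')"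
    have n: "x \<noteq> x'" "x \<noteq> y'" "y \<noteq> x'" "y \<noteq> y'" "f \<noteq> x" "f \<noteq> y" "\<rho> f \<noteq> x" "\<rho> f \<noteq> y" "e \<noteq> x'" "e \<noteq> y'" "\<rho> e \<noteq> x'" "\<rho> e \<noteq> y'"
      using dis a(5,7) b(5,7) by metis+
    have comm: "?t (?u c) = ?u (?t c)" for c using n by (auto simp: transpose_def)
    have 3: "(?u \<circ> (?t \<circ> \<rho> \<circ> ?t) \<circ> ?u) = (?t \<circ> (?u \<circ> \<rho> \<circ> ?u) \<circ> ?t)"
      by (simp add: fun_eq_iff comm)
    have r1: "(?t \<circ> \<rho> \<circ> ?t) f = \<rho> f" using n by (simp add: transpose_def)
    have r2: "(?u \<circ> \<rho> \<circ> ?u) e = \<rho> e" using n by (simp add: transpose_def)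
    have "play V S1 (?u \<circ> (?t \<circ> \<rho> \<circ> ?t) \<circ> ?u, ?w)"
      unfolding a(11)
      by (rule playI[where e = f and x = x' and y = y' and us = us' and vs = vs'])
         (use invol_conj[of \<rho>, OF inv] inv b dis in \<open>simp_all add: r1 del: comp_apply\<close>)
    moreover have "play V S2 (?u \<circ> (?t \<circ> \<rho> \<circ> ?t) \<circ> ?u, ?w)"
      unfolding b(11)
    proof (rule playI[where e = e and x = x and y = y and us = us and vs = vs])
      have "?w = w(f div 3 := us', \<rho> f div 3 := vs', e div 3 := us, \<rho> e div 3 := vs)"
        using dis by (auto simp: fun_eq_iff)
      then show "(?u \<circ> (?t \<circ> \<rho> \<circ> ?t) \<circ> ?u, ?w) = (?t \<circ> (?u \<circ> \<rho> \<circ> ?u) \<circ> ?t,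
          w(f div 3 := us', \<rho> f div 3 := vs', e div 3 := us, (?u \<circ> \<rho> \<circ> ?u) e div 3 := vs))"
        unfolding 3 r2 by simp
    qed (use invol_conj[of \<rho>, OF inv] inv a dis in \<open>simp_all add: r2 del: comp_apply\<close>)
    ultimately show ?thesis by blast
  qed
qed

text \<open>No first step can miss a terminal state: every fork closes after one step on each side,
  so the detour has the same length.\<close>

lemma diamond_shorten:
  assumes dia: "\<forall>s a b. R s a \<longrightarrow> R s b \<longrightarrow> a = b \<or> (\<exists>c. R a c \<and> R b c)" and nf: "\<forall>u. \<not> R t u"
  shows "(R ^^ n) s t \<Longrightarrow> R s b \<Longrightarrow> \<exists>k. n = Suc k \<and> (R ^^ k) b t"
proof (induction n arbitrary: s b)
  case 0
  then show ?case using nf by simp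
next
  case (Suc n)
  obtain a where a: "R s a" "(R ^^ n) a t" using relpowp_Suc_D2[OF Suc.prems(1)] by blast
  show ?case
  proof (cases "a = b")
    case True
    then show ?thesis using a(2) by blast
  next
    case False
    then obtain c where c: "R a c" "R b c" using dia a(1) Suc.prems(2) by blast
    obtain k where k: "n = Suc k" "(R ^^ k) c t" using Suc.IH[OF a(2) c(1)] by blast
    have "(R ^^ n) b t" unfolding k(1) by (rule relpowp_Suc_I2[OF c(2) k(2)])
    then show ?thesis by blast
  qed
qed

text \<open>Applied to \<open>play\<close>, with empty scripts as terminal states, this says that
  the initial graph and the script determine the final graph, in whichever order the moves are
  played.\<close>

lemma diamond_unique:
  assumes dia: "\<forall>s a b. R s a \<longrightarrow> R s b \<longrightarrow> a = b \<or> (\<exists>c. R a c \<and> R b c)"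
    and nf: "\<forall>u. \<not> R t u" "\<forall>u. \<not> R t' u"
  shows "(R ^^ n) s t \<Longrightarrow> (R ^^ m) s t' \<Longrightarrow> t = t'"
proof (induction m arbitrary: s n)
  case 0
  then have s: "s = t'" by simp
  show ?case
  proof (cases n)
    case 0
    then show ?thesis using s \<open>(R ^^ n) s t\<close> by simp
  next
    case (Suc k)
    then have "(R ^^ Suc k) s t" using \<open>(R ^^ n) s t\<close> by simp
    from relpowp_Suc_D2[OF this] show ?thesis using nf(2) s by blast
  qed
next
  case (Suc m)
  obtain a where a: "R s a" "(R ^^ m) a t'" using relpowp_Suc_D2[OF Suc.prems(2)] by blast
  obtain k where "n = Suc k" "(R ^^ k) a t" using diamond_shorten[OF dia nf(1) Suc.prems(1) a(1)] by blast
  then show ?case using Suc.IH a(2) by blast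
qed

definition scripts :: "nat \<Rightarrow> nat \<Rightarrow> script set" where
  "scripts V n = {w. (\<forall>v. v \<ge> V \<longrightarrow> w v = []) \<and> (\<forall>v. set (w v) \<subseteq> {..<3} \<times> {..<3}) \<and> (\<Sum>v<V. length (w v)) = n}"

text \<open>Each move is recorded at both ends of its edge, hence \<open>2 * m\<close>. The script
  is built from the last move to the first, so that earlier moves are put in front.\<close>

lemma moves_script:
  "(slot_move V ^^ m) \<rho> \<rho>' \<Longrightarrow> (\<And>a. \<rho> (\<rho> a) = a) \<Longrightarrow>
    \<exists>w \<in> scripts V (2 * m). (play V ^^ m) (\<rho>, w) (\<rho>', \<lambda>_. [])"
proof (induction m arbitrary: \<rho>)
  case 0
  then show ?case by (intro bexI[of _ "\<lambda>_. []"]) (auto simp: scripts_def)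
next
  case (Suc m)
  obtain \<rho>1 where 1: "slot_move V \<rho> \<rho>1" "(slot_move V ^^ m) \<rho>1 \<rho>'" using relpowp_Suc_D2[OF Suc.prems(1)] by blast
  obtain e x y where e: "e < 3 * V" "\<rho> e < 3 * V" "e div 3 \<noteq> \<rho> e div 3" "x div 3 = e div 3" "x \<noteq> e"
     "y div 3 = \<rho> e div 3" "y \<noteq> \<rho> e" "\<rho>1 = transpose x y \<circ> \<rho> \<circ> transpose x y"
    using 1(1) unfolding slot_move_def by blast
  have inv: "\<rho>1 (\<rho>1 a) = a" for a unfolding e(8) by (rule invol_conj[OF Suc.prems(2)])
  obtain w where w: "w \<in> scripts V (2 * m)" "(play V ^^ m) (\<rho>1, w) (\<rho>', \<lambda>_. [])"
    using Suc.IH[OF 1(2) inv] by blast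
  let ?v = "e div 3" and ?u = "\<rho> e div 3"
  have lt: "?v < V" "?u < V" using e(1,2) div3_less by blast+
  define w' where "w' = w(?v := (e mod 3, x mod 3) # w ?v, ?u := (\<rho> e mod 3, y mod 3) # w ?u)"
  have "play V (\<rho>, w') (\<rho>1, w)"
  proof (rule playI[where e = e and x = x and y = y and us = "w ?v" and vs = "w ?u"])
    show "(\<rho>1, w) = (transpose x y \<circ> \<rho> \<circ> transpose x y, w'(?v := w ?v, ?u := w ?u))"
      using e(8) by (auto simp: w'_def fun_eq_iff)
  qed (use e Suc.prems(2) in \<open>simp_all add: w'_def\<close>)
  then have p: "(play V ^^ Suc m) (\<rho>, w') (\<rho>', \<lambda>_. [])" by (rule relpowp_Suc_I2[OF _ w(2)])
  have "(\<Sum>v<V. length (w' v)) = (\<Sum>v<V. length (w v) + ((if v = ?v then 1 else 0) + (if v = ?u then 1 else 0)))"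
    using e(3) by (intro sum.cong) (auto simp: w'_def)
  also have "\<dots> = 2 * m + 2" using lt w(1) by (simp add: sum.distrib scripts_def)
  finally have "w' \<in> scripts V (2 * Suc m)"
    using w(1) lt unfolding scripts_def by (auto simp: w'_def)
  then show ?case using p by blast
qed

lemma delimited_inj:
  "concat (map (\<lambda>x. map Some x @ [None]) xs) = concat (map (\<lambda>x. map Some x @ [None]) ys) \<Longrightarrow> xs = ys"
proof (induction xs arbitrary: ys)
  case Nil
  then show ?case by (cases ys) auto
next
  case (Cons x xs)
  obtain y ys' where ys: "ys = y # ys'" using Cons.prems by (cases ys) auto
  have aux: "map Some x @ None # r = map Some y @ None # r' \<Longrightarrow> x = y \<and> r = r'" for x y :: "'a list" and r r'
  proof (induction x arbitrary: y)
    case Nil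
    then show ?case by (cases y) simp_all
  next
    case (Cons a x)
    then show ?case by (cases y) simp_all
  qed
  let ?c = "\<lambda>xs. concat (map (\<lambda>x. map Some x @ [None]) xs)"
  have "map Some x @ None # ?c xs = map Some y @ None # ?c ys'" using Cons.prems unfolding ys by simp
  then have "x = y \<and> ?c xs = ?c ys'" by (rule aux)
  then show ?case using Cons.IH[of ys'] unfolding ys by simp
qed

text \<open>Writing the lists one after the other, each closed by the separator \<open>None\<close>,
  gives a word of length \<open>V + n\<close> over nine records and the separator, hence the base
  10.\<close>

lemma scripts_card: "finite (scripts V n) \<and> card (scripts V n) \<le> 10 ^ (V + n)"
proof -
  let ?al = "insert None (Some ` ({..<3} \<times> {..<3})) :: (nat \<times> nat) option set"
  let ?enc = "\<lambda>w :: script. concat (map (\<lambda>x. map Some x @ [None]) (map w [0..<V]))"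
  let ?T = "{xs. set xs \<subseteq> ?al \<and> length xs = V + n}"
  have fin: "finite ?al" by simp
  have "card ?al = 10"
    by (subst card_insert_disjoint) (auto simp: card_image card_cartesian_product)
  then have cT: "card ?T = 10 ^ (V + n)" using card_lists_length_eq[OF fin, of "V + n"] by simp
  have fT: "finite ?T" by (rule finite_lists_length_eq[OF fin])
  have inj: "inj_on ?enc (scripts V n)"
  proof (rule inj_onI)
    fix w w' assume w: "w \<in> scripts V n" "w' \<in> scripts V n" "?enc w = ?enc w'"
    then have "map w [0..<V] = map w' [0..<V]" using delimited_inj by blast
    then have "w v = w' v" if "v < V" for v using that by (simp add: map_eq_conv)
    moreover have "w v = w' v" if "\<not> v < V" for v using that w by (simp add: scripts_def)
    ultimately show "w = w'" by blast
  qed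
  have sub: "?enc ` scripts V n \<subseteq> ?T"
  proof
    fix xs assume "xs \<in> ?enc ` scripts V n"
    then obtain w where w: "w \<in> scripts V n" "xs = ?enc w" by blast
    have "length xs = (\<Sum>v<V. length (w v) + 1)"
      unfolding w(2) length_concat map_map by (simp add: interv_sum_list_conv_sum_set_nat atLeast0LessThan comp_def)
    also have "\<dots> = V + n" using w(1) by (simp add: scripts_def sum_Suc)
    finally have "length xs = V + n" .
    moreover have "set xs \<subseteq> ?al" using w(1) unfolding w(2) scripts_def by auto
    ultimately show "xs \<in> ?T" by blast
  qed
  show ?thesis
    using card_inj_on_le[OF inj sub fT] inj_on_finite[OF inj sub fT] cT by simp
qed

text \<open>Two reachable graphs with the same script coincide by confluence, so scripts are counted
  instead of sequences; the base of the power does not grow with the number of available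
  moves.\<close>

lemma reachable_card:
  assumes "\<And>a. \<rho> (\<rho> a) = a"
  shows "finite {\<rho>'. (slot_move V ^^ m) \<rho> \<rho>'} \<and> card {\<rho>'. (slot_move V ^^ m) \<rho> \<rho>'} \<le> 10 ^ (V + 2 * m)"
proof -
  let ?R = "{\<rho>'. (slot_move V ^^ m) \<rho> \<rho>'}"
  have "\<forall>\<rho>'\<in>?R. \<exists>w. w \<in> scripts V (2 * m) \<and> (play V ^^ m) (\<rho>, w) (\<rho>', \<lambda>_. [])"
    using moves_script[OF _ assms] by blast
  then obtain w where w: "\<And>\<rho>'. \<rho>' \<in> ?R \<Longrightarrow> w \<rho>' \<in> scripts V (2 * m) \<and> (play V ^^ m) (\<rho>, w \<rho>') (\<rho>', \<lambda>_. [])"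
    by metis
  have nf: "\<not> play V (\<sigma>, \<lambda>_. []) u" for \<sigma> u unfolding play_def by simp
  have inj: "inj_on w ?R"
  proof (rule inj_onI)
    fix \<rho>1 \<rho>2 assume r: "\<rho>1 \<in> ?R" "\<rho>2 \<in> ?R" "w \<rho>1 = w \<rho>2"
    have "(\<rho>1, (\<lambda>_. []) :: script) = (\<rho>2, \<lambda>_. [])"
    proof (rule diamond_unique[where R = "play V"])
      show "\<forall>s a b. play V s a \<longrightarrow> play V s b \<longrightarrow> a = b \<or> (\<exists>c. play V a c \<and> play V b c)"
        using play_diamond by blast
      show "(play V ^^ m) (\<rho>, w \<rho>1) (\<rho>1, \<lambda>_. [])" using w[OF r(1)] by blast
      show "(play V ^^ m) (\<rho>, w \<rho>1) (\<rho>2, \<lambda>_. [])" using w[OF r(2)] r(3) by simp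
    qed (use nf in blast)+
    then show "\<rho>1 = \<rho>2" by simp
  qed
  have sub: "w ` ?R \<subseteq> scripts V (2 * m)" using w by blast
  show ?thesis
    using scripts_card[of V "2 * m"] card_inj_on_le[OF inj sub] inj_on_finite[OF inj sub] by linarith
qed

section \<open>Two extreme families of graphs\<close>

lemma div3_cong_less: "(a::nat) div 3 = b div 3 \<Longrightarrow> b < 3 * V \<Longrightarrow> a < 3 * V"
  by (metis div3_less div_less_iff_less_mult mult.commute zero_less_numeral)

definition pairing :: "('a \<times> 'a) list \<Rightarrow> 'a \<Rightarrow> 'a" where
  "pairing ps a = (case map_of (ps @ map prod.swap ps) a of None \<Rightarrow> a | Some b \<Rightarrow> b)"

lemma mset_flat: "mset (flat ps) = mset (map fst (ps @ map prod.swap ps))"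
  by (induction ps) auto

lemma pairing_pair:
  assumes "distinct (flat ps)" "(x, y) \<in> set ps"
  shows "pairing ps x = y" "pairing ps y = x"
proof -
  have d: "distinct (map fst (ps @ map prod.swap ps))"
    using assms(1) mset_flat[of ps] by (metis mset_eq_imp_distinct_iff)
  have "(x, y) \<in> set (ps @ map prod.swap ps)" using assms(2) by simp
  then have "map_of (ps @ map prod.swap ps) x = Some y" by (rule map_of_is_SomeI[OF d])
  then show "pairing ps x = y" by (simp add: pairing_def del: map_of_append)
  have "(y, x) \<in> set (ps @ map prod.swap ps)" using assms(2) by force
  then have "map_of (ps @ map prod.swap ps) y = Some x" by (rule map_of_is_SomeI[OF d])
  then show "pairing ps y = x" by (simp add: pairing_def del: map_of_append)
qed

lemma pairing_outside:
  assumes "a \<notin> set (flat ps)"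
  shows "pairing ps a = a"
proof -
  have "set (flat ps) = set (map fst (ps @ map prod.swap ps))" using mset_flat[of ps] by (metis set_mset_mset)
  then have "a \<notin> fst ` set (ps @ map prod.swap ps)" using assms unfolding set_map by simp
  then have "map_of (ps @ map prod.swap ps) a = None" unfolding map_of_eq_None_iff .
  then show ?thesis by (simp add: pairing_def del: map_of_append)
qed

lemma in_flatE:
  assumes "a \<in> set (flat ps)"
  obtains x y where "(x, y) \<in> set ps" "a = x \<or> a = y"
  using assms by auto

lemma pairing_invol:
  assumes d: "distinct (flat ps)"
  shows "pairing ps (pairing ps a) = a" "a \<in> set (flat ps) \<longleftrightarrow> pairing ps a \<noteq> a"
proof -
  have ne: "x \<noteq> y" if "(x, y) \<in> set ps" for x y
    using d that by (induction ps) auto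
  have 1: "pairing ps (pairing ps a) = a \<and> pairing ps a \<noteq> a" if "a \<in> set (flat ps)"
    using that
  proof (rule in_flatE)
    fix x y assume "(x, y) \<in> set ps" "a = x \<or> a = y"
    then show ?thesis using pairing_pair[OF d] ne[of x y] by auto
  qed
  show "pairing ps (pairing ps a) = a" using 1 pairing_outside[of a ps] by (cases "a \<in> set (flat ps)") auto
  show "a \<in> set (flat ps) \<longleftrightarrow> pairing ps a \<noteq> a" using 1 pairing_outside[of a ps] by blast
qed

text \<open>\<open>cs\<close> enumerates the \<open>2 * V + 1\<close> slots that do not point to a
  parent: slot 0 and two per vertex. The first \<open>V - 1\<close> of them carry the tree edges,
  and \<open>es\<close> joins the other \<open>V + 2\<close> to one another and to the
  leaves.\<close>

lemma pairing_slot_graph: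
  assumes V: "V > 0"
    and cs1: "\<And>k. 1 \<le> k \<Longrightarrow> k \<le> 2 * V + 1 \<Longrightarrow> cs k < 3 * V"
    and cs2: "\<And>a. a < 3 * V \<Longrightarrow> a = 0 \<or> a mod 3 \<noteq> 0 \<Longrightarrow> \<exists>k\<ge>1. k \<le> 2 * V + 1 \<and> cs k = a"
    and cs3: "\<And>v. 0 < v \<Longrightarrow> v < V \<Longrightarrow> cs v < 3 * v"
    and es: "set (flat es) = cs ` {V..2 * V + 1} \<union> {3 * V..<3 * V + p}" "2 * length es = V + 2 + p"
    and lf: "\<And>x y. (x, y) \<in> set es \<Longrightarrow> x < 3 * V \<or> y < 3 * V"
  defines "ps \<equiv> map (\<lambda>v. (3 * v, cs v)) [1..<V] @ es"
  shows "distinct (flat ps)" "slot_graph V p (pairing ps)"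
proof -
  have tree: "set (flat (map (\<lambda>v. (3 * v, cs v)) [1..<V])) = (\<lambda>v. 3 * v) ` {1..<V} \<union> cs ` {1..<V}"
    by auto
  have all: "set (flat ps) = {..<3 * V + p}"
  proof
    show "set (flat ps) \<subseteq> {..<3 * V + p}"
    proof
      fix a assume "a \<in> set (flat ps)"
      then have "a \<in> (\<lambda>v. 3 * v) ` {1..<V} \<union> cs ` {1..<V} \<union> cs ` {V..2 * V + 1} \<union> {3 * V..<3 * V + p}"
        unfolding ps_def map_append concat_append set_append tree es(1) by blast
      then show "a \<in> {..<3 * V + p}"
      proof (elim UnE imageE)
        fix k assume "a = cs k" "k \<in> {1..<V}"
        then show ?thesis using cs1[of k] by simp
      next
        fix k assume "a = cs k" "k \<in> {V..2 * V + 1}"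
        then show ?thesis using cs1[of k] V by simp
      qed simp_all
    qed
    show "{..<3 * V + p} \<subseteq> set (flat ps)"
    proof
      fix a assume a: "a \<in> {..<3 * V + p}"
      consider "3 * V \<le> a" | "a < 3 * V" "a \<noteq> 0" "a mod 3 = 0" | "a < 3 * V" "a = 0 \<or> a mod 3 \<noteq> 0" by linarith
      then have "a \<in> (\<lambda>v. 3 * v) ` {1..<V} \<union> cs ` {1..<V} \<union> cs ` {V..2 * V + 1} \<union> {3 * V..<3 * V + p}"
      proof cases
        case 1
        then show ?thesis using a by simp
      next
        case 2
        then obtain v where "a = 3 * v" by (auto simp: mod_eq_0_iff_dvd)
        then show ?thesis using 2 by auto
      next
        case 3
        then obtain k where k: "1 \<le> k" "k \<le> 2 * V + 1" "cs k = a" using cs2 by blast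
        then show ?thesis by (cases "k < V") auto
      qed
      then show "a \<in> set (flat ps)"
        unfolding ps_def map_append concat_append set_append tree es(1) by blast
    qed
  qed
  \<comment> \<open>The list has as many entries as the set it covers, so none is repeated.\<close>
  have "length (flat ps) = 3 * V + p" using es(2) V unfolding length_flat by (simp add: ps_def)
  then show d: "distinct (flat ps)" 
    using card_distinct[of "flat ps"] arg_cong[OF all, of card] by simp
  note pp = pairing_pair[OF d]
  show "slot_graph V p (pairing ps)"
    unfolding slot_graph_def
  proof (intro conjI allI impI)
    fix a
    show "pairing ps (pairing ps a) = a" by (rule pairing_invol(1)[OF d])
    show "a < 3 * V + p \<longleftrightarrow> pairing ps a \<noteq> a" using pairing_invol(2)[OF d, of a] unfolding all by simp
    assume a: "3 * V \<le> a \<and> a < 3 * V + p"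
    then have "a \<in> set (flat ps)" unfolding all by simp
    then obtain x y where xy: "(x, y) \<in> set ps" "a = x \<or> a = y" by (rule in_flatE)
    have "(x, y) \<in> set es"
    proof (rule ccontr)
      assume "(x, y) \<notin> set es"
      then obtain v where "x = 3 * v" "y = cs v" "1 \<le> v" "v < V" using xy(1) unfolding ps_def by auto
      then show False using xy(2) a cs1[of v] by auto
    qed
    then show "pairing ps a < 3 * V" using lf[of x y] xy(2) pp[OF xy(1)] a by auto
  next
    fix v assume v: "0 < v \<and> v < V"
    then have "(3 * v, cs v) \<in> set ps" unfolding ps_def by auto
    then show "pairing ps (3 * v) < 3 * v" using pp(1)[of "3 * v" "cs v"] cs3 v by simp
  qed
qed

section \<open>Counting vertices with a loop or with two leaves\<close>

definition busy :: "nat \<Rightarrow> (nat \<Rightarrow> nat) \<Rightarrow> nat \<Rightarrow> bool" where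
  "busy V \<rho> v \<longleftrightarrow> (\<exists>a. a div 3 = v \<and> \<rho> a < 3 * V \<and> \<rho> a div 3 = v)
     \<or> (\<exists>a b. a \<noteq> b \<and> a div 3 = v \<and> b div 3 = v \<and> 3 * V \<le> \<rho> a \<and> 3 * V \<le> \<rho> b)"

definition num_busy :: "nat \<Rightarrow> (nat \<Rightarrow> nat) \<Rightarrow> nat" where
  "num_busy V \<rho> = card {v. v < V \<and> busy V \<rho> v}"

text \<open>Away from the two ends of the contracted edge nothing changes: a slot joined to
  \<open>x\<close> or \<open>y\<close> before the move is joined to the other one afterwards, and
  both belong to those ends.\<close>

lemma num_busy_move:
  assumes "slot_move V \<rho> \<rho>'"
  shows "num_busy V \<rho>' \<le> num_busy V \<rho> + 2"
proof -
  obtain e x y where e: "e < 3 * V" "\<rho> e < 3 * V" "e div 3 \<noteq> \<rho> e div 3" "x div 3 = e div 3" "x \<noteq> e"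
     "y div 3 = \<rho> e div 3" "y \<noteq> \<rho> e" "\<rho>' = transpose x y \<circ> \<rho> \<circ> transpose x y"
    using assms unfolding slot_move_def by blast
  have xy: "x < 3 * V" "y < 3 * V"
    using div3_cong_less[OF e(4,1)] div3_cong_less[OF e(6,2)] by blast+
  have "busy V \<rho> v" if v: "busy V \<rho>' v" "v \<noteq> e div 3" "v \<noteq> \<rho> e div 3" for v
  proof -
    have eq: "(\<rho>' a < 3 * V \<and> \<rho>' a div 3 = v \<longleftrightarrow> \<rho> a < 3 * V \<and> \<rho> a div 3 = v) \<and> (3 * V \<le> \<rho>' a \<longleftrightarrow> 3 * V \<le> \<rho> a)"
      if a: "a div 3 = v" for a
    proof -
      have "a \<noteq> x" "a \<noteq> y" using a v e(4,6) by auto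
      then have r: "\<rho>' a = transpose x y (\<rho> a)" unfolding e(8) by (simp add: transpose_def)
      consider "\<rho> a = x" | "\<rho> a = y" | "\<rho> a \<noteq> x" "\<rho> a \<noteq> y" by blast
      then show ?thesis
      proof cases
        case 1
        then show ?thesis using r xy v(2,3) e(4,6) by simp
      next
        case 2
        then show ?thesis using r xy v(2,3) e(4,6) by simp
      next
        case 3
        then show ?thesis using r by (simp add: transpose_def)
      qed
    qed
    then show ?thesis using v(1) unfolding busy_def by blast
  qed
  then have "{v. v < V \<and> busy V \<rho>' v} \<subseteq> {v. v < V \<and> busy V \<rho> v} \<union> {e div 3, \<rho> e div 3}" by blast
  then have "num_busy V \<rho>' \<le> card ({v. v < V \<and> busy V \<rho> v} \<union> {e div 3, \<rho> e div 3})"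
    unfolding num_busy_def by (intro card_mono) auto
  also have "\<dots> \<le> num_busy V \<rho> + card {e div 3, \<rho> e div 3}" unfolding num_busy_def by (rule card_Un_le)
  also have "\<dots> \<le> num_busy V \<rho> + 2" using e(3) by simp
  finally show ?thesis .
qed

lemma num_busy_moves: "(slot_move V ^^ m) \<rho> \<rho>' \<Longrightarrow> num_busy V \<rho>' \<le> num_busy V \<rho> + 2 * m"
proof (induction m arbitrary: \<rho>')
  case (Suc m)
  obtain \<rho>1 where "(slot_move V ^^ m) \<rho> \<rho>1" "slot_move V \<rho>1 \<rho>'" using relpowp_Suc_E[OF Suc.prems] by blast
  then show ?case using Suc.IH[of \<rho>1] num_busy_move[of V \<rho>1 \<rho>'] by simp
qed simp

text \<open>The slots below \<open>3 * V\<close> are exactly those that share their vertex with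
  another slot, and a bijection respecting equality of vertices must preserve this.\<close>

lemma isomorphic_slots:
  assumes "isomorphic {..<3 * V + p} (slot_vert V) \<rho> {..<3 * V + p} (slot_vert V) \<rho>'"
  obtains \<phi> where "bij_betw \<phi> {..<3 * V + p} {..<3 * V + p}" "\<forall>a<3 * V + p. \<phi> (\<rho> a) = \<rho>' (\<phi> a)"
    "\<forall>a<3 * V + p. a < 3 * V \<longleftrightarrow> \<phi> a < 3 * V"
    "\<forall>a<3 * V. \<forall>b<3 * V. a div 3 = b div 3 \<longleftrightarrow> \<phi> a div 3 = \<phi> b div 3"
proof -
  let ?A = "{..<3 * V + p}"
  obtain \<phi> where p: "bij_betw \<phi> ?A ?A" "\<forall>a\<in>?A. \<forall>b\<in>?A. slot_vert V a = slot_vert V b \<longleftrightarrow> slot_vert V (\<phi> a) = slot_vert V (\<phi> b)"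
     "\<forall>a\<in>?A. \<phi> (\<rho> a) = \<rho>' (\<phi> a)" using assms by (auto simp: isomorphic_def)
  have inj: "inj_on \<phi> ?A" and im: "\<phi> ` ?A = ?A" using p(1) by (auto simp: bij_betw_def)
  have other: "\<exists>b. b < 3 * V \<and> b \<noteq> a \<and> slot_vert V b = slot_vert V a" if a: "a < 3 * V" for a
  proof -
    define b where "b = (if a mod 3 = 0 then a + 1 else 3 * (a div 3))"
    have "b div 3 = a div 3" "b \<noteq> a" unfolding b_def by presburger+
    moreover have "b < 3 * V" by (rule div3_cong_less[OF calculation(1) a])
    ultimately show ?thesis using a by (auto simp: vt_eq_trivalent)
  qed
  have lt: "a < 3 * V \<longleftrightarrow> \<phi> a < 3 * V" if a: "a \<in> ?A" for a
  proof
    assume "a < 3 * V"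
    then obtain b where b: "b < 3 * V" "b \<noteq> a" "slot_vert V b = slot_vert V a" using other by blast
    then have bA: "b \<in> ?A" by simp
    have "slot_vert V (\<phi> b) = slot_vert V (\<phi> a)" "\<phi> b \<noteq> \<phi> a" using p(2) b a bA inj_on_eq_iff[OF inj bA a] by auto
    then show "\<phi> a < 3 * V" using vt_same[of V "\<phi> b" "\<phi> a"] by blast
  next
    assume "\<phi> a < 3 * V"
    then obtain c where c: "c < 3 * V" "c \<noteq> \<phi> a" "slot_vert V c = slot_vert V (\<phi> a)" using other by blast
    then have "c \<in> \<phi> ` ?A" unfolding im by simp
    then obtain b where b: "b \<in> ?A" "c = \<phi> b" by blast
    then have "slot_vert V b = slot_vert V a" "b \<noteq> a" using p(2) a c by auto
    then show "a < 3 * V" using vt_same[of V b a] by blast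
  qed
  show ?thesis
  proof (rule that[OF p(1)])
    show "\<forall>a<3 * V + p. \<phi> (\<rho> a) = \<rho>' (\<phi> a)" using p(3) by simp
    show "\<forall>a<3 * V + p. a < 3 * V \<longleftrightarrow> \<phi> a < 3 * V" using lt by simp
    show "\<forall>a<3 * V. \<forall>b<3 * V. a div 3 = b div 3 \<longleftrightarrow> \<phi> a div 3 = \<phi> b div 3"
    proof (intro allI impI)
      fix a b assume ab: "a < 3 * V" "b < 3 * V"
      then have A: "a \<in> ?A" "b \<in> ?A" by simp_all
      have "\<phi> a < 3 * V" "\<phi> b < 3 * V" using lt A ab by blast+
      moreover have "slot_vert V a = slot_vert V b \<longleftrightarrow> slot_vert V (\<phi> a) = slot_vert V (\<phi> b)" using p(2) A by blast
      ultimately show "a div 3 = b div 3 \<longleftrightarrow> \<phi> a div 3 = \<phi> b div 3" using ab by (simp add: slot_vert_def)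
    qed
  qed
qed

text \<open>The map on trivalent vertices induced by \<open>\<phi>\<close> is injective and carries
  loops to loops and pairs of leaves to pairs of leaves.\<close>

lemma num_busy_iso:
  assumes iso: "isomorphic {..<3 * V + p} (slot_vert V) \<rho> {..<3 * V + p} (slot_vert V) \<rho>'"
    and \<rho>A: "\<And>a. a < 3 * V + p \<Longrightarrow> \<rho> a < 3 * V + p"
  shows "num_busy V \<rho> \<le> num_busy V \<rho>'"
proof -
  obtain \<phi> where p: "bij_betw \<phi> {..<3 * V + p} {..<3 * V + p}" "\<forall>a<3 * V + p. \<phi> (\<rho> a) = \<rho>' (\<phi> a)"
    "\<forall>a<3 * V + p. a < 3 * V \<longleftrightarrow> \<phi> a < 3 * V"
    "\<forall>a<3 * V. \<forall>b<3 * V. a div 3 = b div 3 \<longleftrightarrow> \<phi> a div 3 = \<phi> b div 3"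
    using isomorphic_slots[OF iso] .
  have inj: "inj_on \<phi> {..<3 * V + p}" using p(1) by (simp add: bij_betw_def)
  let ?f = "\<lambda>v. \<phi> (3 * v) div 3"
  have p4: "\<phi> a div 3 = \<phi> b div 3 \<longleftrightarrow> a div 3 = b div 3" if "a < 3 * V" "b < 3 * V" for a b
    using p(4)[rule_format, OF that] by simp
  have p3: "\<phi> a < 3 * V \<longleftrightarrow> a < 3 * V" if "a < 3 * V + p" for a
    using p(3)[rule_format, OF that] by simp
  have p2: "\<phi> (\<rho> a) = \<rho>' (\<phi> a)" if "a < 3 * V" for a
    using p(2)[rule_format, of a] that by simp
  have lt: "a < 3 * V" if "v < V" "a div 3 = v" for a v
    by (rule div3_cong_less[of a "3 * v"]) (use that in simp_all)
  have dv: "\<phi> a div 3 = ?f v" if "v < V" "a div 3 = v" for a v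
    unfolding p4[OF lt[OF that] mult_strict_left_mono[OF that(1) zero_less_numeral]] using that(2) by simp
  have fV: "?f v < V" if "v < V" for v
    by (rule div3_less) (use p3[of "3 * v"] that in simp)
  have "inj_on ?f {v. v < V \<and> busy V \<rho> v}"
  proof (rule inj_onI)
    fix v w assume vw: "v \<in> {v. v < V \<and> busy V \<rho> v}" "w \<in> {v. v < V \<and> busy V \<rho> v}" "?f v = ?f w"
    then have "3 * v div 3 = 3 * w div 3" using p4[of "3 * v" "3 * w"] by simp
    then show "v = w" by simp
  qed
  moreover have "busy V \<rho>' (?f v)" if v: "v < V" "busy V \<rho> v" for v
    using v(2)[unfolded busy_def]
  proof (elim disjE exE conjE)
    fix a assume a: "a div 3 = v" "\<rho> a < 3 * V" "\<rho> a div 3 = v"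
    have "\<phi> a div 3 = ?f v" "\<phi> (\<rho> a) div 3 = ?f v" using dv[OF v(1)] a(1,3) by blast+
    moreover have "\<phi> (\<rho> a) < 3 * V" using p3[of "\<rho> a"] a(2) by simp
    moreover have "\<phi> (\<rho> a) = \<rho>' (\<phi> a)" by (rule p2[OF lt[OF v(1) a(1)]])
    ultimately have "\<phi> a div 3 = ?f v \<and> \<rho>' (\<phi> a) < 3 * V \<and> \<rho>' (\<phi> a) div 3 = ?f v" by simp
    then show ?thesis unfolding busy_def by (rule disjI1[OF exI])
  next
    fix a b assume a: "a \<noteq> b" "a div 3 = v" "b div 3 = v" "3 * V \<le> \<rho> a" "3 * V \<le> \<rho> b"
    note la = lt[OF v(1) a(2)] and lb = lt[OF v(1) a(3)]
    have "3 * V \<le> \<phi> (\<rho> a)" using p3[of "\<rho> a"] \<rho>A[of a] la a(4) by simp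
    moreover have "3 * V \<le> \<phi> (\<rho> b)" using p3[of "\<rho> b"] \<rho>A[of b] lb a(5) by simp
    moreover have "\<phi> a \<noteq> \<phi> b" using inj_on_eq_iff[OF inj, of a b] la lb a(1) by simp
    moreover have "\<phi> a div 3 = ?f v" "\<phi> b div 3 = ?f v" using dv[OF v(1)] a(2,3) by blast+
    ultimately have "\<phi> a \<noteq> \<phi> b \<and> \<phi> a div 3 = ?f v \<and> \<phi> b div 3 = ?f v \<and> 3 * V \<le> \<rho>' (\<phi> a) \<and> 3 * V \<le> \<rho>' (\<phi> b)"
      unfolding p2[OF la] p2[OF lb] by simp
    then show ?thesis unfolding busy_def
      by - (rule disjI2, rule exI[of _ "\<phi> a"], rule exI[of _ "\<phi> b"])
  qed
  then have "?f ` {v. v < V \<and> busy V \<rho> v} \<subseteq> {v. v < V \<and> busy V \<rho>' v}" using fV by auto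
  ultimately show ?thesis unfolding num_busy_def by (intro card_inj_on_le) auto
qed

text \<open>A loop and a pair of leaves both use two slots of the vertex, but two of its three slots
  lead to other trivalent vertices.\<close>

lemma not_busy:
  assumes "a div 3 = v" "b div 3 = v" "a \<noteq> b" "\<rho> a < 3 * V" "\<rho> b < 3 * V" "\<rho> a div 3 \<noteq> v" "\<rho> b div 3 \<noteq> v"
    and inv: "\<And>c. \<rho> (\<rho> c) = c" and ne: "\<And>c. c < 3 * V \<Longrightarrow> \<rho> c \<noteq> c" and v: "v < V"
  shows "\<not> busy V \<rho> v"
proof
  assume "busy V \<rho> v"
  then consider c where "c div 3 = v" "\<rho> c < 3 * V" "\<rho> c div 3 = v"
    | c d where "c \<noteq> d" "c div 3 = v" "d div 3 = v" "3 * V \<le> \<rho> c" "3 * V \<le> \<rho> d"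
    unfolding busy_def by blast
  then show False
  proof cases
    case 1
    have "c \<noteq> a" "c \<noteq> b" "\<rho> c \<noteq> a" "\<rho> c \<noteq> b" using 1 assms(6,7) inv[of c] assms(1,2) by metis+
    moreover have "c \<noteq> \<rho> c" using ne[of c] 1 v by linarith
    ultimately show False using 1(1,3) assms(1-3) by linarith
  next
    case 2
    have "c \<noteq> a" "c \<noteq> b" "d \<noteq> a" "d \<noteq> b" using 2 assms(4,5) by auto
    then show False using 2(1-3) assms(1-3) by linarith
  qed
qed

lemma set_flat_map: "set (flat (map (\<lambda>i. (f i, h i)) xs)) = f ` set xs \<union> h ` set xs"
  by (induction xs) auto

lemma ends_image: "cs ` {V..2 * V + 1} = (\<lambda>j. cs (2 * V + 1 - j)) ` {..<V + 2}" for cs :: "nat \<Rightarrow> nat"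
proof
  show "cs ` {V..2 * V + 1} \<subseteq> (\<lambda>j. cs (2 * V + 1 - j)) ` {..<V + 2}"
  proof
    fix a assume "a \<in> cs ` {V..2 * V + 1}"
    then obtain k where k: "a = cs k" "V \<le> k" "k \<le> 2 * V + 1" by auto
    then show "a \<in> (\<lambda>j. cs (2 * V + 1 - j)) ` {..<V + 2}"
      by (intro image_eqI[of _ _ "2 * V + 1 - k"]) simp_all
  qed
  show "(\<lambda>j. cs (2 * V + 1 - j)) ` {..<V + 2} \<subseteq> cs ` {V..2 * V + 1}"
    by (rule image_subsetI, rule imageI) simp
qed

section \<open>Caterpillars and heap-shaped trees with their free ends joined\<close>

text \<open>Vertex \<open>v\<close> is attached by its slot \<open>3 * v\<close> to the slot with index \<open>v\<close> in the following enumerations;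
  the indices from \<open>V\<close> to \<open>2 * V + 1\<close> enumerate the free ends of the tree.\<close>

definition spine_cs :: "nat \<Rightarrow> nat \<Rightarrow> nat" where
  "spine_cs V k = (if k < V then 3 * k - 1 else if k = V then 0 else if k \<le> 2 * V then 3 * (k - V - 1) + 1 else 3 * V - 1)"

text \<open>Binary heap order: vertex \<open>w\<close> offers its slots \<open>3 * w + 1\<close> and
  \<open>3 * w + 2\<close> under the indices \<open>2 * w + 2\<close> and \<open>2 * w + 3\<close>,
  and slot 0 has index 1. Counted from the top index \<open>2 * V + 1\<close> downwards, the ends
  come in pairs at one vertex.\<close>

definition heap_cs :: "nat \<Rightarrow> nat" where
  "heap_cs k = (if k = 1 then 0 else 3 * ((k - 2) div 2) + 1 + k mod 2)"

lemma spine_cs_less: "V > 0 \<Longrightarrow> 1 \<le> k \<Longrightarrow> k \<le> 2 * V + 1 \<Longrightarrow> spine_cs V k < 3 * V"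
  unfolding spine_cs_def by (simp, linarith)

lemma spine_cs_onto:
  assumes V: "V > 0" and a: "a < 3 * V" "a = 0 \<or> a mod 3 \<noteq> 0"
  shows "\<exists>k\<ge>1. k \<le> 2 * V + 1 \<and> spine_cs V k = a"
proof -
  have dm: "a = 3 * (a div 3) + a mod 3" by simp
  have lt: "a div 3 < V" using div3_less[OF a(1)] .
  consider "a = 0" | "a mod 3 = 1" | "a mod 3 = 2" "a div 3 + 1 < V" | "a mod 3 = 2" "a div 3 + 1 = V"
    using a(2) lt by linarith
  then show ?thesis
  proof cases
    case 1
    then show ?thesis using V by (intro exI[of _ V]) (simp add: spine_cs_def)
  next
    case 2
    have "spine_cs V (V + 1 + a div 3) = 3 * (a div 3) + 1" using lt by (simp add: spine_cs_def)
    then show ?thesis using dm 2 lt by (intro exI[of _ "V + 1 + a div 3"]) simp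
  next
    case 3
    have "spine_cs V (a div 3 + 1) = 3 * (a div 3) + 2" using 3 by (simp add: spine_cs_def)
    then show ?thesis using dm 3 lt by (intro exI[of _ "a div 3 + 1"]) simp
  next
    case 4
    have "spine_cs V (2 * V + 1) = 3 * V - 1" by (simp add: spine_cs_def)
    moreover have "3 * V - 1 = a" using dm 4 by linarith
    ultimately show ?thesis by (intro exI[of _ "2 * V + 1"]) simp
  qed
qed

lemma spine_cs_inj:
  assumes "V > 0" "V \<le> k" "k \<le> 2 * V + 1" "V \<le> l" "l \<le> 2 * V + 1" "spine_cs V k = spine_cs V l"
  shows "k = l"
proof -
  have s: "spine_cs V i = (if i = V then 0 else if i \<le> 2 * V then 3 * (i - V - 1) + 1 else 3 * V - 1)"
    if "V \<le> i" for i using that by (simp add: spine_cs_def)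
  have mid: "3 * (i - V - 1) + 1 \<noteq> 3 * V - 1" for i using assms(1) by presburger
  show ?thesis
    using assms(6) unfolding s[OF assms(2)] s[OF assms(4)]
    using assms(1-5) mid[of k] mid[of l] by (simp split: if_splits)
qed

lemma heap_cs_less:
  assumes "V > 0" "1 \<le> k" "k \<le> 2 * V + 1"
  shows "heap_cs k < 3 * V"
proof (cases "k = 1")
  case False
  then have "(k - 2) div 2 < V" using assms by linarith
  moreover have "k mod 2 < 2" by simp
  ultimately have "3 * ((k - 2) div 2) + 1 + k mod 2 < 3 * V" by linarith
  then show ?thesis using False by (simp add: heap_cs_def)
qed (use assms in \<open>simp add: heap_cs_def\<close>)

lemma heap_cs_onto:
  assumes a: "a < 3 * V" "a = 0 \<or> a mod 3 \<noteq> 0"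
  shows "\<exists>k\<ge>1. k \<le> 2 * V + 1 \<and> heap_cs k = a"
proof -
  have dm: "a = 3 * (a div 3) + a mod 3" by simp
  have lt: "a div 3 < V" using div3_less[OF a(1)] .
  consider "a = 0" | "a mod 3 = 1" | "a mod 3 = 2" using a(2) by linarith
  then show ?thesis
  proof cases
    case 1
    then show ?thesis by (intro exI[of _ 1]) (simp add: heap_cs_def)
  next
    case 2
    have "heap_cs (2 * (a div 3) + 2) = 3 * (a div 3) + 1" by (simp add: heap_cs_def)
    then show ?thesis using dm 2 lt by (intro exI[of _ "2 * (a div 3) + 2"]) simp
  next
    case 3
    have "(2 * (a div 3) + 3) mod 2 = 1" "(2 * (a div 3) + 3 - 2) div 2 = a div 3" by presburger+
    then have "heap_cs (2 * (a div 3) + 3) = 3 * (a div 3) + 2" by (simp add: heap_cs_def)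
    then show ?thesis using dm 3 lt by (intro exI[of _ "2 * (a div 3) + 3"]) simp
  qed
qed

lemma heap_cs_parent: "0 < v \<Longrightarrow> heap_cs v < 3 * v"
  unfolding heap_cs_def by (simp, linarith)

text \<open>Free ends are counted downwards, end \<open>j\<close> having the index
  \<open>2 * V + 1 - j\<close>. The first \<open>g\<close> ends and then the \<open>p\<close> leaves
  are matched with the remaining \<open>g + p\<close> ends according to the permutation
  \<open>zs\<close>.\<close>

definition spine_pairs :: "nat \<Rightarrow> nat \<Rightarrow> nat list \<Rightarrow> (nat \<times> nat) list" where
  "spine_pairs g p zs = (let V = 2 * g + p - 2 in map (\<lambda>v. (3 * v, spine_cs V v)) [1..<V]
     @ map (\<lambda>i. (if i < g then spine_cs V (2 * V + 1 - i) else 3 * V + (i - g), spine_cs V (2 * V + 1 - (g + zs ! i)))) [0..<g + p])"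

lemma spine_graph:
  assumes V: "V = 2 * g + p - 2" "V > 0" and zs: "length zs = g + p" "distinct zs" "set zs = {..<g + p}"
  shows "slot_graph V p (pairing (spine_pairs g p zs))" "distinct (flat (spine_pairs g p zs))"
proof -
  let ?F = "\<lambda>j. spine_cs V (2 * V + 1 - j)"
  let ?es = "map (\<lambda>i. (if i < g then ?F i else 3 * V + (i - g), ?F (g + zs ! i))) [0..<g + p]"
  have n: "2 * g + p = V + 2" using V by simp
  have "(\<lambda>i. ?F (g + zs ! i)) ` {..<g + p} = (\<lambda>j. ?F (g + j)) ` ((!) zs ` {..<g + p})" by (simp add: image_image)
  also have "(!) zs ` {..<g + p} = {..<g + p}" using zs(1,3) by (simp add: set_conv_nth image_def) blast
  finally have 2: "(\<lambda>i. ?F (g + zs ! i)) ` {..<g + p} = (\<lambda>j. ?F (g + j)) ` {..<g + p}" .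
  have flat: "set (flat ?es) = (\<lambda>i. if i < g then ?F i else 3 * V + (i - g)) ` {..<g + p} \<union> (\<lambda>j. ?F (g + j)) ` {..<g + p}"
    unfolding set_flat_map set_upt atLeast0LessThan 2 ..
  have "set (flat ?es) = ?F ` {..<V + 2} \<union> {3 * V..<3 * V + p}"
    unfolding flat
  proof (intro subset_antisym subsetI)
    fix a assume "a \<in> (\<lambda>i. if i < g then ?F i else 3 * V + (i - g)) ` {..<g + p} \<union> (\<lambda>j. ?F (g + j)) ` {..<g + p}"
    then show "a \<in> ?F ` {..<V + 2} \<union> {3 * V..<3 * V + p}"
    proof (elim UnE imageE)
      fix i assume a: "a = (if i < g then ?F i else 3 * V + (i - g))" "i \<in> {..<g + p}"
      show ?thesis
      proof (cases "i < g")
        case True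
        then show ?thesis using a(1) n by (intro UnI1 image_eqI[of _ _ i]) simp_all
      next
        case False
        then have "a = 3 * V + (i - g)" "i - g < p" using a by simp_all
        then show ?thesis by simp
      qed
    next
      fix j assume "a = ?F (g + j)" "j \<in> {..<g + p}"
      then show ?thesis using n by (intro UnI1 image_eqI[of _ _ "g + j"]) simp_all
    qed
  next
    fix a assume "a \<in> ?F ` {..<V + 2} \<union> {3 * V..<3 * V + p}"
    then show "a \<in> (\<lambda>i. if i < g then ?F i else 3 * V + (i - g)) ` {..<g + p} \<union> (\<lambda>j. ?F (g + j)) ` {..<g + p}"
    proof (elim UnE imageE)
      fix j assume a: "a = ?F j" "j \<in> {..<V + 2}"
      show ?thesis
      proof (cases "j < g")
        case True
        then show ?thesis using a(1) by (intro UnI1 image_eqI[of _ _ j]) simp_all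
      next
        case False
        then show ?thesis using a n by (intro UnI2 image_eqI[of _ _ "j - g"]) simp_all
      qed
    next
      assume "a \<in> {3 * V..<3 * V + p}"
      then obtain d where "a = 3 * V + d" "d < p" using le_Suc_ex[of "3 * V" a] by auto
      then show ?thesis by (intro UnI1 image_eqI[of _ _ "d + g"]) simp_all
    qed
  qed
  then have es: "set (flat ?es) = spine_cs V ` {V..2 * V + 1} \<union> {3 * V..<3 * V + p}" unfolding ends_image .
  have len: "2 * length ?es = V + 2 + p" using n by simp
  have lf: "x < 3 * V \<or> y < 3 * V" if xy: "(x, y) \<in> set ?es" for x y
  proof -
    obtain i where i: "i < g + p" "y = ?F (g + zs ! i)" using xy unfolding set_map set_upt by auto
    have "zs ! i < g + p" using zs i(1) nth_mem[of i zs] by simp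
    then have "1 \<le> 2 * V + 1 - (g + zs ! i)" using n V(2) by linarith
    then have "y < 3 * V" unfolding i(2) by (intro spine_cs_less[OF V(2)]) simp_all
    then show ?thesis by blast
  qed
  have par: "spine_cs V v < 3 * v" if "0 < v" "v < V" for v using that by (simp add: spine_cs_def)
  note * = pairing_slot_graph[of V "spine_cs V" ?es p, OF V(2) spine_cs_less[OF V(2)] spine_cs_onto[OF V(2)] par es len lf]
  have eq: "spine_pairs g p zs = map (\<lambda>v. (3 * v, spine_cs V v)) [1..<V] @ ?es"
    unfolding spine_pairs_def V(1)[symmetric] Let_def ..
  show "slot_graph V p (pairing (spine_pairs g p zs))" "distinct (flat (spine_pairs g p zs))"
    unfolding eq using * by blast+
qed

lemma spine_values:
  assumes V: "V = 2 * g + p - 2" "V > 0" and zs: "length zs = g + p" "distinct zs" "set zs = {..<g + p}"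
  defines "\<rho> \<equiv> pairing (spine_pairs g p zs)"
  shows "\<And>v. 0 < v \<Longrightarrow> v < V \<Longrightarrow> \<rho> (3 * v) = 3 * v - 1 \<and> \<rho> (3 * v - 1) = 3 * v"
    "\<And>i. i < g \<Longrightarrow> \<rho> (spine_cs V (2 * V + 1 - i)) = spine_cs V (2 * V + 1 - (g + zs ! i))
       \<and> \<rho> (spine_cs V (2 * V + 1 - (g + zs ! i))) = spine_cs V (2 * V + 1 - i)"
proof -
  note pp = pairing_pair[OF spine_graph(2)[OF V zs], folded \<rho>_def]
  fix v assume v: "0 < v" "v < V"
  then have "(3 * v, spine_cs V v) \<in> set (spine_pairs g p zs)"
    unfolding spine_pairs_def V(1)[symmetric] Let_def by auto
  from pp[OF this] show "\<rho> (3 * v) = 3 * v - 1 \<and> \<rho> (3 * v - 1) = 3 * v" using v by (simp add: spine_cs_def)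
next
  note pp = pairing_pair[OF spine_graph(2)[OF V zs], folded \<rho>_def]
  fix i assume i: "i < g"
  let ?f = "\<lambda>i. (if i < g then spine_cs V (2 * V + 1 - i) else 3 * V + (i - g), spine_cs V (2 * V + 1 - (g + zs ! i)))"
  have "?f i \<in> ?f ` set [0..<g + p]" by (rule imageI) (use i in simp)
  then have "?f i \<in> set (spine_pairs g p zs)"
    unfolding spine_pairs_def V(1)[symmetric] Let_def set_append set_map by blast
  then have "(spine_cs V (2 * V + 1 - i), spine_cs V (2 * V + 1 - (g + zs ! i))) \<in> set (spine_pairs g p zs)" using i by simp
  from pp[OF this] show "\<rho> (spine_cs V (2 * V + 1 - i)) = spine_cs V (2 * V + 1 - (g + zs ! i))
       \<and> \<rho> (spine_cs V (2 * V + 1 - (g + zs ! i))) = spine_cs V (2 * V + 1 - i)" by blast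
qed

text \<open>Under this permutation end \<open>i\<close> meets end \<open>g + p + i\<close> for
  \<open>i < g\<close>, across the block of leaves, which occupy the \<open>p\<close> ends from
  \<open>g\<close> on. For \<open>g > 0\<close> these ends lie on different vertices.\<close>

definition shifted :: "nat \<Rightarrow> nat \<Rightarrow> nat list" where
  "shifted g p = [p..<g + p] @ [0..<p]"

lemma shifted: "length (shifted g p) = g + p" "distinct (shifted g p)" "set (shifted g p) = {..<g + p}"
  unfolding shifted_def by auto

text \<open>An inner vertex of the spine has two neighbours on the spine, so only the two extreme
  vertices could count. For \<open>g = 0\<close> each may carry two leaves; otherwise the shift
  joins the outermost ends to other vertices. The pair \<open>(1, 1)\<close> is the exception: its
  single trivalent vertex carries a loop.\<close>

lemma spine_busy:
  assumes V: "V = 2 * g + p - 2" "V > 0" and ex: "(g, p) \<noteq> (1, 1)"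
  shows "num_busy V (pairing (spine_pairs g p (shifted g p))) \<le> (if g = 0 then 2 else 0)"
proof -
  define \<rho> where "\<rho> = pairing (spine_pairs g p (shifted g p))"
  note sv = spine_values[OF V shifted, folded \<rho>_def]
  have sg: "slot_graph V p \<rho>" unfolding \<rho>_def by (rule spine_graph(1)[OF V shifted])
  have inv: "\<rho> (\<rho> c) = c" for c using sg unfolding slot_graph_def by blast
  have ne: "\<rho> c \<noteq> c" if "c < 3 * V" for c
  proof -
    have "c < 3 * V + p \<longleftrightarrow> \<rho> c \<noteq> c" using sg unfolding slot_graph_def by blast
    then show ?thesis using that by simp
  qed
  have mid: "\<not> busy V \<rho> v" if v: "0 < v" "v + 1 < V" for v
  proof (rule not_busy[of "3 * v" _ "3 * v + 2"])
    have 1: "\<rho> (3 * v) = 3 * v - 1" using sv(1)[of v] v by simp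
    have 2: "\<rho> (3 * v + 2) = 3 * (v + 1)" using sv(1)[of "v + 1"] v by simp
    show "\<rho> (3 * v) < 3 * V" "\<rho> (3 * v + 2) < 3 * V" unfolding 1 2 using v by simp_all
    show "\<rho> (3 * v) div 3 \<noteq> v" unfolding 1 using v by presburger
    show "\<rho> (3 * v + 2) div 3 \<noteq> v" unfolding 2 by simp
  qed (use v inv ne in simp_all)
  have "num_busy V \<rho> \<le> (if g = 0 then 2 else 0)"
  proof (cases "g = 0")
    case True
    have "{v. v < V \<and> busy V \<rho> v} \<subseteq> {0, V - 1}"
    proof
      fix v assume "v \<in> {v. v < V \<and> busy V \<rho> v}"
      then have "v < V" "\<not> (0 < v \<and> v + 1 < V)" using mid by blast+
      then show "v \<in> {0, V - 1}" by auto
    qed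
    then have "num_busy V \<rho> \<le> card {0, V - 1}" unfolding num_busy_def by (intro card_mono) simp_all
    also have "\<dots> \<le> 2" by (simp add: card_insert_if)
    finally show ?thesis using True by simp
  next
    case False
    then have g: "g \<ge> 1" by simp
    have V2: "V \<ge> 2"
    proof (rule ccontr)
      assume "\<not> 2 \<le> V"
      then have "2 * g + p = 3" using V by simp
      then have "g = 1" "p = 1" using g by presburger+
      then show False using ex by simp
    qed
    have rot: "shifted g p ! i = p + i" if "i < g" for i
      using that by (simp add: shifted_def nth_append)
    \<comment> \<open>Slot \<open>3 * V - 1\<close> is end 0, which is joined to end
      \<open>g + p\<close>.\<close>
    have first: "\<not> busy V \<rho> (V - 1)"
    proof (rule not_busy[of "3 * (V - 1)" _ "3 * V - 1"])
      have 1: "\<rho> (3 * (V - 1)) = 3 * (V - 1) - 1" using sv(1)[of "V - 1"] V2 by simp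
      have "spine_cs V (2 * V + 1 - 0) = 3 * V - 1" by (simp add: spine_cs_def)
      then have 2: "\<rho> (3 * V - 1) = spine_cs V (2 * V + 1 - (g + p))" using sv(2)[of 0] g rot[of 0] by simp
      have 3: "spine_cs V (2 * V + 1 - (g + p)) = (if g = 1 then 0 else 3 * (g - 2) + 1)"
      proof (cases "g = 1")
        case True
        then have "2 * V + 1 - (g + p) = V" using V by simp
        then show ?thesis using True by (simp add: spine_cs_def)
      next
        case False
        then have "g \<ge> 2" using g by simp
        then have k: "2 * V + 1 - (g + p) - V - 1 = g - 2" "V < 2 * V + 1 - (g + p)" "2 * V + 1 - (g + p) \<le> 2 * V"
          using V by linarith+
        then show ?thesis using False unfolding spine_cs_def by simp
      qed
      show "\<rho> (3 * (V - 1)) < 3 * V" unfolding 1 using V2 by simp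
      have gl: "g - 2 < V - 1" using V V2 g by linarith
      have "3 * (g - 2) + 1 < 3 * V" using gl by linarith
      then show "\<rho> (3 * V - 1) < 3 * V" unfolding 2 3 using V2 by simp
      show "\<rho> (3 * (V - 1)) div 3 \<noteq> V - 1" unfolding 1 using V2 by presburger
      have "(3 * (g - 2) + 1) div 3 = g - 2" by presburger
      then show "\<rho> (3 * V - 1) div 3 \<noteq> V - 1" unfolding 2 3 using gl V2 by simp
      show "3 * (V - 1) \<noteq> 3 * V - 1" "(3 * V - 1) div 3 = V - 1" using V2 by presburger+
    qed (use inv ne V2 in simp_all)
    \<comment> \<open>Slot 0 is the last end \<open>2 * g + p - 1\<close>, which is joined to end
      \<open>g - 1\<close>.\<close>
    have last: "\<not> busy V \<rho> 0"
    proof (rule not_busy[of 2 _ 0])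
      have 1: "\<rho> 2 = 3" using sv(1)[of 1] V2 by simp
      have e0: "spine_cs V V = 0" by (simp add: spine_cs_def)
      have "2 * V + 1 - (g + (p + (g - 1))) = V" using V g by simp
      then have 2: "\<rho> 0 = spine_cs V (2 * V + 1 - (g - 1))"
        using sv(2)[of "g - 1"] g rot[of "g - 1"] e0 by simp
      have 3: "spine_cs V (2 * V + 1 - (g - 1)) = (if g = 1 then 3 * V - 1 else 3 * (g + p - 1) + 1)"
      proof (cases "g = 1")
        case True
        then show ?thesis by (simp add: spine_cs_def)
      next
        case False
        then have k: "2 * V + 1 - (g - 1) - V - 1 = g + p - 1" "V < 2 * V + 1 - (g - 1)" "2 * V + 1 - (g - 1) \<le> 2 * V"
          using V g by linarith+
        then show ?thesis using False unfolding spine_cs_def by simp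
      qed
      show "\<rho> 2 < 3 * V" unfolding 1 using V2 by simp
      show "\<rho> 0 < 3 * V" unfolding 2 3 using V V2 g by (auto split: if_splits)
      show "\<rho> 2 div 3 \<noteq> 0" unfolding 1 by simp
      show "\<rho> 0 div 3 \<noteq> 0" unfolding 2 3 using V V2 g by (auto split: if_splits)
    qed (use inv ne V2 in simp_all)
    have "{v. v < V \<and> busy V \<rho> v} = {}"
    proof (rule equals0I)
      fix v assume "v \<in> {v. v < V \<and> busy V \<rho> v}"
      then have v: "v < V" "busy V \<rho> v" by blast+
      then have "\<not> (0 < v \<and> v + 1 < V)" using mid by blast
      then have "v = 0 \<or> v = V - 1" using v by linarith
      then show False using v first last by blast
    qed
    then show ?thesis unfolding num_busy_def by (simp only: card.empty)
  qed
  then show ?thesis unfolding \<rho>_def .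
qed

definition heap_pairs :: "nat \<Rightarrow> nat \<Rightarrow> (nat \<times> nat) list" where
  "heap_pairs g p = (let V = 2 * g + p - 2 in map (\<lambda>v. (3 * v, heap_cs v)) [1..<V]
     @ (map (\<lambda>i. (heap_cs (2 * V + 1 - 2 * i), heap_cs (2 * V + 1 - (2 * i + 1)))) [0..<g]
       @ map (\<lambda>j. (heap_cs (2 * V + 1 - (2 * g + j)), 3 * V + j)) [0..<p]))"

lemma heap_graph:
  assumes V: "V = 2 * g + p - 2" "V > 0"
  shows "slot_graph V p (pairing (heap_pairs g p))" "distinct (flat (heap_pairs g p))"
proof -
  let ?F = "\<lambda>j. heap_cs (2 * V + 1 - j)"
  let ?es = "map (\<lambda>i. (?F (2 * i), ?F (2 * i + 1))) [0..<g] @ map (\<lambda>j. (?F (2 * g + j), 3 * V + j)) [0..<p]"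
  have n: "2 * g + p = V + 2" using V by simp
  have flat: "set (flat ?es) = ((\<lambda>i. ?F (2 * i)) ` {..<g} \<union> (\<lambda>i. ?F (2 * i + 1)) ` {..<g})
     \<union> ((\<lambda>j. ?F (2 * g + j)) ` {..<p} \<union> (\<lambda>j. 3 * V + j) ` {..<p})"
    unfolding map_append concat_append set_append set_flat_map set_upt atLeast0LessThan ..
  have "set (flat ?es) = ?F ` {..<V + 2} \<union> {3 * V..<3 * V + p}"
    unfolding flat
  proof (intro subset_antisym subsetI)
    fix a assume "a \<in> ((\<lambda>i. ?F (2 * i)) ` {..<g} \<union> (\<lambda>i. ?F (2 * i + 1)) ` {..<g})
     \<union> ((\<lambda>j. ?F (2 * g + j)) ` {..<p} \<union> (\<lambda>j. 3 * V + j) ` {..<p})"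
    then show "a \<in> ?F ` {..<V + 2} \<union> {3 * V..<3 * V + p}"
    proof (elim UnE imageE)
      fix i assume "a = ?F (2 * i)" "i \<in> {..<g}"
      then show ?thesis using n by (intro UnI1 image_eqI[of _ _ "2 * i"]) simp_all
    next
      fix i assume "a = ?F (2 * i + 1)" "i \<in> {..<g}"
      then show ?thesis using n by (intro UnI1 image_eqI[of _ _ "2 * i + 1"]) simp_all
    next
      fix j assume "a = ?F (2 * g + j)" "j \<in> {..<p}"
      then show ?thesis using n by (intro UnI1 image_eqI[of _ _ "2 * g + j"]) simp_all
    qed simp
  next
    fix a assume "a \<in> ?F ` {..<V + 2} \<union> {3 * V..<3 * V + p}"
    then show "a \<in> ((\<lambda>i. ?F (2 * i)) ` {..<g} \<union> (\<lambda>i. ?F (2 * i + 1)) ` {..<g})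
     \<union> ((\<lambda>j. ?F (2 * g + j)) ` {..<p} \<union> (\<lambda>j. 3 * V + j) ` {..<p})"
    proof (elim UnE imageE)
      fix j assume a: "a = ?F j" "j \<in> {..<V + 2}"
      have dm: "j = 2 * (j div 2) + j mod 2" by simp
      consider "j < 2 * g" "j mod 2 = 0" | "j < 2 * g" "j mod 2 = 1" | "2 * g \<le> j" by linarith
      then show ?thesis
      proof cases
        case 1
        then show ?thesis using a(1) dm by (intro UnI1 UnI1 image_eqI[of _ _ "j div 2"]) simp_all
      next
        case 2
        have "j = 2 * (j div 2) + 1" "j div 2 < g" using dm 2 by linarith+
        then have "a \<in> (\<lambda>i. ?F (2 * i + 1)) ` {..<g}" using a(1) by (intro image_eqI[of _ _ "j div 2"]) simp_all
        then show ?thesis by blast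
      next
        case 3
        then have "a \<in> (\<lambda>j. ?F (2 * g + j)) ` {..<p}" using a n by (intro image_eqI[of _ _ "j - 2 * g"]) simp_all
        then show ?thesis by blast
      qed
    next
      assume "a \<in> {3 * V..<3 * V + p}"
      then have "a = 3 * V + (a - 3 * V)" "a - 3 * V < p" unfolding atLeastLessThan_iff by linarith+
      then have "a \<in> (\<lambda>j. 3 * V + j) ` {..<p}" by blast
      then show ?thesis by blast
    qed
  qed
  then have es: "set (flat ?es) = heap_cs ` {V..2 * V + 1} \<union> {3 * V..<3 * V + p}" unfolding ends_image .
  have len: "2 * length ?es = V + 2 + p" using n by simp
  have FV: "?F j < 3 * V" if "j < V + 2" for j by (rule heap_cs_less[OF V(2)]) (use that V(2) in simp_all)
  have lf: "x < 3 * V \<or> y < 3 * V" if xy: "(x, y) \<in> set ?es" for x y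
  proof -
    have "(\<exists>i<g. x = ?F (2 * i)) \<or> (\<exists>j<p. x = ?F (2 * g + j))" using xy by auto
    then have "x < 3 * V" using FV n by (elim disjE exE conjE) simp_all
    then show ?thesis by blast
  qed
  have par: "heap_cs v < 3 * v" if "0 < v" "v < V" for v by (rule heap_cs_parent[OF that(1)])
  note * = pairing_slot_graph[of V heap_cs ?es p, OF V(2) heap_cs_less[OF V(2)] heap_cs_onto par es len lf]
  have eq: "heap_pairs g p = map (\<lambda>v. (3 * v, heap_cs v)) [1..<V] @ ?es"
    unfolding heap_pairs_def V(1)[symmetric] Let_def ..
  show "slot_graph V p (pairing (heap_pairs g p))" "distinct (flat (heap_pairs g p))"
    unfolding eq using * by blast+
qed

text \<open>Ends \<open>2 * i\<close> and \<open>2 * i + 1\<close> are both slots of vertex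
  \<open>V - 1 - i\<close>. The first \<open>g\<close> such pairs are closed to loops, and the next
  \<open>p div 2\<close> pairs carry two leaves each.\<close>

lemma heap_busy:
  assumes V: "V = 2 * g + p - 2" "V > 0"
  shows "g + p div 2 \<le> num_busy V (pairing (heap_pairs g p))"
proof -
  let ?\<rho> = "pairing (heap_pairs g p)"
  note pp = pairing_pair[OF heap_graph(2)[OF V]]
  have n: "2 * g + p = V + 2" using V by simp
  have iV: "i < V" if "i < g + p div 2" for i
  proof -
    define h where "h = p div 2"
    have "2 * h \<le> p" unfolding h_def by simp
    moreover have "i < g + h" using that by (simp add: h_def)
    ultimately show ?thesis using n V(2) by linarith
  qed
  have F: "heap_cs (2 * V + 1 - 2 * i) = 3 * (V - 1 - i) + 2" "heap_cs (2 * V + 1 - (2 * i + 1)) = 3 * (V - 1 - i) + 1"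
    if iV: "i < V" for i
  proof -
    define d where "d = V - 1 - i"
    have d: "V = i + 1 + d" using iV by (simp add: d_def)
    have "2 * V + 1 - 2 * i = 2 * d + 3" "2 * V + 1 - (2 * i + 1) = 2 * d + 2" "V - 1 - i = d" using d by simp_all
    moreover have "(2 * d + 3) mod 2 = 1" "(2 * d + 3 - 2) div 2 = d" by presburger+
    ultimately show "heap_cs (2 * V + 1 - 2 * i) = 3 * (V - 1 - i) + 2" "heap_cs (2 * V + 1 - (2 * i + 1)) = 3 * (V - 1 - i) + 1"
      by (simp_all add: heap_cs_def)
  qed
  have dv: "(3 * w + 2) div 3 = w" "(3 * w + 1) div 3 = w" for w :: nat by presburger+
  have "busy V ?\<rho> (V - 1 - i)" if i: "i < g + p div 2" for i
  proof (cases "i < g")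
    case True
    have "(heap_cs (2 * V + 1 - 2 * i), heap_cs (2 * V + 1 - (2 * i + 1))) \<in> set (heap_pairs g p)"
      unfolding heap_pairs_def V(1)[symmetric] Let_def using True by auto
    then have "?\<rho> (3 * (V - 1 - i) + 2) = 3 * (V - 1 - i) + 1" using pp(1) unfolding F[OF iV[OF i]] by blast
    moreover have "3 * (V - 1 - i) + 1 < 3 * V" using V(2) by linarith
    ultimately have "(3 * (V - 1 - i) + 2) div 3 = V - 1 - i \<and> ?\<rho> (3 * (V - 1 - i) + 2) < 3 * V \<and> ?\<rho> (3 * (V - 1 - i) + 2) div 3 = V - 1 - i"
      using dv[of "V - 1 - i"] by simp
    then show ?thesis unfolding busy_def by - (rule disjI1, rule exI)
  next
    case False
    define j where "j = 2 * (i - g)"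
    have j: "2 * i = 2 * g + j" "2 * i + 1 = 2 * g + (j + 1)" "j + 1 < p" using False i unfolding j_def by linarith+
    have "(heap_cs (2 * V + 1 - (2 * g + k)), 3 * V + k) \<in> set (heap_pairs g p)" if "k < p" for k
      unfolding heap_pairs_def V(1)[symmetric] Let_def using that by auto
    note pk = pp(1)[OF this]
    have "?\<rho> (3 * (V - 1 - i) + 2) = 3 * V + j" using pk[of j] j(3) unfolding j(1)[symmetric] F[OF iV[OF i]] by simp
    moreover have "?\<rho> (3 * (V - 1 - i) + 1) = 3 * V + (j + 1)" using pk[of "j + 1"] j(3) unfolding j(2)[symmetric] F[OF iV[OF i]] by simp
    ultimately have "3 * (V - 1 - i) + 2 \<noteq> 3 * (V - 1 - i) + 1 \<and> (3 * (V - 1 - i) + 2) div 3 = V - 1 - i \<and> (3 * (V - 1 - i) + 1) div 3 = V - 1 - i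
      \<and> 3 * V \<le> ?\<rho> (3 * (V - 1 - i) + 2) \<and> 3 * V \<le> ?\<rho> (3 * (V - 1 - i) + 1)"
      using dv[of "V - 1 - i"] by simp
    then show ?thesis unfolding busy_def
      by - (rule disjI2, rule exI[of _ "3 * (V - 1 - i) + 2"], rule exI[of _ "3 * (V - 1 - i) + 1"])
  qed
  then have "(\<lambda>i. V - 1 - i) ` {..<g + p div 2} \<subseteq> {v. v < V \<and> busy V ?\<rho> v}" using V(2) by auto
  moreover have "inj_on (\<lambda>i. V - 1 - i) {..<g + p div 2}"
  proof (rule inj_onI)
    fix i j assume "i \<in> {..<g + p div 2}" "j \<in> {..<g + p div 2}" "V - 1 - i = V - 1 - j"
    then show "i = j" using iV[of i] iV[of j] by simp
  qed
  ultimately have "card {..<g + p div 2} \<le> num_busy V ?\<rho>" unfolding num_busy_def by (intro card_inj_on_le) auto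
  then show ?thesis by simp
qed

section \<open>Counting caterpillar graphs up to isomorphism\<close>

text \<open>An isomorphism from a graph of the family is determined along the spine by the image of one vertex
  and the residues of the images of the slots.\<close>

lemma spine_determined:
  fixes \<phi> \<psi> \<rho> :: "nat \<Rightarrow> nat"
  assumes V: "V = 2 * g + p - 2" "V > 0"
    and xs: "length xs = g + p" "distinct xs" "set xs = {..<g + p}"
    and ys: "length ys = g + p" "distinct ys" "set ys = {..<g + p}"
    and \<phi>: "\<forall>a<3 * V + p. \<phi> (pairing (spine_pairs g p xs) a) = \<rho> (\<phi> a)"
    and \<psi>: "\<forall>a<3 * V + p. \<psi> (pairing (spine_pairs g p ys) a) = \<rho> (\<psi> a)"
    and div: "\<forall>a<3 * V. \<forall>b<3 * V. a div 3 = b div 3 \<longleftrightarrow> \<phi> a div 3 = \<phi> b div 3"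
      "\<forall>a<3 * V. \<forall>b<3 * V. a div 3 = b div 3 \<longleftrightarrow> \<psi> a div 3 = \<psi> b div 3"
    and inj: "inj_on \<phi> {..<3 * V + p}"
    and code: "\<phi> 0 div 3 = \<psi> 0 div 3" "\<forall>a<3 * V. \<phi> a mod 3 = \<psi> a mod 3"
    and i: "i < g"
  shows "xs ! i = ys ! i"
proof -
  note sx = spine_values[OF V xs] and sy = spine_values[OF V ys]
  \<comment> \<open>One image together with the residues fixes the images of all three slots of a
    vertex.\<close>
  have eq0: "\<phi> (3 * v) = \<psi> (3 * v) \<Longrightarrow> v < V \<Longrightarrow> a div 3 = v \<Longrightarrow> \<phi> a = \<psi> a" for v a
  proof -
    assume e: "\<phi> (3 * v) = \<psi> (3 * v)" and v: "v < V" "a div 3 = v"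
    have a: "a < 3 * V" "3 * v < 3 * V" "a div 3 = 3 * v div 3"
      using v div3_cong_less[of a "3 * v" V] by simp_all
    have "\<phi> a div 3 = \<phi> (3 * v) div 3" using div(1)[rule_format, OF a(1,2)] a(3) by blast
    moreover have "\<psi> a div 3 = \<psi> (3 * v) div 3" using div(2)[rule_format, OF a(1,2)] a(3) by blast
    ultimately have "\<phi> a div 3 = \<psi> a div 3" using e by simp
    then show ?thesis using code(2)[rule_format, OF a(1)] by (rule eq_div_mod3)
  qed
  \<comment> \<open>Along the spine slot \<open>3 * v + 2\<close> is joined to slot
    \<open>3 * (v + 1)\<close> in both graphs, and both maps turn this edge into one application of
    \<open>\<rho>\<close>.\<close>
  have base: "\<phi> (3 * v) = \<psi> (3 * v)" if "v < V" for v
    using that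
  proof (induction v)
    case 0
    have "\<phi> 0 mod 3 = \<psi> 0 mod 3" using code(2) V(2) by simp
    then show ?case using eq_div_mod3[OF code(1)] by simp
  next
    case (Suc v)
    have "\<phi> (3 * v) = \<psi> (3 * v)" using Suc by simp
    then have e: "\<phi> (3 * v + 2) = \<psi> (3 * v + 2)" by (rule eq0) (use Suc.prems in simp_all)
    have s: "3 * Suc v - 1 = 3 * v + 2" by simp
    have "pairing (spine_pairs g p xs) (3 * v + 2) = 3 * Suc v" "pairing (spine_pairs g p ys) (3 * v + 2) = 3 * Suc v"
      using sx(1)[of "Suc v"] sy(1)[of "Suc v"] Suc.prems unfolding s by simp_all
    moreover have "3 * v + 2 < 3 * V + p" using Suc.prems by simp
    ultimately have "\<phi> (3 * Suc v) = \<rho> (\<phi> (3 * v + 2))" "\<psi> (3 * Suc v) = \<rho> (\<psi> (3 * v + 2))"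
      using \<phi>[rule_format, of "3 * v + 2"] \<psi>[rule_format, of "3 * v + 2"] by simp_all
    then show ?case using e by simp
  qed
  have eq: "\<phi> a = \<psi> a" if "a < 3 * V" for a
    using eq0[OF base[OF div3_less[OF that]] div3_less[OF that] HOL.refl] .
  let ?F = "\<lambda>j. spine_cs V (2 * V + 1 - j)"
  have n: "2 * g + p = V + 2" using V by simp
  have FV: "?F j < 3 * V" if "j < V + 2" for j by (rule spine_cs_less[OF V(2)]) (use that V(2) in simp_all)
  have "xs ! i < g + p" "ys ! i < g + p" using nth_mem[of i xs] nth_mem[of i ys] xs ys i by simp_all
  then have j: "g + xs ! i < V + 2" "g + ys ! i < V + 2" "i < V + 2" using n i by linarith+
  \<comment> \<open>Both maps send end \<open>i\<close> to the same slot, so its partners under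
    \<open>xs\<close> and \<open>ys\<close> have the same image, and injectivity identifies
    them.\<close>
  have "?F i < 3 * V + p" using FV[OF j(3)] by simp
  then have "\<phi> (?F (g + xs ! i)) = \<rho> (\<phi> (?F i))" "\<psi> (?F (g + ys ! i)) = \<rho> (\<psi> (?F i))"
    using \<phi>[rule_format, of "?F i"] \<psi>[rule_format, of "?F i"] sx(2)[OF i] sy(2)[OF i] by simp_all
  then have "\<phi> (?F (g + xs ! i)) = \<phi> (?F (g + ys ! i))"
    using eq[OF FV[OF j(3)]] eq[OF FV[OF j(2)]] by simp
  moreover have "?F (g + xs ! i) \<in> {..<3 * V + p}" "?F (g + ys ! i) \<in> {..<3 * V + p}" using FV[OF j(1)] FV[OF j(2)] by simp_all
  ultimately have e: "?F (g + xs ! i) = ?F (g + ys ! i)" by (rule inj_onD[OF inj])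
  have "2 * V + 1 - (g + xs ! i) = 2 * V + 1 - (g + ys ! i)"
    by (rule spine_cs_inj[OF V(2) _ _ _ _ e]) (use j in simp_all)
  then show ?thesis using j V(2) by linarith
qed

text \<open>Only the partners of the first \<open>g\<close> ends are varied; the leaves take what
  remains in increasing order, an arbitrary choice because they have no labels.\<close>

definition extension :: "nat \<Rightarrow> nat list \<Rightarrow> nat list" where
  "extension n xs = xs @ sorted_list_of_set ({..<n} - set xs)"

lemma extension:
  assumes "distinct xs" "set xs \<subseteq> {..<n}"
  shows "length (extension n xs) = n" "distinct (extension n xs)" "set (extension n xs) = {..<n}"
proof -
  show d: "distinct (extension n xs)" using assms(1) unfolding extension_def by simp
  show s: "set (extension n xs) = {..<n}" using assms(2) unfolding extension_def by auto
  show "length (extension n xs) = n" using distinct_card[OF d] unfolding s by simp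
qed

section \<open>Lower bounds for the lengths of paths\<close>

definition close_classes :: "nat \<Rightarrow> nat \<Rightarrow> nat \<Rightarrow> bool" where
  "close_classes g p n \<longleftrightarrow> (\<forall>C\<in>graph_classes g p. \<forall>D\<in>graph_classes g p. \<exists>m\<le>n. (C, D) \<in> whitehead_step g p ^^ m)"

lemma close_slot_graphs:
  assumes close: "close_classes g p n" and V: "V > 0" "int V = 2 * int g - 2 + int p"
    and sg: "slot_graph V p \<rho>" "slot_graph V p \<sigma>"
  shows "\<exists>m\<le>n. \<exists>\<rho>'. (slot_move V ^^ m) \<rho> \<rho>' \<and> isomorphic {..<3 * V + p} (slot_vert V) \<sigma> {..<3 * V + p} (slot_vert V) \<rho>'"
proof -
  note c = slot_cubic[OF V sg(1)] slot_cubic[OF V sg(2)]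
  obtain m where m: "m \<le> n" "(iso_class g p {..<3 * V + p} (slot_vert V) \<rho>, iso_class g p {..<3 * V + p} (slot_vert V) \<sigma>) \<in> whitehead_step g p ^^ m"
    using close iso_class_in_classes[OF c(1)] iso_class_in_classes[OF c(2)] unfolding close_classes_def by blast
  then show ?thesis using slot_path[OF c m(2)] by blast
qed

lemma linear_lower_bound:
  assumes close: "close_classes g p n" and pos: "2 * int g - 2 + int p > 0"
    and ex: "(g, p) \<notin> {(0, 3), (0, 4), (0, 5), (1, 1)}"
  shows "g + p \<le> 9 * n"
proof -
  define V where V: "V = 2 * g + p - 2"
  have V0: "V > 0" and Vi: "int V = 2 * int g - 2 + int p" using pos unfolding V by linarith+
  let ?s = "pairing (spine_pairs g p (shifted g p))" and ?h = "pairing (heap_pairs g p)"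
  have sg: "slot_graph V p ?s" by (rule spine_graph(1)[OF V V0 shifted])
  have hg: "slot_graph V p ?h" by (rule heap_graph(1)[OF V V0])
  obtain m \<rho>' where m: "m \<le> n" "(slot_move V ^^ m) ?s \<rho>'" "isomorphic {..<3 * V + p} (slot_vert V) ?h {..<3 * V + p} (slot_vert V) \<rho>'"
    using close_slot_graphs[OF close V0 Vi sg hg] by blast
  have hA: "?h a < 3 * V + p" if "a < 3 * V + p" for a
  proof -
    have "a < 3 * V + p \<longleftrightarrow> ?h a \<noteq> a" "?h a < 3 * V + p \<longleftrightarrow> ?h (?h a) \<noteq> ?h a" "?h (?h a) = a"
      using hg unfolding slot_graph_def by blast+
    then show ?thesis using that by simp
  qed
  have "g + p div 2 \<le> num_busy V ?h" by (rule heap_busy[OF V V0])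
  also have "\<dots> \<le> num_busy V \<rho>'" by (rule num_busy_iso[OF m(3) hA])
  also have "\<dots> \<le> num_busy V ?s + 2 * m" by (rule num_busy_moves[OF m(2)])
  also have "num_busy V ?s \<le> (if g = 0 then 2 else 0)" by (rule spine_busy[OF V V0]) (use ex in simp)
  finally have b: "g + p div 2 \<le> (if g = 0 then 2 else 0) + 2 * m" by simp
  define h where "h = p div 2"
  have h: "p \<le> 2 * h + 1" unfolding h_def by linarith
  show ?thesis
  proof (cases "g = 0")
    case True
    then have "p \<ge> 3" using pos by linarith
    moreover have "p \<noteq> 3" "p \<noteq> 4" "p \<noteq> 5" using ex True by simp_all
    ultimately have "p \<ge> 6" by linarith
    \<comment> \<open>For \<open>g = 0\<close> the caterpillar itself may have two vertices that
      count, so \<open>h \<le> 2 + 2 * m\<close> says something only from \<open>h = 3\<close> on;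
      this is where \<open>p \<le> 5\<close> is lost. The constant 9 comes from
      \<open>p \<le> 5 + 4 * m\<close> with \<open>m \<ge> 1\<close>.\<close>
    then have "h \<ge> 3" unfolding h_def by linarith
    moreover have "h \<le> 2 + 2 * m" using b True unfolding h_def[symmetric] by simp
    ultimately have "1 \<le> m" "p \<le> 5 + 4 * m" using h by linarith+
    then show ?thesis using True m(1) by linarith
  next
    case False
    then show ?thesis using b h m(1) unfolding h_def[symmetric] by simp
  qed
qed

text \<open>The left side counts the injective choices of \<open>g\<close> partners. The right side
  counts their codes: the graph reached, with the script bound for each length up to
  \<open>n\<close>; the vertex to which slot 0 goes; and the residue of the image of each of the
  \<open>3 * V\<close> slots.\<close>

lemma counting_bound:
  assumes close: "close_classes g p n" and pos: "2 * int g - 2 + int p > 0" and V: "V = 2 * g + p - 2"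
  shows "\<Prod>{p + 1..g + p} \<le> (n + 1) * 10 ^ (V + 2 * n) * (V * 3 ^ (3 * V))"
proof -
  have V0: "V > 0" and Vi: "int V = 2 * int g - 2 + int p" using pos unfolding V by linarith+
  let ?A = "{..<3 * V + p}"
  let ?G = "\<lambda>xs. pairing (spine_pairs g p (extension (g + p) xs))"
  let ?s = "pairing (spine_pairs g p (shifted g p))"
  define X where "X = {xs. length xs = g \<and> distinct xs \<and> set xs \<subseteq> {..<g + p}}"
  have cX: "card X = \<Prod>{p + 1..g + p}"
    unfolding X_def using card_lists_distinct_length_eq[of "{..<g + p}" g] by simp
  have sg: "slot_graph V p ?s" by (rule spine_graph(1)[OF V V0 shifted])
  have inv: "?s (?s a) = a" for a using sg unfolding slot_graph_def by blast
  define R where "R = (\<Union>m\<in>{..n}. {\<rho>'. (slot_move V ^^ m) ?s \<rho>'})"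
  have R: "finite R" "card R \<le> (n + 1) * 10 ^ (V + 2 * n)"
  proof -
    have fin: "finite {\<rho>'. (slot_move V ^^ m) ?s \<rho>'}" and c: "card {\<rho>'. (slot_move V ^^ m) ?s \<rho>'} \<le> 10 ^ (V + 2 * m)" for m
      using reachable_card[where \<rho> = ?s and V = V and m = m] inv by simp_all
    show "finite R" unfolding R_def using fin by blast
    have "card R \<le> (\<Sum>m\<in>{..n}. card {\<rho>'. (slot_move V ^^ m) ?s \<rho>'})" unfolding R_def by (rule card_UN_le) simp
    also have "\<dots> \<le> (\<Sum>m\<in>{..n}. 10 ^ (V + 2 * n))"
    proof (rule sum_mono)
      fix m assume "m \<in> {..n}"
      then have "(10::nat) ^ (V + 2 * m) \<le> 10 ^ (V + 2 * n)" by (intro power_increasing) simp_all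
      then show "card {\<rho>'. (slot_move V ^^ m) ?s \<rho>'} \<le> 10 ^ (V + 2 * n)" using c[of m] by linarith
    qed
    also have "\<dots> = (n + 1) * 10 ^ (V + 2 * n)" by simp
    finally show "card R \<le> (n + 1) * 10 ^ (V + 2 * n)" .
  qed
  have ext: "length (extension (g + p) xs) = g + p" "distinct (extension (g + p) xs)" "set (extension (g + p) xs) = {..<g + p}"
    if "xs \<in> X" for xs using extension[of xs "g + p"] that unfolding X_def by blast+
  define P where "P xs r \<phi> \<longleftrightarrow> r \<in> R \<and> bij_betw \<phi> ?A ?A
      \<and> (\<forall>a<3 * V + p. \<phi> (?G xs a) = r (\<phi> a)) \<and> (\<forall>a<3 * V + p. a < 3 * V \<longleftrightarrow> \<phi> a < 3 * V)
      \<and> (\<forall>a<3 * V. \<forall>b<3 * V. a div 3 = b div 3 \<longleftrightarrow> \<phi> a div 3 = \<phi> b div 3)" for xs r \<phi>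
  have "\<exists>q. P xs (fst q) (snd q)" if xs: "xs \<in> X" for xs
  proof -
    have gx: "slot_graph V p (?G xs)" by (rule spine_graph(1)[OF V V0 ext[OF xs]])
    obtain m \<rho>' where m: "m \<le> n" "(slot_move V ^^ m) ?s \<rho>'" "isomorphic ?A (slot_vert V) (?G xs) ?A (slot_vert V) \<rho>'"
      using close_slot_graphs[OF close V0 Vi sg gx] by (elim exE conjE)
    obtain \<phi> where p: "bij_betw \<phi> ?A ?A" "\<forall>a<3 * V + p. \<phi> (?G xs a) = \<rho>' (\<phi> a)"
      "\<forall>a<3 * V + p. a < 3 * V \<longleftrightarrow> \<phi> a < 3 * V"
      "\<forall>a<3 * V. \<forall>b<3 * V. a div 3 = b div 3 \<longleftrightarrow> \<phi> a div 3 = \<phi> b div 3"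
      using isomorphic_slots[OF m(3)] .
    have "\<rho>' \<in> R" unfolding R_def by (rule UN_I[of m]) (use m(1,2) in simp_all)
    then have "P xs \<rho>' \<phi>" unfolding P_def using p by (intro conjI)
    then show ?thesis by (intro exI[of _ "(\<rho>', \<phi>)"]) simp
  qed
  then obtain q where q: "\<And>xs. xs \<in> X \<Longrightarrow> P xs (fst (q xs)) (snd (q xs))" by metis
  define code where "code xs = (fst (q xs), snd (q xs) 0 div 3, \<lambda>a\<in>{..<3 * V}. snd (q xs) a mod 3)" for xs
  let ?T = "R \<times> {..<V} \<times> ({..<3 * V} \<rightarrow>\<^sub>E {..<3::nat})"
  have "inj_on code X"
  proof (rule inj_onI)
    fix xs ys assume x: "xs \<in> X" and y: "ys \<in> X" and e: "code xs = code ys"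
    have e1: "fst (q xs) = fst (q ys)" "snd (q xs) 0 div 3 = snd (q ys) 0 div 3"
      and e2: "(\<lambda>a\<in>{..<3 * V}. snd (q xs) a mod 3) = (\<lambda>a\<in>{..<3 * V}. snd (q ys) a mod 3)"
      using e unfolding code_def by blast+
    have e3: "\<forall>a<3 * V. snd (q xs) a mod 3 = snd (q ys) a mod 3"
    proof (intro allI impI)
      fix a assume "a < 3 * V"
      then show "snd (q xs) a mod 3 = snd (q ys) a mod 3" using fun_cong[OF e2, of a] by simp
    qed
    note qx = q[OF x, unfolded P_def] and qy = q[OF y, unfolded P_def]
    have inj: "inj_on (snd (q xs)) ?A" using qx unfolding bij_betw_def by blast
    have "extension (g + p) xs ! i = extension (g + p) ys ! i" if i: "i < g" for i
    proof (rule spine_determined[OF V V0 ext[OF x] ext[OF y] _ _ _ _ inj e1(2) e3 i])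
      show "\<forall>a<3 * V + p. snd (q xs) (?G xs a) = fst (q xs) (snd (q xs) a)" using qx by blast
      show "\<forall>a<3 * V + p. snd (q ys) (?G ys a) = fst (q xs) (snd (q ys) a)" unfolding e1(1) using qy by blast
      show "\<forall>a<3 * V. \<forall>b<3 * V. a div 3 = b div 3 \<longleftrightarrow> snd (q xs) a div 3 = snd (q xs) b div 3" using qx by blast
      show "\<forall>a<3 * V. \<forall>b<3 * V. a div 3 = b div 3 \<longleftrightarrow> snd (q ys) a div 3 = snd (q ys) b div 3" using qy by blast
    qed
    moreover have "length xs = g" "length ys = g" using x y unfolding X_def by blast+
    ultimately show "xs = ys" by (intro nth_equalityI) (simp_all add: extension_def nth_append)
  qed
  moreover have "code ` X \<subseteq> ?T"
  proof (rule image_subsetI)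
    fix xs assume x: "xs \<in> X"
    have "0 < 3 * V + p" "0 < 3 * V" using V0 by simp_all
    then have "snd (q xs) 0 < 3 * V" using q[OF x] unfolding P_def by blast
    then have "snd (q xs) 0 div 3 < V" by (rule div3_less)
    then show "code xs \<in> ?T" using q[OF x] unfolding code_def P_def by simp
  qed
  moreover have fT: "finite ?T" using R(1) by (intro finite_cartesian_product finite_PiE) simp_all
  ultimately have "card X \<le> card ?T" by (rule card_inj_on_le)
  also have "\<dots> = card R * (V * 3 ^ (3 * V))" by (simp add: card_cartesian_product card_PiE)
  also have "\<dots> \<le> (n + 1) * 10 ^ (V + 2 * n) * (V * 3 ^ (3 * V))" using R(2) by (rule mult_right_mono) simp
  finally show ?thesis unfolding cX .
qed

section \<open>From path lengths to the diameter, and explicit constants\<close>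

lemma diam_le:
  assumes "close_classes g p n"
  shows "whitehead_diam g p \<le> enat n"
  unfolding whitehead_diam_def
proof (rule SUP_least)
  fix x assume "x \<in> graph_classes g p \<times> graph_classes g p"
  then obtain C D where x: "x = (C, D)" "C \<in> graph_classes g p" "D \<in> graph_classes g p" by blast
  then obtain m where m: "m \<le> n" "(C, D) \<in> whitehead_step g p ^^ m" using assms unfolding close_classes_def by blast
  have "whitehead_dist g p C D \<le> enat m" unfolding whitehead_dist_def by (rule INF_lower) (use m(2) in simp)
  also have "\<dots> \<le> enat n" using m(1) by simp
  finally show "(case x of (C, D) \<Rightarrow> whitehead_dist g p C D) \<le> enat n" using x by simp
qed

lemma close_classes_diam:
  assumes "whitehead_diam g p = enat n"
  shows "close_classes g p n"
  unfolding close_classes_def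
proof (intro ballI)
  fix C D assume CD: "C \<in> graph_classes g p" "D \<in> graph_classes g p"
  have "(case (C, D) of (C, D) \<Rightarrow> whitehead_dist g p C D) \<le> whitehead_diam g p"
    unfolding whitehead_diam_def by (rule SUP_upper) (use CD in simp)
  then have d: "whitehead_dist g p C D \<le> enat n" using assms by simp
  show "\<exists>m\<le>n. (C, D) \<in> whitehead_step g p ^^ m"
  proof (rule ccontr)
    assume n: "\<not> (\<exists>m\<le>n. (C, D) \<in> whitehead_step g p ^^ m)"
    \<comment> \<open>This also covers a pair joined by no path, whose distance is infinite.\<close>
    have "enat (Suc n) \<le> whitehead_dist g p C D"
      unfolding whitehead_dist_def
    proof (rule INF_greatest)
      fix m assume "m \<in> {m. (C, D) \<in> whitehead_step g p ^^ m}"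
      then have "\<not> m \<le> n" using n by blast
      then show "enat (Suc n) \<le> enat m" by simp
    qed
    then have "enat (Suc n) \<le> enat n" using d by (rule order_trans)
    then show False by simp
  qed
qed

text \<open>A weak form of Stirling's formula. In the induction step
  \<open>(1 + 1 / N) ^ g \<le> exp 1\<close> because \<open>g \<le> N\<close>.\<close>

lemma power_le_rising:
  "real (g + p) ^ g \<le> exp (real g) * real (\<Prod>{p + 1..g + p})"
proof (induction g)
  case (Suc g)
  define N where "N = real (g + p)"
  define M where "M = real (Suc g + p)"
  define P where "P = real (\<Prod>{p + 1..g + p})"
  have MN: "M = N + 1" unfolding M_def N_def by simp
  have N0: "N \<ge> 0" "real g \<le> N" unfolding N_def by simp_all
  have IH: "N ^ g \<le> exp (real g) * P" using Suc unfolding N_def P_def .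
  have "M ^ g \<le> exp 1 * N ^ g"
  proof (cases "g = 0")
    case False
    then have N: "N > 0" unfolding N_def by simp
    have "M = N * (1 + 1 / N)" using N unfolding MN by (simp add: field_simps)
    then have "M ^ g = N ^ g * (1 + 1 / N) ^ g" by (simp add: power_mult_distrib)
    also have "\<dots> \<le> N ^ g * exp (1 / N) ^ g"
      using N by (intro mult_left_mono power_mono exp_ge_add_one_self) simp_all
    also have "exp (1 / N) ^ g = exp (real g / N)" by (simp add: exp_of_nat_mult[symmetric])
    also have "N ^ g * exp (real g / N) \<le> N ^ g * exp 1"
      using N N0 by (intro mult_left_mono) simp_all
    finally show ?thesis by (simp only: mult.commute)
  qed simp
  also have "\<dots> \<le> exp 1 * (exp (real g) * P)" using IH by (intro mult_left_mono) simp_all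
  finally have "M * M ^ g \<le> M * (exp 1 * (exp (real g) * P))"
    using N0 unfolding MN by (intro mult_left_mono) simp_all
  also have "\<dots> = (exp 1 * exp (real g)) * (M * P)" by (simp only: mult_ac)
  also have "exp 1 * exp (real g) = exp (real (Suc g))" by (simp add: exp_add[symmetric])
  also have "M * P = real (\<Prod>{p + 1..Suc g + p})"
  proof -
    have "{p + 1..Suc g + p} = insert (Suc g + p) {p + 1..g + p}" by auto
    then have "\<Prod>{p + 1..Suc g + p} = (Suc g + p) * \<Prod>{p + 1..g + p}" by simp
    then show ?thesis unfolding M_def P_def by (simp only: of_nat_mult)
  qed
  finally show ?case unfolding M_def by (simp only: power_Suc)
qed simp

text \<open>Base 10 is bounded by \<open>exp 4\<close>, base 3 by \<open>exp 2\<close>, and the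
  factors \<open>n + 1\<close> and \<open>V\<close> by exponentials, which gives the exponent
  \<open>9 * n + 11 * V\<close>. With \<open>V \<le> 2 * (g + p)\<close> and the factor
  \<open>exp g\<close> from \<open>power_le_rising\<close> the 11 becomes 22 + 1 = 23.\<close>

lemma entropy_lower_bound:
  assumes close: "close_classes g p n" and pos: "2 * int g - 2 + int p > 0"
  shows "real g * ln (real (g + p)) \<le> 9 * real n + 23 * real (g + p)"
proof -
  define V where V: "V = 2 * g + p - 2"
  have e2: "(2::real) \<le> exp 1" using exp_ge_add_one_self[of 1] by simp
  have e10: "(10::real) \<le> exp 4"
  proof -
    have "(2::real) ^ 4 \<le> exp 1 ^ 4" using e2 by (intro power_mono) simp_all
    also have "exp 1 ^ 4 = exp (4::real)" by (simp add: exp_of_nat_mult[symmetric])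
    finally show ?thesis by simp
  qed
  have e3: "(3::real) \<le> exp 2" using exp_ge_add_one_self[of 2] by simp
  have "real (\<Prod>{p + 1..g + p}) \<le> real ((n + 1) * 10 ^ (V + 2 * n) * (V * 3 ^ (3 * V)))"
    using counting_bound[OF close pos V] by (simp only: of_nat_le_iff)
  also have "\<dots> = (real n + 1) * 10 ^ (V + 2 * n) * (real V * 3 ^ (3 * V))"
    unfolding of_nat_mult of_nat_power of_nat_add by simp
  also have "\<dots> \<le> exp (real n) * exp 4 ^ (V + 2 * n) * (exp (real V) * exp 2 ^ (3 * V))"
  proof (intro mult_mono power_mono)
    show "real n + 1 \<le> exp (real n)" using exp_ge_add_one_self[of "real n"] by linarith
    show "real V \<le> exp (real V)" using exp_ge_add_one_self[of "real V"] by linarith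
  qed (use e10 e3 in simp_all)
  also have "\<dots> = exp (9 * real n + 11 * real V)"
    by (simp add: exp_of_nat_mult[symmetric] exp_add[symmetric] algebra_simps)
  finally have c: "real (\<Prod>{p + 1..g + p}) \<le> exp (9 * real n + 11 * real V)" .
  have gp: "real (g + p) > 0" using pos by linarith
  have "real (g + p) ^ g \<le> exp (real g) * exp (9 * real n + 11 * real V)"
    by (rule order_trans[OF power_le_rising mult_left_mono[OF c]]) simp
  also have "\<dots> = exp (real g + 9 * real n + 11 * real V)" by (simp add: exp_add[symmetric] add.assoc)
  finally have "ln (real (g + p) ^ g) \<le> real g + 9 * real n + 11 * real V"
    using gp by (metis exp_le_cancel_iff exp_ln zero_less_power)
  moreover have "ln (real (g + p) ^ g) = real g * ln (real (g + p))" using gp by (simp add: ln_realpow)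
  moreover have "real V \<le> 2 * real (g + p)" unfolding V by simp
  ultimately show ?thesis by simp
qed

lemma ex_power_two: "\<exists>k. Suc n \<le> 2 ^ k \<and> 2 ^ k \<le> 2 * Suc n"
proof (induction n)
  case 0
  show ?case by (rule exI[of _ 0]) simp
next
  case (Suc n)
  then obtain k where k: "Suc n \<le> 2 ^ k" "2 ^ k \<le> 2 * Suc n" by blast
  show ?case
  proof (cases "Suc (Suc n) \<le> 2 ^ k")
    case True
    then show ?thesis using k by (intro exI[of _ k]) simp
  next
    case False
    then have "2 ^ k = Suc n" using k by simp
    then show ?thesis by (intro exI[of _ "Suc k"]) simp
  qed
qed

text \<open>From \<open>1 / 2 \<le> ln 2\<close> and \<open>ln 4 \<le> 3\<close> one gets
  \<open>k \<le> 6 + 2 * ln (g + p)\<close>. The coefficient of \<open>g\<close> is then 12 + 4 * 6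
  + 2 = 38, larger than those of \<open>p\<close> and of the logarithmic term.\<close>

lemma diam_upper_bound:
  assumes pos: "2 * int g - 2 + int p > 0"
  shows "\<exists>n. close_classes g p n \<and> real n \<le> 38 * (real g * ln (real (g + p)) + real (g + p))"
proof -
  have gp: "g + p \<ge> 1" using pos by linarith
  obtain k where k: "2 * g + p \<le> 2 ^ k" "2 ^ k \<le> 2 * (2 * g + p)"
  proof -
    have e: "Suc (2 * g + p - 1) = 2 * g + p" using gp by simp
    show ?thesis using ex_power_two[of "2 * g + p - 1"] that unfolding e by blast
  qed
  let ?n = "2 * (3 * (2 * g + p) + g * (2 * k + 1))"
  have "close_classes g p ?n"
    unfolding close_classes_def using classes_connected[OF _ _ pos] k(1) by simp
  moreover have "real ?n \<le> 38 * (real g * ln (real (g + p)) + real (g + p))"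
  proof -
    have l2: "ln (2::real) \<ge> 1 / 2" using ln_le_minus_one[of "1 / 2 :: real"] by (simp add: ln_div)
    have l4: "ln (4::real) \<le> 3" using ln_le_minus_one[of "4 :: real"] by simp
    have l0: "ln (real (g + p)) \<ge> 0" using gp by simp
    have "(2::real) ^ k \<le> 4 * real (g + p)"
    proof -
      have "real (2 ^ k) \<le> real (2 * (2 * g + p))" using k(2) by (simp only: of_nat_le_iff)
      then show ?thesis by simp
    qed
    then have "ln ((2::real) ^ k) \<le> ln (4 * real (g + p))" using gp by (subst ln_le_cancel_iff) simp_all
    moreover have "ln ((2::real) ^ k) = real k * ln 2" by (simp add: ln_realpow)
    moreover have "ln (4 * real (g + p)) = ln 4 + ln (real (g + p))" by (rule ln_mult_pos) (use gp in simp_all)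
    ultimately have "real k * ln 2 \<le> ln 4 + ln (real (g + p))" by simp
    moreover have "real k * (1 / 2) \<le> real k * ln 2" using l2 by (intro mult_left_mono) simp_all
    ultimately have kk: "real k \<le> 6 + 2 * ln (real (g + p))" using l4 by simp
    have "real g * real k \<le> real g * (6 + 2 * ln (real (g + p)))" using kk by (intro mult_left_mono) simp_all
    then have gk: "real g * real k \<le> 6 * real g + 2 * (real g * ln (real (g + p)))" by (simp add: algebra_simps)
    have gl: "real g * ln (real (g + p)) \<ge> 0" using l0 by simp
    have "real ?n = 12 * real g + 6 * real p + 4 * (real g * real k) + 2 * real g" by (simp add: algebra_simps)
    also have "\<dots> \<le> 38 * (real g * ln (real (g + p)) + real (g + p))" using gk gl by simp
    finally show ?thesis .
  qed
  ultimately show ?thesis by blast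
qed

text \<open>For each of the four excluded pairs there is a single graph, so the diameter is 0 while
  the lower estimate would be positive.\<close>

theorem theoremA2:
  shows "\<exists>K::real. K \<ge> 1 \<and> (\<forall>g p :: nat. 2 * int g - 2 + int p > 0 \<longrightarrow>
     ereal_of_enat (whitehead_diam g p)
       \<le> ereal (K * (real g * ln (real (g + p)) + real (g + p)))
     \<and> ((g, p) \<notin> {(0, 3), (0, 4), (0, 5), (1, 1)} \<longrightarrow>
         ereal (1 / K * (real g * ln (real (g + p)) + real (g + p)))
           \<le> ereal_of_enat (whitehead_diam g p)))"
proof (rule exI[of _ 225], intro conjI allI impI)
  fix g p :: nat assume pos: "2 * int g - 2 + int p > 0"
  let ?X = "real g * ln (real (g + p)) + real (g + p)"
  have gp: "g + p \<ge> 1" using pos by linarith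
  have X: "?X \<ge> 0" using gp by simp
  obtain n where n: "close_classes g p n" "real n \<le> 38 * ?X" using diam_upper_bound[OF pos] by blast
  have "ereal_of_enat (whitehead_diam g p) \<le> ereal_of_enat (enat n)"
    using diam_le[OF n(1)] by (simp only: ereal_of_enat_le_iff)
  also have "\<dots> = ereal (real n)" by simp
  also have "\<dots> \<le> ereal (225 * ?X)" using n(2) X by simp
  finally show "ereal_of_enat (whitehead_diam g p) \<le> ereal (225 * ?X)" .
  assume ex: "(g, p) \<notin> {(0, 3), (0, 4), (0, 5), (1, 1)}"
  obtain d where d: "whitehead_diam g p = enat d"
    using diam_le[OF n(1)] by (cases "whitehead_diam g p") simp_all
  have c: "close_classes g p d" by (rule close_classes_diam[OF d])
  have "real (g + p) \<le> real (9 * d)" using linear_lower_bound[OF c pos ex] by (simp only: of_nat_le_iff)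
  \<comment> \<open>The linear bound replaces \<open>g + p\<close> by \<open>9 * d\<close> both in
    the entropy bound and in \<open>?X\<close>, so 9 + 23 * 9 + 9 = 225.\<close>
  then have "?X \<le> 225 * real d" using entropy_lower_bound[OF c pos] by simp
  then have "1 / 225 * ?X \<le> real d" by simp
  then show "ereal (1 / 225 * ?X) \<le> ereal_of_enat (whitehead_diam g p)" unfolding d by simp
qed simp

end
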